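(* Suppose that the noises $\{\xi_t\}$ are i.i.d. with mean $0$ and variance $1$, and that the sampling distribution $\mathsf Z$ satisfies conditions (B1) and (B2) of the context. Then an arm $a\in[K]$ is stable under the generalized Thompson sampling algorithm if and only if it is either a suboptimal arm ($a\in\mathcal A_+$) or the unique optimal arm ($\mathcal A_0=\{a\}$).
   Context: Notation: $[K]=\{1,\dots,K\}$. Bandit model. There are $K$ arms with mean rewards $\mu_1,\dots,\mu_K\in\mathbb R$ and noise level $\sigma>0$. At round $t$ an arm $A_t\in[K]$ is selected and the reward $R_t=\mu_{A_t}+\sigma\xi_t$ is observed, where $\{\xi_t\}$ are i.i.d. standardized noise variables. Let $\mu_*=\max_b\mu_b$, $\Delta_a=\mu_*-\mu_a\ge0$, $\mathcal A_0=\{a:\Delta_a=0\}$ (optimal arms), $\mathcal A_+=\{a:\Delta_a>0\}$ (suboptimal arms). Algorithm (generalized Gaussian Thompson sampling with sampling distribution $\mathsf Z$). Set $\bar n_{a;0}=1$, $\bar\mu_{a;0}=0$ for all $a$. For $t=1,2,\dots$: pull $A_t\in\arg\max_{a\in[K]}\{\bar\mu_{a;t-1}+\sigma\,\bar n_{a;t-1}^{-1/2}Z_{a;t}\}$, where $Z_{\cdot;\cdot}$ are i.i.d. copies of $\mathsf Z$ (independent of the noises), observe $R_t$, and update $\bar n_{a;t}=\bar n_{a;t-1}+\mathbf 1_{A_t=a}$, $\bar\mu_{a;t}=\bar n_{a;t}^{-1}(\bar n_{a;t-1}\bar\mu_{a;t-1}+\mathbf 1_{A_t=a}R_t)$ for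 all $a$. The arm-pull count is $n_{a;T}=\sum_{s=1}^T\mathbf 1_{A_s=a}$. Conditions on $\mathsf Z$. Let $\Phi(z)=\mathbb P(\mathsf Z\le z)$, $\bar\Phi=1-\Phi$. (B1) $\Phi(z)\in(0,1)$ for all $z\in\mathbb R$, $\Phi\in C^1(\mathbb R)$, and $\|\Phi'\|_\infty<\infty$. (B2) For any $c>1$, $\lim_{z\uparrow\infty}\frac{\log z}{-\log\Phi(-z)}=0$ and $\lim_{z\uparrow\infty}\max\{\frac{\log z}{-\log\bar\Phi(z)},\frac{z^2\bar\Phi(cz)}{\bar\Phi(z)}\}=0$. Stability. A bandit algorithm is called stable for arm $a\in[K]$ if there exists a sequence of deterministic real numbers $\{n^*_{a;T}:T\in\mathbb N\}$ such that $n_{a;T}/n^*_{a;T}\to1$ in probability as $T\to\infty$; the arm is then called stable. *)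

theory Defs
  imports "HOL-Probability.Probability"
begin

text \<open>
  Arms are the natural numbers \<open>{1..K}\<close>.  Along a trajectory, \<open>A s\<close> is the arm pulled and
  \<open>R s\<close> the reward observed in round \<open>s \<ge> 1\<close>; the values at index \<open>0\<close> are never used.
\<close>

definition best_mean :: "nat \<Rightarrow> (nat \<Rightarrow> real) \<Rightarrow> real" where
  "best_mean K \<mu> = Max (\<mu> ` {1..K})"

definition gap :: "nat \<Rightarrow> (nat \<Rightarrow> real) \<Rightarrow> nat \<Rightarrow> real" where
  "gap K \<mu> a = best_mean K \<mu> - \<mu> a"

definition optimal_arms :: "nat \<Rightarrow> (nat \<Rightarrow> real) \<Rightarrow> nat set" where
  "optimal_arms K \<mu> = {a \<in> {1..K}. gap K \<mu> a = 0}"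

definition suboptimal_arms :: "nat \<Rightarrow> (nat \<Rightarrow> real) \<Rightarrow> nat set" where
  "suboptimal_arms K \<mu> = {a \<in> {1..K}. gap K \<mu> a > 0}"

primrec nbar :: "(nat \<Rightarrow> nat) \<Rightarrow> nat \<Rightarrow> nat \<Rightarrow> real" where
  "nbar A a 0 = 1"
| "nbar A a (Suc t) = nbar A a t + of_bool (A (Suc t) = a)"

primrec mubar :: "(nat \<Rightarrow> nat) \<Rightarrow> (nat \<Rightarrow> real) \<Rightarrow> nat \<Rightarrow> nat \<Rightarrow> real" where
  "mubar A R a 0 = 0"
| "mubar A R a (Suc t) =
     (nbar A a t * mubar A R a t + of_bool (A (Suc t) = a) * R (Suc t)) / nbar A a (Suc t)"

definition pull_count :: "(nat \<Rightarrow> nat) \<Rightarrow> nat \<Rightarrow> nat \<Rightarrow> nat" where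
  "pull_count A a T = (\<Sum>s=1..T. of_bool (A s = a))"

text \<open>
  A run of generalized Gaussian Thompson sampling on a probability space \<open>M\<close>, with noises \<open>\<xi> t\<close>
  and samples \<open>Z a t\<close> of law \<open>D\<close>.  The assumption \<open>indep\<close> says that the whole family consisting
  of all \<open>\<xi> t\<close> and all \<open>Z a t\<close> is mutually independent; it also contains the measurability of
  these variables.  Ties in the maximisation may be broken in any measurable way.
\<close>

locale thompson_sampling = prob_space M
  for M :: "'w measure"
  and K :: nat
  and \<mu> :: "nat \<Rightarrow> real"
  and \<sigma> :: real
  and D :: "real measure"
  and \<xi> :: "nat \<Rightarrow> 'w \<Rightarrow> real"
  and Z :: "nat \<Rightarrow> nat \<Rightarrow> 'w \<Rightarrow> real"
  and A :: "nat \<Rightarrow> 'w \<Rightarrow> nat" +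
  assumes sigma_pos: "\<sigma> > 0"
    and indep: "indep_vars (\<lambda>_. borel) (case_sum \<xi> (case_prod Z)) ({1..} <+> {1..K} \<times> {1..})"
    and noise_identical: "\<And>t. t \<ge> 1 \<Longrightarrow> distr M borel (\<xi> t) = distr M borel (\<xi> 1)"
    and noise_integrable: "\<And>t. t \<ge> 1 \<Longrightarrow> integrable M (\<xi> t)"
    and noise_sq_integrable: "\<And>t. t \<ge> 1 \<Longrightarrow> integrable M (\<lambda>\<omega>. (\<xi> t \<omega>)\<^sup>2)"
    and noise_mean: "\<And>t. t \<ge> 1 \<Longrightarrow> expectation (\<xi> t) = 0"
    and noise_variance: "\<And>t. t \<ge> 1 \<Longrightarrow> variance (\<xi> t) = 1"
    and sample_law: "\<And>a t. a \<in> {1..K} \<Longrightarrow> t \<ge> 1 \<Longrightarrow> distr M borel (Z a t) = D"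
    and pull_measurable: "\<And>t. t \<ge> 1 \<Longrightarrow> A t \<in> measurable M (count_space UNIV)"
    and pull_argmax: "\<And>t \<omega>. \<omega> \<in> space M \<Longrightarrow>
      is_arg_max
        (\<lambda>b. mubar (\<lambda>s. A s \<omega>) (\<lambda>s. \<mu> (A s \<omega>) + \<sigma> * \<xi> s \<omega>) b t
             + \<sigma> * nbar (\<lambda>s. A s \<omega>) b t powr (- 1 / 2) * Z b (Suc t) \<omega>)
        (\<lambda>b. b \<in> {1..K}) (A (Suc t) \<omega>)"

definition condition_B1 :: "real measure \<Rightarrow> bool" where
  "condition_B1 D \<longleftrightarrow>
     (\<forall>z. 0 < cdf D z \<and> cdf D z < 1) \<and>
     cdf D C1_differentiable_on UNIV \<and>
     bounded (range (deriv (cdf D)))"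

definition ccdf :: "real measure \<Rightarrow> real \<Rightarrow> real" where
  "ccdf D z = 1 - cdf D z"

definition condition_B2 :: "real measure \<Rightarrow> bool" where
  "condition_B2 D \<longleftrightarrow>
     (\<forall>c>1.
        ((\<lambda>z. ln z / (- ln (cdf D (- z)))) \<longlongrightarrow> 0) at_top \<and>
        ((\<lambda>z. max (ln z / (- ln (ccdf D z))) (z\<^sup>2 * ccdf D (c * z) / ccdf D z)) \<longlongrightarrow> 0) at_top)"

definition tendsto_in_prob :: "'w measure \<Rightarrow> (nat \<Rightarrow> 'w \<Rightarrow> real) \<Rightarrow> real \<Rightarrow> bool" where
  "tendsto_in_prob M X l \<longleftrightarrow>
     (\<forall>\<epsilon>>0. (\<lambda>T. measure M {\<omega> \<in> space M. \<bar>X T \<omega> - l\<bar> > \<epsilon>}) \<longlonglongrightarrow> 0)"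

text \<open>
  Since \<open>x / 0 = 0\<close>, convergence to \<open>1\<close> forces \<open>nstar T \<noteq> 0\<close> for all large \<open>T\<close>, so no separate
  nonvanishing requirement on the normalising sequence is needed.
\<close>

definition stable_arm :: "'w measure \<Rightarrow> (nat \<Rightarrow> 'w \<Rightarrow> nat) \<Rightarrow> nat \<Rightarrow> bool" where
  "stable_arm M A a \<longleftrightarrow>
     (\<exists>nstar :: nat \<Rightarrow> real.
        tendsto_in_prob M (\<lambda>T \<omega>. real (pull_count (\<lambda>s. A s \<omega>) a T) / nstar T) 1)"

end

theory Submission
  imports Defs
begin

text \<open>
  Write \<open>S b t\<close> for the sum of the noises observed at arm \<open>b\<close> up to round \<open>t\<close>, and \<open>n b t\<close> for the
  number of pulls.

  Suboptimal arms. The empirical means are uniformly close to the true means, by a maximal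
  inequality for the supermartingale \<open>S\<^sup>2 / (n + N)\<^sup>2 + 1 / (n + N)\<close>. Let \<open>z\<close> be the upper
  \<open>1/T\<close>-quantile of the sampling law. An arm with gap \<open>\<Delta>\<close> is rarely pulled once \<open>n\<close> exceeds
  \<open>(1 + d) (\<sigma> z / \<Delta>)\<^sup>2\<close>, apart from the rounds in which all indices are low, whose expected number
  is bounded by the comparison argument of Agrawal and Goyal; and it is pulled too often for \<open>n\<close> to
  stay below \<open>(1 - d) (\<sigma> z / \<Delta>)\<^sup>2\<close>. Both follow from first-moment bounds. So suboptimal arms are
  stable and pulled \<open>o(T)\<close> times, which settles the case of a unique optimal arm.

  Tied arms. If one of \<open>m \<ge> 2\<close> optimal arms is stable, then by symmetry of the law all of them have
  \<open>n b T / T \<longlonglongrightarrow> 1 / m\<close>. Hence \<open>E (\<Sum>b. S b T * n b T) = E (\<Sum>b. S b T * (n b T - T / m))\<close> is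
  \<open>o(T powr (3/2))\<close>. Its increment at time \<open>t\<close> is the mean excess of \<open>S\<close> at the pulled arm over \<open>S\<close>
  at the optimal arm with the largest sample, as the latter is independent of the past. With equal
  counts the algorithm maximises \<open>S b / \<surd>(t/m) + Z b\<close>, so this excess is asymptotically nonnegative,
  and it is of order \<open>\<surd>T\<close> whenever \<open>\<bar>S i - S j\<bar> \<ge> \<eta> \<surd>T\<close> and \<open>i\<close> narrowly loses to \<open>j\<close> in the
  samples. Therefore \<open>(S i - S j) / \<surd>T\<close> is small for most \<open>t \<le> T\<close>. But \<open>S i - S j\<close> is a martingale
  whose variance grows at rate \<open>2 / m\<close>, which contradicts this when one follows
  \<open>E (cos ((S i - S j) / \<surd>T))\<close> in \<open>t\<close>.
\<close>

section \<open>Algebras generated by parts of an independent family\<close>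

text \<open>Ties may be broken with knowledge of later rounds, so a run need not be adapted. Since
  (B1) makes \<open>D\<close> atomless, ties are null and every run agrees almost surely with one
  computed from the driving randomness alone. This restores adaptedness and fixes the law of the
  counts, the source of the symmetry. Conditioning on the past is done by splitting the independent
  family, by means of the algebras below. (B2) enters through the quantile \<open>z\<close>: for
  \<open>c > 1\<close> the expected number of samples above \<open>c * z\<close> among
  \<open>T\<close> tends to 0, while for \<open>c < 1\<close> it outgrows \<open>z\<^sup>2\<close>.
  The critical count is itself of order \<open>z\<^sup>2\<close>, so this sharp change at
  \<open>c = 1\<close> is why first moments decide both sides. For tied arms the obstacle is that
  the noise has two moments only. Expectations of noise sums on rare events are therefore truncated
  by \<open>v \<le> c + v\<^sup>2 / c\<close>. The product of noise sum and count is followed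
  because a pull changes it by the old noise sum of the pulled arm plus a term of mean zero.\<close>

definition gen_algebra :: "'w measure \<Rightarrow> ('i \<Rightarrow> 'w \<Rightarrow> real) \<Rightarrow> 'i set \<Rightarrow> 'w measure" where
  "gen_algebra M X J = vimage_algebra (space M) (\<lambda>\<omega>. \<lambda>i\<in>J. X i \<omega>) (PiM J (\<lambda>_. borel))"

lemma space_gen_algebra [simp]: "space (gen_algebra M X J) = space M"
  by (simp add: gen_algebra_def)

lemma measurable_gen_algebra_restrict:
  "(\<lambda>\<omega>. \<lambda>i\<in>J. X i \<omega>) \<in> measurable (gen_algebra M X J) (PiM J (\<lambda>_. borel))"
  unfolding gen_algebra_def by (rule measurable_vimage_algebra1) (auto simp: space_PiM)

lemma measurable_gen_algebra_component:
  assumes "i \<in> J"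
  shows "X i \<in> borel_measurable (gen_algebra M X J)"
proof -
  have "(\<lambda>\<omega>. (\<lambda>i\<in>J. X i \<omega>) i) \<in> borel_measurable (gen_algebra M X J)"
    by (rule measurable_compose[OF measurable_gen_algebra_restrict measurable_component_singleton])
       (use assms in auto)
  then show ?thesis using assms by simp
qed

text \<open>The universal property: the generated algebra is the coarsest one that makes the
  coordinates in \<open>J\<close> measurable. Inclusions between such algebras are derived from it
  through the identity map.\<close>

lemma measurable_into_gen_algebra:
  assumes "\<And>i. i \<in> J \<Longrightarrow> X i \<in> borel_measurable N" "space N = space M"
  shows "(\<lambda>\<omega>. \<omega>) \<in> measurable N (gen_algebra M X J)"
  unfolding gen_algebra_def
proof (rule measurable_vimage_algebra2)
  show "(\<lambda>\<omega>. \<omega>) \<in> space N \<rightarrow> space M" using assms by auto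
  show "(\<lambda>x. \<lambda>i\<in>J. X i x) \<in> measurable N (PiM J (\<lambda>_. borel))"
    using assms by (intro measurable_restrict) auto
qed

lemma measurable_gen_algebra_mono:
  assumes "J \<subseteq> J'" "f \<in> measurable (gen_algebra M X J) N"
  shows "f \<in> measurable (gen_algebra M X J') N"
  by (rule measurable_compose[OF measurable_into_gen_algebra assms(2)])
     (use assms in \<open>auto intro!: measurable_gen_algebra_component\<close>)

context prob_space
begin

context
  fixes X :: "'i \<Rightarrow> 'a \<Rightarrow> real" and I :: "'i set"
  assumes ind: "indep_vars (\<lambda>_. borel) X I"
begin

lemma gen_algebra_id_measurable:
  assumes "J \<subseteq> I"
  shows "(\<lambda>\<omega>. \<omega>) \<in> measurable M (gen_algebra M X J)"
  by (rule measurable_into_gen_algebra) (use assms ind in \<open>auto simp: indep_vars_def\<close>)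

lemma measurable_gen_algebra_imp:
  assumes "J \<subseteq> I" "f \<in> measurable (gen_algebra M X J) N"
  shows "f \<in> measurable M N"
  by (rule measurable_compose[OF gen_algebra_id_measurable[OF assms(1)] assms(2)])

lemma sets_gen_algebra_imp:
  assumes "J \<subseteq> I" "E \<in> sets (gen_algebra M X J)"
  shows "E \<in> sets M"
  using measurable_sets[OF gen_algebra_id_measurable[OF assms(1)] assms(2)] sets.sets_into_space[OF assms(2)]
  by (simp add: Int_absorb2)

text \<open>Regarding the identity as a random variable into each algebra turns independence of two
  sigma-algebras into independence of two variables. Any pair of maps measurable for the two
  algebras is then covered by composition.\<close>

lemma indep_var_gen_algebra_id:
  assumes "J1 \<subseteq> I" "J2 \<subseteq> I" "J1 \<inter> J2 = {}"
  shows "indep_var (gen_algebra M X J1) (\<lambda>\<omega>. \<omega>) (gen_algebra M X J2) (\<lambda>\<omega>. \<omega>)"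
proof -
  let ?r = "\<lambda>J \<omega>. \<lambda>i\<in>J. X i \<omega>"
  have iv: "indep_var (PiM J1 (\<lambda>_. borel)) (?r J1) (PiM J2 (\<lambda>_. borel)) (?r J2)"
    using indep_var_restrict[OF ind assms(3,1,2)] by simp
  \<comment> \<open>Both families consist of the preimages under the restricted tuples, so
    independence of the tuples carries over unchanged.\<close>
  have *: "{(\<lambda>\<omega>. \<omega>) -` A \<inter> space M |A. A \<in> sets (gen_algebra M X J)}
      = {?r J -` A \<inter> space M | A. A \<in> sets (PiM J (\<lambda>_. borel))}" for J
  proof -
    have "sets (gen_algebra M X J) = {?r J -` A \<inter> space M | A. A \<in> sets (PiM J (\<lambda>_. borel))}"
      unfolding gen_algebra_def by (rule sets_vimage_algebra2) (auto simp: space_PiM)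
    moreover have "A \<inter> space M = A" if "A \<in> sets (gen_algebra M X J)" for A
      using sets.sets_into_space[OF that] by auto
    ultimately show ?thesis by (auto simp: Int_assoc)
  qed
  show ?thesis
    unfolding indep_var_eq *
    using iv gen_algebra_id_measurable assms unfolding indep_var_eq by auto
qed

lemma indep_var_gen_algebra:
  assumes "J1 \<subseteq> I" "J2 \<subseteq> I" "J1 \<inter> J2 = {}"
    and "f \<in> measurable (gen_algebra M X J1) N1" "g \<in> measurable (gen_algebra M X J2) N2"
  shows "indep_var N1 f N2 g"
  using indep_var_compose[OF indep_var_gen_algebra_id[OF assms(1-3)] assms(4,5)]
  by (simp add: comp_def)

text \<open>
  Conditioning on the coordinates in \<open>J1\<close>: in the pair, the first copy of \<open>\<omega>\<close> carries the randomness
  of \<open>J1\<close> and the second one that of \<open>J2\<close>.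
\<close>

lemma nn_integral_gen_algebra_freeze:
  assumes J: "J1 \<subseteq> I" "J2 \<subseteq> I" "J1 \<inter> J2 = {}"
    and h[measurable]: "h \<in> borel_measurable (gen_algebra M X J1 \<Otimes>\<^sub>M gen_algebra M X J2)"
  shows "(\<integral>\<^sup>+\<omega>. h (\<omega>, \<omega>) \<partial>M) = (\<integral>\<^sup>+\<omega>. \<integral>\<^sup>+\<omega>'. h (\<omega>, \<omega>') \<partial>M \<partial>M)"
proof -
  let ?G1 = "gen_algebra M X J1" and ?G2 = "gen_algebra M X J2"
  let ?D1 = "distr M ?G1 (\<lambda>\<omega>. \<omega>)" and ?D2 = "distr M ?G2 (\<lambda>\<omega>. \<omega>)"
  have id1: "(\<lambda>\<omega>. \<omega>) \<in> measurable M ?G1" and id2: "(\<lambda>\<omega>. \<omega>) \<in> measurable M ?G2"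
    using gen_algebra_id_measurable J by auto
  interpret D2: prob_space ?D2 by (rule prob_space_distr[OF id2])
  \<comment> \<open>Independence says that the diagonal map sends \<open>M\<close> to the product of
    its two images, so the integral over the diagonal becomes an iterated one.\<close>
  have eq: "?D1 \<Otimes>\<^sub>M ?D2 = distr M (?G1 \<Otimes>\<^sub>M ?G2) (\<lambda>x. (x, x))"
    using indep_var_gen_algebra_id[OF J] unfolding indep_var_distribution_eq by simp
  have h': "h \<in> borel_measurable (?D1 \<Otimes>\<^sub>M ?D2)"
    using h by (simp cong: measurable_cong_sets)
  have "(\<integral>\<^sup>+\<omega>. h (\<omega>, \<omega>) \<partial>M) = (\<integral>\<^sup>+p. h p \<partial>distr M (?G1 \<Otimes>\<^sub>M ?G2) (\<lambda>x. (x, x)))"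
    by (rule nn_integral_distr[symmetric]) (use id1 id2 h in \<open>auto intro!: measurable_Pair\<close>)
  also have "\<dots> = (\<integral>\<^sup>+\<omega>. \<integral>\<^sup>+\<omega>'. h (\<omega>, \<omega>') \<partial>?D2 \<partial>?D1)"
    unfolding eq[symmetric] by (rule D2.nn_integral_fst[symmetric, OF h'])
  also have "\<dots> = (\<integral>\<^sup>+\<omega>. \<integral>\<^sup>+\<omega>'. h (\<omega>, \<omega>') \<partial>?D2 \<partial>M)"
    by (subst nn_integral_distr[OF id1]) (use D2.borel_measurable_nn_integral_fst[OF h'] in auto)
  also have "\<dots> = (\<integral>\<^sup>+\<omega>. \<integral>\<^sup>+\<omega>'. h (\<omega>, \<omega>') \<partial>M \<partial>M)"
  proof (rule nn_integral_cong)
    fix \<omega> assume "\<omega> \<in> space M"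
    then have "(\<lambda>\<omega>'. h (\<omega>, \<omega>')) \<in> borel_measurable ?G2"
      by (intro measurable_Pair2[OF h]) auto
    then show "(\<integral>\<^sup>+\<omega>'. h (\<omega>, \<omega>') \<partial>?D2) = (\<integral>\<^sup>+\<omega>'. h (\<omega>, \<omega>') \<partial>M)"
      by (subst nn_integral_distr[OF id2]) auto
  qed
  finally show ?thesis .
qed

text \<open>A comparison of conditional probabilities given the past, in elementary form: for each
  past in \<open>G\<close> both probabilities are taken over a fresh copy \<open>\<omega>'\<close>
  of the \<open>J2\<close> part, and the inequality is then integrated over
  \<open>G\<close>.\<close>

lemma prob_gen_algebra_freeze_le:
  assumes J: "J1 \<subseteq> I" "J2 \<subseteq> I" "J1 \<inter> J2 = {}"
    and G: "G \<in> sets (gen_algebra M X J1)"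
    and Q: "Measurable.pred (gen_algebra M X J1 \<Otimes>\<^sub>M gen_algebra M X J2) (\<lambda>p. Q (fst p) (snd p))"
    and Q': "Measurable.pred (gen_algebra M X J1 \<Otimes>\<^sub>M gen_algebra M X J2) (\<lambda>p. Q' (fst p) (snd p))"
    and c: "c \<ge> 0"
    and le: "\<And>\<omega>. \<omega> \<in> G \<Longrightarrow> prob {\<omega>' \<in> space M. Q \<omega> \<omega>'} \<le> c * prob {\<omega>' \<in> space M. Q' \<omega> \<omega>'}"
  shows "prob {\<omega> \<in> G. Q \<omega> \<omega>} \<le> c * prob {\<omega> \<in> G. Q' \<omega> \<omega>}"
proof -
  let ?G1 = "gen_algebra M X J1" and ?G2 = "gen_algebra M X J2"
  note [measurable] = G
  have GM: "G \<in> sets M" by (rule sets_gen_algebra_imp[OF J(1) G])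
  have Gs: "G \<subseteq> space M" using sets.sets_into_space[OF GM] .
  have main: "ennreal (prob {\<omega> \<in> G. P \<omega> \<omega>})
      = (\<integral>\<^sup>+\<omega>. indicator G \<omega> * ennreal (prob {\<omega>' \<in> space M. P \<omega> \<omega>'}) \<partial>M)"
    and meas: "(\<lambda>\<omega>. indicator G \<omega> * ennreal (prob {\<omega>' \<in> space M. P \<omega> \<omega>'})) \<in> borel_measurable M"
    if P[measurable]: "Measurable.pred (?G1 \<Otimes>\<^sub>M ?G2) (\<lambda>p. P (fst p) (snd p))" for P
  proof -
    define h where "h = (\<lambda>p. indicator G (fst p) * indicator {p. P (fst p) (snd p)} p :: ennreal)"
    have h: "h \<in> borel_measurable (?G1 \<Otimes>\<^sub>M ?G2)"
      unfolding h_def by measurable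
    have sec: "Measurable.pred M (P \<omega>)" if "\<omega> \<in> space M" for \<omega>
    proof -
      have "Measurable.pred ?G2 (\<lambda>\<omega>'. (\<lambda>p. P (fst p) (snd p)) (\<omega>, \<omega>'))"
        by (intro measurable_Pair2[OF P]) (use that in auto)
      then show ?thesis using measurable_gen_algebra_imp[OF J(2)] by simp
    qed
    have inner: "(\<integral>\<^sup>+\<omega>'. h (\<omega>, \<omega>') \<partial>M) = indicator G \<omega> * ennreal (prob {\<omega>' \<in> space M. P \<omega> \<omega>'})"
      if "\<omega> \<in> space M" for \<omega>
    proof -
      have "{\<omega>' \<in> space M. P \<omega> \<omega>'} \<in> sets M" using sec[OF that] by (rule predE)
      then have "(\<integral>\<^sup>+\<omega>'. indicator G \<omega> * indicator {\<omega>' \<in> space M. P \<omega> \<omega>'} \<omega>' \<partial>M)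
          = indicator G \<omega> * emeasure M {\<omega>' \<in> space M. P \<omega> \<omega>'}"
        by (rule nn_integral_cmult_indicator)
      also have "(\<integral>\<^sup>+\<omega>'. indicator G \<omega> * indicator {\<omega>' \<in> space M. P \<omega> \<omega>'} \<omega>' \<partial>M)
          = (\<integral>\<^sup>+\<omega>'. h (\<omega>, \<omega>') \<partial>M)"
        by (intro nn_integral_cong) (auto simp: h_def indicator_def)
      finally show ?thesis by (simp add: emeasure_eq_measure)
    qed
    have mid: "(\<lambda>\<omega>. (\<omega>, \<omega>)) \<in> measurable M (?G1 \<Otimes>\<^sub>M ?G2)"
      using gen_algebra_id_measurable J by (auto intro!: measurable_Pair)
    have "Measurable.pred M (\<lambda>\<omega>. P \<omega> \<omega>)"
      using measurable_compose[OF mid P] by simp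
    then have diag: "{\<omega> \<in> G. P \<omega> \<omega>} \<in> sets M"
    proof -
      assume a: "Measurable.pred M (\<lambda>\<omega>. P \<omega> \<omega>)"
      have "{\<omega> \<in> G. P \<omega> \<omega>} = G \<inter> {\<omega> \<in> space M. P \<omega> \<omega>}" using Gs by auto
      then show ?thesis using GM predE[OF a] by simp
    qed
    have "ennreal (prob {\<omega> \<in> G. P \<omega> \<omega>}) = (\<integral>\<^sup>+\<omega>. indicator {\<omega> \<in> G. P \<omega> \<omega>} \<omega> \<partial>M)"
      using diag by (simp add: emeasure_eq_measure)
    also have "\<dots> = (\<integral>\<^sup>+\<omega>. h (\<omega>, \<omega>) \<partial>M)"
      by (intro nn_integral_cong) (auto simp: h_def indicator_def)
    also have "\<dots> = (\<integral>\<^sup>+\<omega>. \<integral>\<^sup>+\<omega>'. h (\<omega>, \<omega>') \<partial>M \<partial>M)"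
      by (rule nn_integral_gen_algebra_freeze[OF J h])
    also have "\<dots> = (\<integral>\<^sup>+\<omega>. indicator G \<omega> * ennreal (prob {\<omega>' \<in> space M. P \<omega> \<omega>'}) \<partial>M)"
      by (intro nn_integral_cong inner)
    finally show "ennreal (prob {\<omega> \<in> G. P \<omega> \<omega>})
      = (\<integral>\<^sup>+\<omega>. indicator G \<omega> * ennreal (prob {\<omega>' \<in> space M. P \<omega> \<omega>'}) \<partial>M)" .
    have "h \<in> borel_measurable (?G1 \<Otimes>\<^sub>M M)"
    proof -
      have "(\<lambda>p. (fst p, snd p)) \<in> measurable (?G1 \<Otimes>\<^sub>M M) (?G1 \<Otimes>\<^sub>M ?G2)"
        by (intro measurable_Pair measurable_fst measurable_compose[OF measurable_snd gen_algebra_id_measurable[OF J(2)]])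
      from measurable_compose[OF this h] show ?thesis by simp
    qed
    then have "(\<lambda>\<omega>. \<integral>\<^sup>+\<omega>'. h (\<omega>, \<omega>') \<partial>M) \<in> borel_measurable ?G1"
      by (rule borel_measurable_nn_integral_fst)
    then have "(\<lambda>\<omega>. \<integral>\<^sup>+\<omega>'. h (\<omega>, \<omega>') \<partial>M) \<in> borel_measurable M"
      by (rule measurable_gen_algebra_imp[OF J(1)])
    then show "(\<lambda>\<omega>. indicator G \<omega> * ennreal (prob {\<omega>' \<in> space M. P \<omega> \<omega>'})) \<in> borel_measurable M"
      by (rule measurable_cong[THEN iffD1, rotated]) (use inner in auto)
  qed
  have "ennreal (prob {\<omega> \<in> G. Q \<omega> \<omega>}) \<le> ennreal c * ennreal (prob {\<omega> \<in> G. Q' \<omega> \<omega>})"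
    unfolding main[OF Q] main[OF Q'] nn_integral_cmult[OF meas[OF Q'], symmetric]
  proof (rule nn_integral_mono)
    fix \<omega> assume "\<omega> \<in> space M"
    show "indicator G \<omega> * ennreal (prob {\<omega>' \<in> space M. Q \<omega> \<omega>'})
      \<le> ennreal c * (indicator G \<omega> * ennreal (prob {\<omega>' \<in> space M. Q' \<omega> \<omega>'}))"
    proof (cases "\<omega> \<in> G")
      case True
      then show ?thesis using le[OF True] c by (simp add: ennreal_mult''[symmetric] ennreal_leI)
    qed simp
  qed
  then show ?thesis using c by (simp add: ennreal_mult''[symmetric])
qed

lemma expectation_gen_algebra_mult:
  assumes J: "J1 \<subseteq> I" "J2 \<subseteq> I" "J1 \<inter> J2 = {}"
    and f: "f \<in> borel_measurable (gen_algebra M X J1)" "integrable M f"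
    and g: "g \<in> borel_measurable (gen_algebra M X J2)" "integrable M g"
  shows "integrable M (\<lambda>\<omega>. f \<omega> * g \<omega> :: real)"
    and "expectation (\<lambda>\<omega>. f \<omega> * g \<omega>) = expectation f * expectation g"
  using indep_var_integrable[OF indep_var_gen_algebra[OF J f(1) g(1)] f(2) g(2)]
    indep_var_lebesgue_integral[OF indep_var_gen_algebra[OF J f(1) g(1)] f(2) g(2)] by auto

lemma prob_gen_algebra_Int:
  assumes J: "J1 \<subseteq> I" "J2 \<subseteq> I" "J1 \<inter> J2 = {}"
    and "E \<in> sets (gen_algebra M X J1)" "F \<in> sets (gen_algebra M X J2)"
  shows "prob (E \<inter> F) = prob E * prob F"
proof -
  have "E \<in> sets M" "F \<in> sets M"
    using sets_gen_algebra_imp assms by auto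
  moreover have "expectation (\<lambda>\<omega>. indicator E \<omega> * indicator F \<omega>)
      = expectation (indicator E :: _ \<Rightarrow> real) * expectation (indicator F)"
    by (rule expectation_gen_algebra_mult[OF J])
       (use assms calculation in \<open>auto simp: emeasure_eq_measure intro!: borel_measurable_indicator\<close>)
  moreover have "(\<lambda>\<omega>. indicator E \<omega> * indicator F \<omega> :: real) = indicator (E \<inter> F)"
    by (auto simp: indicator_def)
  ultimately show ?thesis by simp
qed

end

end

section \<open>Pull counts along a trajectory\<close>

lemma nbar_eq_pull_count: "nbar A b t = 1 + real (pull_count A b t)"
  by (induction t) (simp_all add: pull_count_def)

lemma pull_count_Suc: "pull_count A b (Suc t) = pull_count A b t + of_bool (A (Suc t) = b)"
  by (simp add: pull_count_def)

lemma pull_count_0 [simp]: "pull_count A b 0 = 0"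
  by (simp add: pull_count_def)

lemma nbar_ge_1: "nbar A b t \<ge> 1"
  by (simp add: nbar_eq_pull_count)

lemma nbar_pos [simp]: "nbar A b t > 0"
  using nbar_ge_1[of A b t] by linarith

lemma nbar_nonzero [simp]: "nbar A b t \<noteq> 0"
  using nbar_pos[of A b t] by linarith

lemma pull_count_mono: "s \<le> t \<Longrightarrow> pull_count A b s \<le> pull_count A b t"
  unfolding pull_count_def by (rule sum_mono2) auto

lemma pull_count_le: "pull_count A b t \<le> t"
  by (induction t) (auto simp: pull_count_Suc)

definition pull_noise :: "(nat \<Rightarrow> nat) \<Rightarrow> (nat \<Rightarrow> real) \<Rightarrow> nat \<Rightarrow> nat \<Rightarrow> real" where
  "pull_noise A x b t = (\<Sum>s=1..t. of_bool (A s = b) * x s)"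

lemma pull_noise_0 [simp]: "pull_noise A x b 0 = 0"
  by (simp add: pull_noise_def)

lemma pull_noise_Suc:
  "pull_noise A x b (Suc t) = pull_noise A x b t + of_bool (A (Suc t) = b) * x (Suc t)"
  by (simp add: pull_noise_def)

text \<open>\<open>nbar\<close> starts at 1 and \<open>mubar\<close> at 0, so each arm carries one
  fictitious observation of value 0. Only \<open>nbar - 1\<close> rewards are real, which leaves the
  bias \<open>- \<mu> b / nbar\<close> visible in \<open>mubar_eq\<close>.\<close>

lemma nbar_mult_mubar:
  "nbar A b t * mubar A (\<lambda>s. \<mu> (A s) + \<sigma> * x s) b t
     = (nbar A b t - 1) * \<mu> b + \<sigma> * pull_noise A x b t"
proof (induction t)
  case (Suc t)
  have "nbar A b (Suc t) * mubar A (\<lambda>s. \<mu> (A s) + \<sigma> * x s) b (Suc t)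
     = nbar A b t * mubar A (\<lambda>s. \<mu> (A s) + \<sigma> * x s) b t
       + of_bool (A (Suc t) = b) * (\<mu> (A (Suc t)) + \<sigma> * x (Suc t))"
    using nbar_nonzero[of A b "Suc t"] by (simp del: nbar_nonzero)
  then show ?case
    unfolding Suc.IH by (simp add: pull_noise_Suc algebra_simps)
qed simp

lemma mubar_eq:
  "mubar A (\<lambda>s. \<mu> (A s) + \<sigma> * x s) b t
     = \<mu> b + (\<sigma> * pull_noise A x b t - \<mu> b) / nbar A b t"
  using nbar_mult_mubar[of A b t \<mu> \<sigma> x] by (simp add: field_simps)

lemma nbar_cong: "(\<And>s. 1 \<le> s \<Longrightarrow> s \<le> t \<Longrightarrow> A s = A' s) \<Longrightarrow> nbar A b t = nbar A' b t"
  by (induction t) auto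

lemma mubar_cong:
  "(\<And>s. 1 \<le> s \<Longrightarrow> s \<le> t \<Longrightarrow> A s = A' s \<and> R s = R' s) \<Longrightarrow> mubar A R b t = mubar A' R' b t"
proof (induction t)
  case (Suc t)
  then have "mubar A R b t = mubar A' R' b t" "nbar A b t = nbar A' b t"
    by (auto intro: nbar_cong)
  then show ?case using Suc.prems[of "Suc t"] by simp
qed simp

text \<open>A pull made while \<open>nbar < x\<close> brings the count up to the old
  \<open>nbar\<close>, hence below \<open>x\<close>; this is where the initial value 1 of
  \<open>nbar\<close> matters. So the count can exceed \<open>x\<close> only through pulls with
  \<open>nbar \<ge> x\<close>.\<close>

lemma pull_count_le_late_pulls:
  assumes "x \<ge> 0"
  shows "real (pull_count A b T) \<le> x + (\<Sum>t<T. of_bool (A (Suc t) = b \<and> nbar A b t \<ge> x))"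
proof (induction T)
  case (Suc T)
  show ?case
  proof (cases "A (Suc T) = b \<and> nbar A b T < x")
    case True
    have "0 \<le> (\<Sum>t<T. of_bool (A (Suc t) = b \<and> nbar A b t \<ge> x) :: real)"
      by (intro sum_nonneg) auto
    with True show ?thesis by (auto simp: pull_count_Suc nbar_eq_pull_count)
  next
    case False
    then show ?thesis using Suc by (auto simp: pull_count_Suc)
  qed
qed (use assms in simp)

lemma early_pulls_le:
  assumes "x \<ge> 0"
  shows "(\<Sum>t<T. of_bool (A (Suc t) = b \<and> nbar A b t < x)) \<le> x"
proof -
  \<comment> \<open>Bounding by the count as well makes the induction close: an early pull meets a
    count below \<open>x - 1\<close>.\<close>
  have "(\<Sum>t<T. of_bool (A (Suc t) = b \<and> nbar A b t < x)) \<le> min x (real (pull_count A b T))"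
  proof (induction T)
    case (Suc T)
    then show ?case by (auto simp: pull_count_Suc nbar_eq_pull_count)
  qed (use assms in simp)
  then show ?thesis by simp
qed

lemma pulls_at_count_le:
  "(\<Sum>t<T. of_bool (A (Suc t) = b \<and> pull_count A b t = k)) \<le> (1::real)"
proof -
  \<comment> \<open>The sum becomes positive only when the count passes \<open>k\<close>; this
    sharper claim is inductive.\<close>
  have "(\<Sum>t<T. of_bool (A (Suc t) = b \<and> pull_count A b t = k)) \<le> (of_bool (k < pull_count A b T) :: real)"
    by (induction T) (auto simp: pull_count_Suc split: if_splits)
  also have "\<dots> \<le> 1" by simp
  finally show ?thesis .
qed

lemma sum_pull_count:
  assumes "finite B" "\<And>s. 1 \<le> s \<Longrightarrow> s \<le> T \<Longrightarrow> A s \<in> B"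
  shows "(\<Sum>b\<in>B. pull_count A b T) = T"
  using assms(2)
proof (induction T)
  case (Suc T)
  have "(\<Sum>b\<in>B. of_bool (A (Suc T) = b)) = (1::nat)"
    using Suc.prems[of "Suc T"] assms(1) by simp
  then show ?case using Suc by (simp add: pull_count_Suc sum.distrib)
qed simp

section \<open>Tails of the sampling law\<close>

locale sampling_law = real_distribution D for D :: "real measure" +
  assumes B1: "condition_B1 D" and B2: "condition_B2 D"
begin

lemma cdf_pos: "cdf D z > 0" and cdf_less_1: "cdf D z < 1"
  using B1 by (auto simp: condition_B1_def)

lemma ccdf_pos: "ccdf D z > 0" and ccdf_less_1: "ccdf D z < 1"
  using cdf_pos[of z] cdf_less_1[of z] by (auto simp: ccdf_def)

lemma continuous_cdf: "continuous_on UNIV (cdf D)"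
proof -
  have "cdf D differentiable_on UNIV"
    using B1 by (auto simp: condition_B1_def intro: C1_differentiable_imp_piecewise C1_diff_imp_diff)
  then show ?thesis by (rule differentiable_imp_continuous_on)
qed

lemma continuous_ccdf: "continuous_on UNIV (ccdf D)"
  unfolding ccdf_def using continuous_cdf by (auto intro!: continuous_intros simp: fun_eq_iff)

lemma ccdf_eq: "ccdf D z = measure D {z<..}"
proof -
  have "measure D (UNIV - {..z}) = 1 - measure D {..z}"
    using prob_compl[of "{..z}"] by simp
  moreover have "UNIV - {..z} = {z<..}" by auto
  ultimately show ?thesis by (simp add: ccdf_def cdf_def)
qed

lemma ccdf_antimono: "x \<le> y \<Longrightarrow> ccdf D y \<le> ccdf D x"
  unfolding ccdf_def using cdf_nondecreasing by simp

lemma measure_singleton [simp]: "measure D {x} = 0"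
proof -
  have "isCont (cdf D) x" using continuous_cdf by (simp add: continuous_on_eq_continuous_at)
  then show ?thesis by (simp add: isCont_cdf)
qed

lemma lower_tail_limit: "((\<lambda>z. ln z / (- ln (cdf D (- z)))) \<longlongrightarrow> 0) at_top"
  using B2[unfolded condition_B2_def, rule_format, of 2] by simp

lemma max_limit:
  "c > 1 \<Longrightarrow> ((\<lambda>z. max (ln z / (- ln (ccdf D z))) (z\<^sup>2 * ccdf D (c * z) / ccdf D z)) \<longlongrightarrow> 0) at_top"
  using B2 unfolding condition_B2_def by blast

text \<open>The threshold 1/4 converts negligibility of \<open>ln z\<close> against
  \<open>- ln p\<close> into decay of order \<open>1 / z ^ 4\<close>. That power suffices for both
  uses: at \<open>z\<close> of order \<open>sqrt k\<close> it is summable over \<open>k\<close>, and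
  it beats the factor \<open>z\<^sup>2\<close>.\<close>

lemma ln_ratio_imp_le:
  fixes z p :: real
  assumes "z > 1" "0 < p" "p < 1" "ln z / (- ln p) < 1 / 4"
  shows "p \<le> 1 / z ^ 4"
proof -
  have "ln p < 0" using assms by simp
  then have "4 * ln z < - ln p" using assms(4) by (simp add: field_simps)
  moreover have "ln (1 / z ^ 4) = - 4 * ln z" using assms by (simp add: ln_div ln_realpow)
  ultimately have "ln p \<le> ln (1 / z ^ 4)" by simp
  then show ?thesis using assms by (subst (asm) ln_le_cancel_iff) auto
qed

lemma eventually_cdf_le: "eventually (\<lambda>z. cdf D (- z) \<le> 1 / z ^ 4) at_top"
  using order_tendstoD(2)[OF lower_tail_limit, of "1/4", simplified] eventually_gt_at_top[of 1]
  by eventually_elim (rule ln_ratio_imp_le, use cdf_pos cdf_less_1 in auto)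

lemma eventually_ccdf_le: "eventually (\<lambda>z. ccdf D z \<le> 1 / z ^ 4) at_top"
proof -
  have "eventually (\<lambda>z. max (ln z / (- ln (ccdf D z))) (z\<^sup>2 * ccdf D (2 * z) / ccdf D z) < 1 / 4) at_top"
    by (rule order_tendstoD(2)[OF max_limit]) auto
  then have "eventually (\<lambda>z. ln z / (- ln (ccdf D z)) < 1 / 4) at_top"
    by (rule eventually_mono) (simp only: max_less_iff_conj)
  then show ?thesis using eventually_gt_at_top[of 1]
    by eventually_elim (rule ln_ratio_imp_le, use ccdf_pos ccdf_less_1 in auto)
qed

text \<open>Up to constants the summand is the probability that an arm with \<open>k\<close>
  observations draws a sample low enough to put its index a fixed distance below its mean.
  Summability over \<open>k\<close> lies behind the bounded number of rounds in
  \<open>sum_prob_all_below\<close>.\<close>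

lemma summable_cdf_sqrt:
  assumes "\<epsilon> > 0"
  shows "summable (\<lambda>k. cdf D (- (\<epsilon> * sqrt (real k))))"
proof (rule summable_comparison_test_ev)
  have "filterlim (\<lambda>k. \<epsilon> * sqrt (real k)) at_top sequentially"
    using assms by real_asymp
  then have "eventually (\<lambda>k. cdf D (- (\<epsilon> * sqrt (real k))) \<le> 1 / (\<epsilon> * sqrt (real k)) ^ 4) sequentially"
    by (rule eventually_compose_filterlim[OF eventually_cdf_le])
  then show "eventually (\<lambda>k. norm (cdf D (- (\<epsilon> * sqrt (real k)))) \<le> 1 / \<epsilon> ^ 4 * inverse (real k ^ 2)) sequentially"
  proof eventually_elim
    case (elim k)
    have "sqrt (real k) ^ 4 = (sqrt (real k) ^ 2) ^ 2"
      by (simp only: power_mult[symmetric]) simp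
    then have "(\<epsilon> * sqrt (real k)) ^ 4 = \<epsilon> ^ 4 * real k ^ 2"
      by (simp add: power_mult_distrib)
    then show ?case using elim cdf_pos[of "- (\<epsilon> * sqrt (real k))"] by (simp add: divide_inverse)
  qed
  show "summable (\<lambda>k. 1 / \<epsilon> ^ 4 * inverse (real k ^ 2))"
    by (intro summable_mult inverse_power_summable) auto
qed

lemma ccdf_lim_at_top: "(ccdf D \<longlongrightarrow> 0) at_top"
  unfolding ccdf_def using tendsto_diff[OF tendsto_const[of 1] cdf_lim_at_top_prob] by simp

lemma ccdf_lim_at_bot: "(ccdf D \<longlongrightarrow> 1) at_bot"
  unfolding ccdf_def using tendsto_diff[OF tendsto_const[of 1] cdf_lim_at_bot] by simp

lemma ex_ccdf_eq:
  assumes "0 < p" "p < 1"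
  shows "\<exists>z. ccdf D z = p"
proof -
  obtain x where x: "ccdf D x < p"
    using order_tendstoD(2)[OF ccdf_lim_at_top assms(1)] by (auto simp: eventually_at_top_linorder)
  obtain y where y: "p < ccdf D y"
    using order_tendstoD(1)[OF ccdf_lim_at_bot assms(2)] by (auto simp: eventually_at_bot_linorder)
  have "y \<le> x" using x y ccdf_antimono[of x y] by linarith
  then show ?thesis
    using IVT2'[of "ccdf D" x p y] x y continuous_on_subset[OF continuous_ccdf] by auto
qed

text \<open>Among \<open>T\<close> fresh samples about one exceeds this level. The equation is
  solvable for \<open>T \<ge> 2\<close>, where \<open>1 / T\<close> lies strictly between 0 and 1;
  any solution serves.\<close>

definition tail_quantile :: "nat \<Rightarrow> real" where
  "tail_quantile T = (SOME z. ccdf D z = 1 / real T)"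

lemma ccdf_tail_quantile: "T \<ge> 2 \<Longrightarrow> ccdf D (tail_quantile T) = 1 / real T"
  unfolding tail_quantile_def by (rule someI_ex, rule ex_ccdf_eq) auto

lemma tail_quantile_at_top: "filterlim tail_quantile at_top sequentially"
  unfolding filterlim_at_top
proof
  fix B
  have "(\<lambda>T. 1 / real T) \<longlonglongrightarrow> 0" by real_asymp
  then have "eventually (\<lambda>T. 1 / real T < ccdf D B) sequentially"
    using ccdf_pos by (rule order_tendstoD)
  then show "eventually (\<lambda>T. B \<le> tail_quantile T) sequentially"
    using eventually_ge_at_top[of 2]
  proof eventually_elim
    case (elim T)
    then show ?case using ccdf_tail_quantile[of T] ccdf_antimono[of "tail_quantile T" B]
      by linarith
  qed
qed

lemma upper_ratio_limit:
  assumes "c > 1"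
  shows "((\<lambda>z. z\<^sup>2 * ccdf D (c * z) / ccdf D z) \<longlongrightarrow> 0) at_top"
proof (rule tendsto_sandwich[OF _ _ tendsto_const max_limit[OF assms]])
  show "\<forall>\<^sub>F z in at_top. 0 \<le> z\<^sup>2 * ccdf D (c * z) / ccdf D z"
    using ccdf_pos by (simp add: less_imp_le)
qed simp

lemma tail_quantile_sq_over: "(\<lambda>T. (tail_quantile T)\<^sup>2 / real T) \<longlonglongrightarrow> 0"
proof -
  have "((\<lambda>z. z\<^sup>2 * ccdf D z) \<longlongrightarrow> 0) at_top"
  proof (rule tendsto_sandwich[OF _ _ tendsto_const])
    show "\<forall>\<^sub>F z in at_top. 0 \<le> z\<^sup>2 * ccdf D z" using ccdf_pos by (simp add: less_imp_le)
    show "\<forall>\<^sub>F z in at_top. z\<^sup>2 * ccdf D z \<le> 1 / z\<^sup>2"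
      using eventually_ccdf_le eventually_gt_at_top[of 0]
    proof eventually_elim
      case (elim z)
      have "z\<^sup>2 * ccdf D z \<le> z\<^sup>2 * (1 / z ^ 4)" using elim by (intro mult_left_mono) auto
      also have "\<dots> = 1 / z\<^sup>2" using elim by (simp add: field_simps power4_eq_xxxx power2_eq_square)
      finally show ?case .
    qed
    show "((\<lambda>z::real. 1 / z\<^sup>2) \<longlongrightarrow> 0) at_top" by real_asymp
  qed
  from filterlim_compose[OF this tail_quantile_at_top]
  have "(\<lambda>T. (tail_quantile T)\<^sup>2 * ccdf D (tail_quantile T)) \<longlonglongrightarrow> 0" .
  then show ?thesis
    by (rule Lim_transform_eventually)
       (use eventually_ge_at_top[of 2] in eventually_elim, simp add: ccdf_tail_quantile)
qed

lemma T_mult_ccdf_limit: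
  assumes "c > 1"
  shows "(\<lambda>T. real T * ccdf D (c * tail_quantile T)) \<longlonglongrightarrow> 0"
proof (rule tendsto_sandwich[OF _ _ tendsto_const filterlim_compose[OF upper_ratio_limit[OF assms] tail_quantile_at_top]])
  show "\<forall>\<^sub>F T in sequentially. 0 \<le> real T * ccdf D (c * tail_quantile T)"
    using ccdf_pos by (simp add: less_imp_le)
  have "eventually (\<lambda>T. tail_quantile T \<ge> 1) sequentially"
    using tail_quantile_at_top by (simp add: filterlim_at_top)
  then show "\<forall>\<^sub>F T in sequentially. real T * ccdf D (c * tail_quantile T)
      \<le> (tail_quantile T)\<^sup>2 * ccdf D (c * tail_quantile T) / ccdf D (tail_quantile T)"
    using eventually_ge_at_top[of 2]
  proof eventually_elim
    case (elim T)
    \<comment> \<open>Inserting the factor \<open>z\<^sup>2 \<ge> 1\<close> and writing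
      \<open>1 / T\<close> as \<open>ccdf\<close> at the quantile produces the ratio of
      (B2).\<close>
    have "1 * (real T * ccdf D (c * tail_quantile T)) \<le> (tail_quantile T)\<^sup>2 * (real T * ccdf D (c * tail_quantile T))"
      using elim ccdf_pos by (intro mult_right_mono) (auto simp: less_imp_le)
    then show ?case using elim by (simp add: ccdf_tail_quantile mult_ac)
  qed
qed

text \<open>(B2) is applied at the point \<open>c * z\<close> with factor \<open>1 / c\<close>,
  which leads back to the quantile itself. The meaning: the expected number of samples above
  \<open>c * z\<close> among \<open>T\<close> outgrows \<open>z\<^sup>2\<close>.\<close>

lemma tail_quantile_sq_ratio_limit:
  assumes "0 < c" "c < 1"
  shows "(\<lambda>T. (tail_quantile T)\<^sup>2 / (real T * ccdf D (c * tail_quantile T))) \<longlonglongrightarrow> 0"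
proof -
  have "filterlim (\<lambda>T. c * tail_quantile T) at_top sequentially"
    by (rule filterlim_tendsto_pos_mult_at_top[OF tendsto_const assms(1) tail_quantile_at_top])
  from filterlim_compose[OF upper_ratio_limit[of "1 / c"] this] assms
  have "(\<lambda>T. 1 / c\<^sup>2 * ((c * tail_quantile T)\<^sup>2 * ccdf D (1 / c * (c * tail_quantile T)) / ccdf D (c * tail_quantile T))) \<longlonglongrightarrow> 1 / c\<^sup>2 * 0"
    by (intro tendsto_mult tendsto_const) auto
  then have "(\<lambda>T. 1 / c\<^sup>2 * ((c * tail_quantile T)\<^sup>2 * ccdf D (1 / c * (c * tail_quantile T)) / ccdf D (c * tail_quantile T))) \<longlonglongrightarrow> 0"
    by simp
  then show ?thesis
    by (rule Lim_transform_eventually)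
       (use eventually_ge_at_top[of 2] in eventually_elim,
        use assms in \<open>simp add: ccdf_tail_quantile power_mult_distrib\<close>)
qed

text \<open>If no window of length \<open>\<eta>\<close> had mass, \<open>cdf\<close> would be
  constant along the multiples of \<open>\<eta>\<close> and could not reach its limit 1. A halfway
  value inside a window with mass splits it by continuity. The two pieces later hold the samples of
  the runner-up and of the leader in \<open>close_race\<close>.\<close>

lemma ex_split_points:
  assumes "\<eta> > 0"
  shows "\<exists>u x. u < x \<and> x < u + \<eta> \<and> cdf D u < cdf D x \<and> cdf D x < cdf D (u + \<eta>)"
proof -
  have "\<exists>u. cdf D u < cdf D (u + \<eta>)"
  proof (rule ccontr)
    assume "\<not> ?thesis"
    then have eq: "cdf D (u + \<eta>) = cdf D u" for u
      using cdf_nondecreasing[of u "u + \<eta>"] assms by (smt (verit))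
    have *: "cdf D (real n * \<eta>) = cdf D 0" for n
    proof (induction n)
      case (Suc n)
      then show ?case using eq[of "real n * \<eta>"] by (simp add: algebra_simps)
    qed simp
    have "filterlim (\<lambda>n. real n * \<eta>) at_top sequentially" using assms by real_asymp
    from filterlim_compose[OF cdf_lim_at_top_prob this] have "cdf D 0 = 1"
      unfolding * by (simp add: LIMSEQ_const_iff)
    then show False using cdf_less_1[of 0] by simp
  qed
  then obtain u where u: "cdf D u < cdf D (u + \<eta>)" by auto
  define p where "p = (cdf D u + cdf D (u + \<eta>)) / 2"
  have p: "cdf D u < p" "p < cdf D (u + \<eta>)" using u by (auto simp: p_def)
  obtain x where x: "u \<le> x" "x \<le> u + \<eta>" "cdf D x = p"
    using IVT'[of "cdf D" u p "u + \<eta>"] p assms continuous_on_subset[OF continuous_cdf] by auto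
  then have "u < x" "x < u + \<eta>" using p by (auto simp: order_less_le)
  then show ?thesis using x p by auto
qed

end

section \<open>The canonical run\<close>

definition argmax_sel :: "nat set \<Rightarrow> (nat \<Rightarrow> real) \<Rightarrow> nat" where
  "argmax_sel B f = (LEAST b. b \<in> B \<and> (\<forall>c\<in>B. f c \<le> f b))"

lemma argmax_sel:
  assumes "finite B" "B \<noteq> {}"
  shows "argmax_sel B f \<in> B" and "c \<in> B \<Longrightarrow> f c \<le> f (argmax_sel B f)"
proof -
  have "Max (f ` B) \<in> f ` B" using assms by (intro Max_in) auto
  then obtain b where b: "b \<in> B" "f b = Max (f ` B)" by (metis imageE)
  then have "b \<in> B \<and> (\<forall>c\<in>B. f c \<le> f b)" using assms by auto
  then have *: "argmax_sel B f \<in> B \<and> (\<forall>c\<in>B. f c \<le> f (argmax_sel B f))"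
    unfolding argmax_sel_def by (rule LeastI)
  then show "argmax_sel B f \<in> B" and "c \<in> B \<Longrightarrow> f c \<le> f (argmax_sel B f)" by auto
qed

lemma measurable_argmax_sel [measurable]:
  assumes "finite B" "\<And>b. b \<in> B \<Longrightarrow> (\<lambda>\<omega>. f \<omega> b) \<in> borel_measurable N"
  shows "(\<lambda>\<omega>. argmax_sel B (f \<omega>)) \<in> measurable N (count_space UNIV)"
  unfolding argmax_sel_def
proof (rule measurable_Least)
  fix b
  have "Measurable.pred N (\<lambda>\<omega>. \<forall>c\<in>B. f \<omega> c \<le> f \<omega> b)" if "b \<in> B"
    using assms that by (intro pred_intros_finite) auto
  then show "Measurable.pred N (\<lambda>\<omega>. b \<in> B \<and> (\<forall>c\<in>B. f \<omega> c \<le> f \<omega> b))"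
    by (cases "b \<in> B") auto
qed

lemma measurable_of_bool [measurable]:
  "Measurable.pred N P \<Longrightarrow> (\<lambda>\<omega>. of_bool (P \<omega>) :: real) \<in> borel_measurable N"
  unfolding of_bool_def by measurable

definition ts_index ::
    "(nat \<Rightarrow> real) \<Rightarrow> real \<Rightarrow> (nat \<Rightarrow> nat) \<Rightarrow> (nat \<Rightarrow> real) \<Rightarrow> (nat \<Rightarrow> nat \<Rightarrow> real) \<Rightarrow> nat \<Rightarrow> nat \<Rightarrow> real" where
  "ts_index \<mu> \<sigma> A x z b t =
     mubar A (\<lambda>s. \<mu> (A s) + \<sigma> * x s) b t + \<sigma> * nbar A b t powr (- 1 / 2) * z b (Suc t)"

text \<open>
  The run that breaks ties in favour of the least arm, as a function of the driving randomness
  \<open>y\<close>; its state consists of \<open>nbar\<close>, \<open>mubar\<close> and the last arm pulled.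
\<close>

primrec run_state ::
    "nat \<Rightarrow> (nat \<Rightarrow> real) \<Rightarrow> real \<Rightarrow> (nat + nat \<times> nat \<Rightarrow> real) \<Rightarrow> nat \<Rightarrow> (nat \<Rightarrow> real) \<times> (nat \<Rightarrow> real) \<times> nat" where
  "run_state K \<mu> \<sigma> y 0 = (\<lambda>_. 1, \<lambda>_. 0, 0)"
| "run_state K \<mu> \<sigma> y (Suc t) =
    (let n = fst (run_state K \<mu> \<sigma> y t); m = fst (snd (run_state K \<mu> \<sigma> y t));
         a = argmax_sel {1..K} (\<lambda>b. m b + \<sigma> * n b powr (- 1 / 2) * y (Inr (b, Suc t)))
     in (\<lambda>b. n b + of_bool (a = b),
         \<lambda>b. (n b * m b + of_bool (a = b) * (\<mu> a + \<sigma> * y (Inl (Suc t)))) / (n b + of_bool (a = b)), a))"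

definition run_arm :: "nat \<Rightarrow> (nat \<Rightarrow> real) \<Rightarrow> real \<Rightarrow> (nat + nat \<times> nat \<Rightarrow> real) \<Rightarrow> nat \<Rightarrow> nat" where
  "run_arm K \<mu> \<sigma> y t = snd (snd (run_state K \<mu> \<sigma> y t))"

lemma run_state_eq:
  "fst (run_state K \<mu> \<sigma> y t) = (\<lambda>b. nbar (run_arm K \<mu> \<sigma> y) b t) \<and>
   fst (snd (run_state K \<mu> \<sigma> y t)) =
     (\<lambda>b. mubar (run_arm K \<mu> \<sigma> y) (\<lambda>s. \<mu> (run_arm K \<mu> \<sigma> y s) + \<sigma> * y (Inl s)) b t)"
proof (induction t)
  case (Suc t)
  then show ?case by (auto simp: Let_def run_arm_def fun_eq_iff)
qed simp

lemma run_arm_Suc: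
  "run_arm K \<mu> \<sigma> y (Suc t) =
     argmax_sel {1..K} (\<lambda>b. ts_index \<mu> \<sigma> (run_arm K \<mu> \<sigma> y) (\<lambda>s. y (Inl s)) (\<lambda>b s. y (Inr (b, s))) b t)"
  using run_state_eq[of K \<mu> \<sigma> y t]
  by (simp add: run_arm_def[of K \<mu> \<sigma> y "Suc t"] Let_def ts_index_def)

text \<open>The arm of round \<open>Suc t\<close> is chosen after that round's samples are drawn and
  before its noise is seen; the different ranges of \<open>s\<close> for noises and samples record
  this.\<close>

lemma measurable_run_arm:
  assumes x: "\<And>s. 1 \<le> s \<Longrightarrow> s \<le> t \<Longrightarrow> (\<lambda>\<omega>. y \<omega> (Inl s)) \<in> borel_measurable N"
    and z: "\<And>b s. b \<in> {1..K} \<Longrightarrow> 1 \<le> s \<Longrightarrow> s \<le> Suc t \<Longrightarrow> (\<lambda>\<omega>. y \<omega> (Inr (b, s))) \<in> borel_measurable N"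
  shows "(\<lambda>\<omega>. run_arm K \<mu> \<sigma> (y \<omega>) (Suc t)) \<in> measurable N (count_space UNIV)"
proof -
  \<comment> \<open>Kept apart from the induction on the state because the last round needs only the
    arm: the state after it would involve the unseen noise.\<close>
  have step: "(\<lambda>\<omega>. snd (snd (run_state K \<mu> \<sigma> (y \<omega>) (Suc s)))) \<in> measurable N (count_space UNIV)"
    if "s \<le> t" and [measurable]: "\<And>b. (\<lambda>\<omega>. fst (run_state K \<mu> \<sigma> (y \<omega>) s) b) \<in> borel_measurable N"
      "\<And>b. (\<lambda>\<omega>. fst (snd (run_state K \<mu> \<sigma> (y \<omega>) s)) b) \<in> borel_measurable N" for s
  proof -
    have "(\<lambda>\<omega>. argmax_sel {1..K} (\<lambda>b. fst (snd (run_state K \<mu> \<sigma> (y \<omega>) s)) b +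
        \<sigma> * fst (run_state K \<mu> \<sigma> (y \<omega>) s) b powr (- 1 / 2) * y \<omega> (Inr (b, Suc s)))) \<in> measurable N (count_space UNIV)"
    proof (rule measurable_argmax_sel)
      fix b assume "b \<in> {1..K}"
      then have [measurable]: "(\<lambda>\<omega>. y \<omega> (Inr (b, Suc s))) \<in> borel_measurable N"
        using z that by auto
      show "(\<lambda>\<omega>. fst (snd (run_state K \<mu> \<sigma> (y \<omega>) s)) b +
        \<sigma> * fst (run_state K \<mu> \<sigma> (y \<omega>) s) b powr (- 1 / 2) * y \<omega> (Inr (b, Suc s))) \<in> borel_measurable N"
        by measurable
    qed simp
    then show ?thesis by (simp add: Let_def)
  qed
  have st: "(\<forall>b. (\<lambda>\<omega>. fst (run_state K \<mu> \<sigma> (y \<omega>) s) b) \<in> borel_measurable N) \<and>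
    (\<forall>b. (\<lambda>\<omega>. fst (snd (run_state K \<mu> \<sigma> (y \<omega>) s)) b) \<in> borel_measurable N)" if "s \<le> t" for s
    using that
  proof (induction s)
    case (Suc s)
    define n where "n = (\<lambda>b \<omega>. fst (run_state K \<mu> \<sigma> (y \<omega>) s) b)"
    define m where "m = (\<lambda>b \<omega>. fst (snd (run_state K \<mu> \<sigma> (y \<omega>) s)) b)"
    define a where "a = (\<lambda>\<omega>. snd (snd (run_state K \<mu> \<sigma> (y \<omega>) (Suc s))))"
    have [measurable]: "n b \<in> borel_measurable N" "m b \<in> borel_measurable N" for b
      using Suc by (auto simp: n_def m_def)
    have a[measurable]: "a \<in> measurable N (count_space UNIV)"
      unfolding a_def using Suc by (intro step) auto
    have [measurable]: "(\<lambda>\<omega>. \<mu> (a \<omega>)) \<in> borel_measurable N"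
      by (rule measurable_compose[OF a]) simp
    have [measurable]: "(\<lambda>\<omega>. y \<omega> (Inl (Suc s))) \<in> borel_measurable N"
      using x Suc by auto
    have eqs: "(\<lambda>\<omega>. fst (run_state K \<mu> \<sigma> (y \<omega>) (Suc s)) b) = (\<lambda>\<omega>. n b \<omega> + of_bool (a \<omega> = b))"
      "(\<lambda>\<omega>. fst (snd (run_state K \<mu> \<sigma> (y \<omega>) (Suc s))) b) =
        (\<lambda>\<omega>. (n b \<omega> * m b \<omega> + of_bool (a \<omega> = b) * (\<mu> (a \<omega>) + \<sigma> * y \<omega> (Inl (Suc s))))
          / (n b \<omega> + of_bool (a \<omega> = b)))"
      for b by (simp_all add: Let_def n_def m_def a_def fun_eq_iff)
    have ms: "(\<lambda>\<omega>. n b \<omega> + of_bool (a \<omega> = b)) \<in> borel_measurable N"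
      "(\<lambda>\<omega>. (n b \<omega> * m b \<omega> + of_bool (a \<omega> = b) * (\<mu> (a \<omega>) + \<sigma> * y \<omega> (Inl (Suc s))))
          / (n b \<omega> + of_bool (a \<omega> = b))) \<in> borel_measurable N" for b
      by measurable
    show ?case unfolding eqs using ms by blast
  qed simp
  show ?thesis unfolding run_arm_def by (rule step[OF order_refl]) (use st[OF order_refl] in blast)+
qed

section \<open>Information before and after a pull\<close>

definition noise_and_samples :: "nat \<Rightarrow> (nat + nat \<times> nat) set" where
  "noise_and_samples K = {1..} <+> {1..K} \<times> {1..}"

definition hist_index :: "nat \<Rightarrow> nat \<Rightarrow> (nat + nat \<times> nat) set" where
  "hist_index K t = {1..t} <+> {1..K} \<times> {1..t}"

text \<open>What is known when the arm of round \<open>Suc t\<close> is pulled: the history and the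
  samples of that round. The noise \<open>Inl (Suc t)\<close> is left out and hence independent of
  the choice.\<close>

definition pre_index :: "nat \<Rightarrow> nat \<Rightarrow> (nat + nat \<times> nat) set" where
  "pre_index K t = {1..t} <+> {1..K} \<times> {1..Suc t}"

definition row_index :: "nat \<Rightarrow> nat \<Rightarrow> (nat + nat \<times> nat) set" where
  "row_index K t = {} <+> {1..K} \<times> {t}"

context thompson_sampling
begin

abbreviation "driver \<equiv> case_sum \<xi> (case_prod Z)"

abbreviation "gen \<equiv> gen_algebra M driver"

lemma indep': "indep_vars (\<lambda>_. borel) driver (noise_and_samples K)"
  using indep by (simp add: noise_and_samples_def)

lemma index_subset:
  "hist_index K t \<subseteq> noise_and_samples K" "pre_index K t \<subseteq> noise_and_samples K"
  "t \<ge> 1 \<Longrightarrow> row_index K t \<subseteq> noise_and_samples K" "{Inl (Suc t)} \<subseteq> noise_and_samples K"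
  "hist_index K t \<subseteq> pre_index K t" "pre_index K t \<subseteq> hist_index K (Suc t)"
  "row_index K (Suc t) \<subseteq> pre_index K t" "s \<le> t \<Longrightarrow> hist_index K s \<subseteq> hist_index K t"
  by (auto simp: hist_index_def pre_index_def row_index_def noise_and_samples_def)

lemma index_disjoint:
  "hist_index K t \<inter> row_index K (Suc t) = {}" "pre_index K t \<inter> {Inl (Suc t)} = {}"
  by (auto simp: hist_index_def pre_index_def row_index_def)

lemma noise_measurable: "Inl t \<in> J \<Longrightarrow> \<xi> t \<in> borel_measurable (gen J)"
  using measurable_gen_algebra_component[of "Inl t" J driver M] by simp

lemma sample_measurable: "Inr (b, t) \<in> J \<Longrightarrow> Z b t \<in> borel_measurable (gen J)"
  using measurable_gen_algebra_component[of "Inr (b, t)" J driver M] by simp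

lemma noise_rv [measurable]: "t \<ge> 1 \<Longrightarrow> \<xi> t \<in> borel_measurable M"
  using measurable_gen_algebra_imp[OF indep' subset_refl noise_measurable]
  by (auto simp: noise_and_samples_def Plus_def)

lemma sample_rv [measurable]: "b \<in> {1..K} \<Longrightarrow> t \<ge> 1 \<Longrightarrow> Z b t \<in> borel_measurable M"
  using measurable_gen_algebra_imp[OF indep' subset_refl sample_measurable]
  by (auto simp: noise_and_samples_def Plus_def)

lemma prob_sample:
  assumes "b \<in> {1..K}" "t \<ge> 1" "B \<in> sets borel"
  shows "prob {\<omega> \<in> space M. Z b t \<omega> \<in> B} = measure D B"
  using sample_law[OF assms(1,2)] measure_distr[OF sample_rv[OF assms(1,2)] assms(3)]
  by (auto intro!: arg_cong[where f = prob])

lemma prob_row: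
  assumes "1 \<le> K" "t \<ge> 1" "\<And>b. b \<in> {1..K} \<Longrightarrow> B b \<in> sets borel"
  shows "prob {\<omega> \<in> space M. \<forall>b\<in>{1..K}. Z b t \<omega> \<in> B b} = (\<Prod>b\<in>{1..K}. measure D (B b))"
proof -
  have inj: "inj_on (\<lambda>b. Inr (b, t) :: nat + nat \<times> nat) {1..K}" by (auto simp: inj_on_def)
  let ?R = "(\<lambda>b. Inr (b, t) :: nat + nat \<times> nat) ` {1..K}"
  have "prob (\<Inter>i\<in>?R. driver i -` B (fst (projr i)) \<inter> space M)
      = (\<Prod>i\<in>?R. prob (driver i -` B (fst (projr i)) \<inter> space M))"
    using assms by (intro indep_varsD[OF indep']) (auto simp: noise_and_samples_def Plus_def)
  then have "prob (\<Inter>b\<in>{1..K}. Z b t -` B b \<inter> space M) = (\<Prod>b\<in>{1..K}. prob (Z b t -` B b \<inter> space M))"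
    unfolding prod.reindex[OF inj] image_image by (simp add: o_def image_image)
  moreover have "(\<Inter>b\<in>{1..K}. Z b t -` B b \<inter> space M) = {\<omega> \<in> space M. \<forall>b\<in>{1..K}. Z b t \<omega> \<in> B b}"
    using assms(1) by auto
  moreover have "prob (Z b t -` B b \<inter> space M) = measure D (B b)" if "b \<in> {1..K}" for b
    using prob_sample[OF that assms(2) assms(3)[OF that]]
    by (simp add: vimage_def Int_def conj_commute)
  ultimately show ?thesis by simp
qed

lemma pull_in_arms: "\<omega> \<in> space M \<Longrightarrow> A (Suc t) \<omega> \<in> {1..K}"
  using pull_argmax[of \<omega> t] by (simp add: is_arg_max_linorder)

lemma pull_index_max:
  assumes "\<omega> \<in> space M" "b \<in> {1..K}"
  shows "ts_index \<mu> \<sigma> (\<lambda>s. A s \<omega>) (\<lambda>s. \<xi> s \<omega>) (\<lambda>b s. Z b s \<omega>) b t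
    \<le> ts_index \<mu> \<sigma> (\<lambda>s. A s \<omega>) (\<lambda>s. \<xi> s \<omega>) (\<lambda>b s. Z b s \<omega>) (A (Suc t) \<omega>) t"
  using pull_argmax[of \<omega> t] assms by (simp add: is_arg_max_linorder ts_index_def)

text \<open>Restricting the driver to the independent family makes the run a function on the product
  space, so that laws can be read off from the product measure in
  \<open>prob_canonical_count\<close>.\<close>

definition canonical_arm :: "nat \<Rightarrow> 'w \<Rightarrow> nat" where
  "canonical_arm t \<omega> = run_arm K \<mu> \<sigma> (\<lambda>i\<in>noise_and_samples K. driver i \<omega>) t"

lemma canonical_arm_measurable:
  "canonical_arm (Suc t) \<in> measurable (gen (pre_index K t)) (count_space UNIV)"
proof -
  have "(\<lambda>\<omega>. run_arm K \<mu> \<sigma> (\<lambda>i\<in>noise_and_samples K. driver i \<omega>) (Suc t))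
      \<in> measurable (gen (pre_index K t)) (count_space UNIV)"
    by (rule measurable_run_arm)
       (auto simp: noise_and_samples_def pre_index_def Plus_def intro!: noise_measurable sample_measurable)
  then show ?thesis by (simp add: canonical_arm_def[abs_def])
qed

lemma canonical_index:
  assumes "b \<in> {1..K}"
  shows "ts_index \<mu> \<sigma> (run_arm K \<mu> \<sigma> (\<lambda>i\<in>noise_and_samples K. driver i \<omega>))
      (\<lambda>s. (\<lambda>i\<in>noise_and_samples K. driver i \<omega>) (Inl s))
      (\<lambda>b s. (\<lambda>i\<in>noise_and_samples K. driver i \<omega>) (Inr (b, s))) b t
    = ts_index \<mu> \<sigma> (\<lambda>s. canonical_arm s \<omega>) (\<lambda>s. \<xi> s \<omega>) (\<lambda>b s. Z b s \<omega>) b t"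
  unfolding ts_index_def
  by (intro arg_cong2[where f = "(+)"] arg_cong2[where f = "(*)"] arg_cong2[where f = "(powr)"]
      mubar_cong nbar_cong refl)
     (use assms in \<open>auto simp: noise_and_samples_def canonical_arm_def Plus_def\<close>)

lemma canonical_arm_max:
  assumes "1 \<le> K"
  shows "canonical_arm (Suc t) \<omega> \<in> {1..K}"
    and "b \<in> {1..K} \<Longrightarrow> ts_index \<mu> \<sigma> (\<lambda>s. canonical_arm s \<omega>) (\<lambda>s. \<xi> s \<omega>) (\<lambda>b s. Z b s \<omega>) b t
    \<le> ts_index \<mu> \<sigma> (\<lambda>s. canonical_arm s \<omega>) (\<lambda>s. \<xi> s \<omega>) (\<lambda>b s. Z b s \<omega>) (canonical_arm (Suc t) \<omega>) t"
proof -
  let ?y = "\<lambda>i\<in>noise_and_samples K. driver i \<omega>"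
  let ?f = "\<lambda>b. ts_index \<mu> \<sigma> (run_arm K \<mu> \<sigma> ?y) (\<lambda>s. ?y (Inl s)) (\<lambda>b s. ?y (Inr (b, s))) b t"
  have eq: "canonical_arm (Suc t) \<omega> = argmax_sel {1..K} ?f"
    unfolding canonical_arm_def by (rule run_arm_Suc)
  have "{1..K} \<noteq> {}" using assms by auto
  note * = argmax_sel[OF finite_atLeastAtMost this, where f = ?f]
  show 1: "canonical_arm (Suc t) \<omega> \<in> {1..K}" using *(1) eq by simp
  show "ts_index \<mu> \<sigma> (\<lambda>s. canonical_arm s \<omega>) (\<lambda>s. \<xi> s \<omega>) (\<lambda>b s. Z b s \<omega>) b t
    \<le> ts_index \<mu> \<sigma> (\<lambda>s. canonical_arm s \<omega>) (\<lambda>s. \<xi> s \<omega>) (\<lambda>b s. Z b s \<omega>) (canonical_arm (Suc t) \<omega>) t"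
    if "b \<in> {1..K}"
    using *(2)[OF that] eq unfolding canonical_index[OF that] canonical_index[OF 1] eq[symmetric] by simp
qed

lemma thompson_sampling_canonical:
  assumes "1 \<le> K"
  shows "thompson_sampling M K \<mu> \<sigma> D \<xi> Z canonical_arm"
proof unfold_locales
  show "canonical_arm t \<in> measurable M (count_space UNIV)" if t: "t \<ge> 1" for t
  proof -
    obtain s where "t = Suc s" using t by (cases t) auto
    then show ?thesis
      using measurable_gen_algebra_imp[OF indep' index_subset(2) canonical_arm_measurable] by simp
  qed
next
  show "is_arg_max
        (\<lambda>b. mubar (\<lambda>s. canonical_arm s \<omega>) (\<lambda>s. \<mu> (canonical_arm s \<omega>) + \<sigma> * \<xi> s \<omega>) b t
             + \<sigma> * nbar (\<lambda>s. canonical_arm s \<omega>) b t powr (- 1 / 2) * Z b (Suc t) \<omega>)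
        (\<lambda>b. b \<in> {1..K}) (canonical_arm (Suc t) \<omega>)" for t \<omega>
    using canonical_arm_max[OF assms] by (simp add: is_arg_max_linorder ts_index_def)
qed (fact sigma_pos indep noise_identical noise_integrable noise_sq_integrable noise_mean noise_variance
      sample_law)+

end

text \<open>A special case of grouping into disjoint blocks: the blocks are the singletons
  \<open>{\<rho> j}\<close>, disjoint by injectivity, and each is then projected to its only
  coordinate.\<close>

lemma (in prob_space) indep_vars_reindex:
  assumes ind: "indep_vars (\<lambda>_. N) X I" and inj: "inj_on \<rho> I'" and sub: "\<rho> ` I' \<subseteq> I"
  shows "indep_vars (\<lambda>_. N) (\<lambda>i. X (\<rho> i)) I'"
proof -
  have "indep_vars (\<lambda>j. PiM {\<rho> j} (\<lambda>_. N)) (\<lambda>j \<omega>. restrict (\<lambda>i. X i \<omega>) {\<rho> j}) I'"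
    by (rule indep_vars_restrict[OF ind])
       (use inj sub in \<open>auto simp: disjoint_family_on_def inj_on_def\<close>)
  then have "indep_vars (\<lambda>_. N) (\<lambda>j \<omega>. (restrict (\<lambda>i. X i \<omega>) {\<rho> j}) (\<rho> j)) I'"
    by (rule indep_vars_compose2[where Y = "\<lambda>j f. f (\<rho> j)"]) auto
  then show ?thesis by simp
qed

context thompson_sampling
begin

definition "cnt b t \<omega> = pull_count (\<lambda>s. A s \<omega>) b t"
definition "nb b t \<omega> = nbar (\<lambda>s. A s \<omega>) b t"
definition "mb b t \<omega> = mubar (\<lambda>s. A s \<omega>) (\<lambda>s. \<mu> (A s \<omega>) + \<sigma> * \<xi> s \<omega>) b t"
definition "pn b t \<omega> = pull_noise (\<lambda>s. A s \<omega>) (\<lambda>s. \<xi> s \<omega>) b t"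
definition "idx b t \<omega> = ts_index \<mu> \<sigma> (\<lambda>s. A s \<omega>) (\<lambda>s. \<xi> s \<omega>) (\<lambda>b s. Z b s \<omega>) b t"

lemma idx_eq: "idx b t \<omega> = mb b t \<omega> + \<sigma> * nb b t \<omega> powr (- 1 / 2) * Z b (Suc t) \<omega>"
  by (simp add: ts_index_def idx_def mb_def nb_def)

lemma nb_eq: "nb b t \<omega> = 1 + real (cnt b t \<omega>)"
  by (simp add: nb_def cnt_def nbar_eq_pull_count)

lemma nb_pos [simp]: "nb b t \<omega> > 0"
  by (simp add: nb_eq)

lemma nb_neq_0 [simp]: "nb b t \<omega> \<noteq> 0"
  using nb_pos[of b t \<omega>] by linarith

lemma mb_eq: "mb b t \<omega> = \<mu> b + (\<sigma> * pn b t \<omega> - \<mu> b) / nb b t \<omega>"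
  unfolding mb_def pn_def nb_def by (rule mubar_eq)

lemma idx_le_pull:
  assumes "\<omega> \<in> space M" "b \<in> {1..K}"
  shows "idx b t \<omega> \<le> idx (A (Suc t) \<omega>) t \<omega>"
  using pull_index_max[OF assms] by (simp add: idx_def)

lemma cnt_0 [simp]: "cnt b 0 \<omega> = 0"
  by (simp add: cnt_def)

lemma cnt_Suc: "cnt b (Suc t) \<omega> = cnt b t \<omega> + of_bool (A (Suc t) \<omega> = b)"
  by (simp add: cnt_def pull_count_Suc)

lemma pn_0 [simp]: "pn b 0 \<omega> = 0"
  by (simp add: pn_def)

lemma pn_Suc: "pn b (Suc t) \<omega> = pn b t \<omega> + of_bool (A (Suc t) \<omega> = b) * \<xi> (Suc t) \<omega>"
  by (simp add: pn_def pull_noise_Suc)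

end

text \<open>A run of \<open>thompson_sampling\<close> may break ties by looking at later noises.
  Adaptedness is what makes fresh noise independent of the choice; it holds for the canonical run,
  and the estimates are carried out for such runs.\<close>

locale adapted_thompson = thompson_sampling M K \<mu> \<sigma> D \<xi> Z A + law: sampling_law D
  for M :: "'w measure" and K \<mu> \<sigma> D \<xi> Z A +
  assumes K_ge_1: "1 \<le> K"
    and adapted: "A (Suc t) \<in> measurable (gen (pre_index K t)) (count_space UNIV)"
begin

lemma pull_measurable_hist:
  assumes "1 \<le> s" "s \<le> t"
  shows "A s \<in> measurable (gen (hist_index K t)) (count_space UNIV)"
proof -
  obtain r where r: "s = Suc r" using assms by (cases s) auto
  then have "pre_index K r \<subseteq> hist_index K t"
    using index_subset(6) index_subset(8)[OF assms(2)] by (metis subset_trans)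
  then show ?thesis using measurable_gen_algebra_mono adapted r by blast
qed

lemma cnt_measurable: "cnt b t \<in> measurable (gen (hist_index K t)) (count_space UNIV)"
proof -
  have "(\<lambda>\<omega>. real (cnt b t \<omega>)) \<in> borel_measurable (gen (hist_index K t))"
    unfolding cnt_def pull_count_def of_nat_sum of_nat_of_bool
    by (intro borel_measurable_sum measurable_of_bool
        pred_eq_const1[OF pull_measurable_hist]) auto
  then have "(\<lambda>\<omega>. nat \<lfloor>real (cnt b t \<omega>)\<rfloor>) \<in> measurable (gen (hist_index K t)) (count_space UNIV)"
    by measurable
  then show ?thesis by simp
qed

lemma nb_measurable: "nb b t \<in> borel_measurable (gen (hist_index K t))"
  unfolding nb_eq
  by (intro borel_measurable_add borel_measurable_const measurable_compose[OF cnt_measurable]) simp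

lemma pn_measurable: "pn b t \<in> borel_measurable (gen (hist_index K t))"
  unfolding pn_def pull_noise_def
  by (intro borel_measurable_sum borel_measurable_times measurable_of_bool
      pred_eq_const1[OF pull_measurable_hist] noise_measurable)
     (auto simp: hist_index_def Plus_def)

lemma mb_measurable: "mb b t \<in> borel_measurable (gen (hist_index K t))"
  unfolding mb_eq using pn_measurable nb_measurable by measurable

lemma hist_imp_pre:
  "f \<in> measurable (gen (hist_index K t)) N \<Longrightarrow> f \<in> measurable (gen (pre_index K t)) N"
  by (rule measurable_gen_algebra_mono[OF index_subset(5)])

lemma hist_imp_M: "f \<in> measurable (gen (hist_index K t)) N \<Longrightarrow> f \<in> measurable M N"
  by (rule measurable_gen_algebra_imp[OF indep' index_subset(1)])

lemma pre_imp_M: "f \<in> measurable (gen (pre_index K t)) N \<Longrightarrow> f \<in> measurable M N"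
  by (rule measurable_gen_algebra_imp[OF indep' index_subset(2)])

lemmas cnt_measurable_M [measurable] = cnt_measurable[THEN hist_imp_M]
lemmas nb_measurable_M [measurable] = nb_measurable[THEN hist_imp_M]
lemmas pn_measurable_M [measurable] = pn_measurable[THEN hist_imp_M]
lemmas mb_measurable_M [measurable] = mb_measurable[THEN hist_imp_M]
lemmas pull_measurable_M [measurable] = adapted[THEN pre_imp_M]

text \<open>With everything frozen except the sample of \<open>b\<close>, a tie pins that sample to
  one point, which has mass zero because \<open>cdf D\<close> is continuous.\<close>

lemma prob_tie:
  assumes "b \<in> {1..K}" "c \<in> {1..K}" "b \<noteq> c"
  shows "prob {\<omega> \<in> space M. idx b t \<omega> = idx c t \<omega>} = 0"
proof -
  let ?J1 = "hist_index K t \<union> {Inr (c, Suc t)}" and ?J2 = "{Inr (b, Suc t)}"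
  let ?G1 = "gen ?J1" and ?G2 = "gen ?J2"
  have sub: "?J1 \<subseteq> noise_and_samples K" "?J2 \<subseteq> noise_and_samples K" "?J1 \<inter> ?J2 = {}"
    using assms by (auto simp: noise_and_samples_def hist_index_def Plus_def)
  have [measurable]: "mb b t \<in> borel_measurable ?G1" "nb b t \<in> borel_measurable ?G1"
    "mb c t \<in> borel_measurable ?G1" "nb c t \<in> borel_measurable ?G1"
    using mb_measurable nb_measurable measurable_gen_algebra_mono[of "hist_index K t" ?J1] by blast+
  have [measurable]: "Z c (Suc t) \<in> borel_measurable ?G1" "Z b (Suc t) \<in> borel_measurable ?G2"
    by (auto intro!: sample_measurable)
  let ?Q = "\<lambda>\<omega> \<omega>'. mb b t \<omega> + \<sigma> * nb b t \<omega> powr (- 1 / 2) * Z b (Suc t) \<omega>' = idx c t \<omega>"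
  \<comment> \<open>Nullity is obtained from the comparison lemma with factor 0 and an impossible
    second event.\<close>
  have "prob {\<omega> \<in> space M. ?Q \<omega> \<omega>} \<le> 0 * prob {\<omega> \<in> space M. False}"
  proof (rule prob_gen_algebra_freeze_le[OF indep' sub, where Q = ?Q and Q' = "\<lambda>_ _. False"])
    show "space M \<in> sets ?G1" using sets.top[of ?G1] by simp
    have [measurable]: "idx c t \<in> borel_measurable ?G1"
      unfolding idx_eq by measurable
    show "Measurable.pred (?G1 \<Otimes>\<^sub>M ?G2) (\<lambda>p. ?Q (fst p) (snd p))"
      by measurable
    fix \<omega>
    define w where "w = \<sigma> * nb b t \<omega> powr (- 1 / 2)"
    have "w > 0" unfolding w_def using sigma_pos by simp
    then have "(m + w * z = i) = (z = (i - m) / w)" for m z i :: real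
      using nonzero_eq_divide_eq[of w z "i - m"] by (auto simp: algebra_simps)
    then have "{\<omega>' \<in> space M. ?Q \<omega> \<omega>'}
        = {\<omega>' \<in> space M. Z b (Suc t) \<omega>' \<in> {(idx c t \<omega> - mb b t \<omega>) / w}}"
      unfolding w_def by simp
    then show "prob {\<omega>' \<in> space M. ?Q \<omega> \<omega>'} \<le> 0 * prob {\<omega>' \<in> space M. False}"
      using prob_sample[OF assms(1), of "Suc t" "{(idx c t \<omega> - mb b t \<omega>) / w}"] by simp
  qed auto
  then show ?thesis unfolding idx_eq[of b] by (simp add: measure_le_0_iff)
qed

lemma idx_measurable_M [measurable]: "b \<in> {1..K} \<Longrightarrow> idx b t \<in> borel_measurable M"
  unfolding idx_eq by measurable

lemma no_ties_AE:
  "AE \<omega> in M. \<forall>t. \<forall>b\<in>{1..K}. \<forall>c\<in>{1..K}. b \<noteq> c \<longrightarrow> idx b t \<omega> \<noteq> idx c t \<omega>"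
proof -
  have *: "AE \<omega> in M. b \<noteq> c \<longrightarrow> idx b t \<omega> \<noteq> idx c t \<omega>" if bc: "b \<in> {1..K}" "c \<in> {1..K}" for b c t
  proof (cases "b = c")
    case False
    have "{\<omega> \<in> space M. idx b t \<omega> = idx c t \<omega>} \<in> sets M"
      using idx_measurable_M bc by measurable
    then have "AE \<omega> in M. \<not> (idx b t \<omega> = idx c t \<omega>)"
      using prob_tie[OF bc False, of t] by (intro AE_I') (auto simp: null_sets_def emeasure_eq_measure)
    then show ?thesis by simp
  qed simp
  show ?thesis
    unfolding AE_all_countable
    by (intro allI AE_finite_allI[OF finite_atLeastAtMost] *)
qed

text \<open>Strong induction over the rounds: equal pasts give equal indices, both arms maximise
  them, and outside a null set the maximiser is unique. Only \<open>A\<close> is adapted here;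
  \<open>A'\<close> may break ties in its own way.\<close>

lemma thompson_sampling_unique:
  assumes "thompson_sampling M K \<mu> \<sigma> D \<xi> Z A'"
  shows "AE \<omega> in M. \<forall>t. A' (Suc t) \<omega> = A (Suc t) \<omega>"
  using no_ties_AE AE_space
proof eventually_elim
  case (elim \<omega>)
  interpret A': thompson_sampling M K \<mu> \<sigma> D \<xi> Z A' by (rule assms)
  show ?case
  proof
    fix t
    show "A' (Suc t) \<omega> = A (Suc t) \<omega>"
    proof (induction t rule: less_induct)
      case (less t)
      have eq: "A' s \<omega> = A s \<omega>" if "1 \<le> s" "s \<le> t" for s
        using less[of "s - 1"] that by simp
      have idx: "A'.idx b t \<omega> = idx b t \<omega>" for b
        unfolding A'.idx_def idx_def ts_index_def using eq
        by (auto intro!: arg_cong2[where f = "(+)"] arg_cong2[where f = "(*)"] arg_cong2[where f = "(powr)"]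
            mubar_cong nbar_cong)
      let ?a = "A (Suc t) \<omega>" and ?a' = "A' (Suc t) \<omega>"
      have mem: "?a \<in> {1..K}" "?a' \<in> {1..K}"
        using pull_in_arms A'.pull_in_arms elim by auto
      then have "idx ?a t \<omega> = idx ?a' t \<omega>"
        using idx_le_pull[OF elim(2), of ?a' t] A'.idx_le_pull[OF elim(2), of ?a t] unfolding idx by simp
      then show ?case using elim(1) mem by metis
    qed
  qed
qed

end

section \<open>Invariance in law of the pull counts\<close>

context thompson_sampling
begin

lemma adapted_thompson_canonical:
  assumes "1 \<le> K" "sampling_law D"
  shows "adapted_thompson M K \<mu> \<sigma> D \<xi> Z canonical_arm"
  using thompson_sampling_canonical[OF assms(1)] assms canonical_arm_measurable
  by (simp add: adapted_thompson_def adapted_thompson_axioms_def)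

lemma driver_distr:
  assumes "1 \<le> K"
  shows "distr M (PiM (noise_and_samples K) (\<lambda>_. borel)) (\<lambda>\<omega>. \<lambda>i\<in>noise_and_samples K. driver i \<omega>)
    = PiM (noise_and_samples K) (\<lambda>i. case i of Inl s \<Rightarrow> distr M borel (\<xi> 1) | Inr _ \<Rightarrow> D)"
proof -
  have ne: "noise_and_samples K \<noteq> {}" by (auto simp: noise_and_samples_def)
  have rv: "random_variable borel (driver i)" if "i \<in> noise_and_samples K" for i
    using indep' that by (auto simp: indep_vars_def)
  have "distr M (PiM (noise_and_samples K) (\<lambda>_. borel)) (\<lambda>\<omega>. \<lambda>i\<in>noise_and_samples K. driver i \<omega>)
      = PiM (noise_and_samples K) (\<lambda>i. distr M borel (driver i))"
    using indep_vars_iff_distr_eq_PiM'[OF ne rv] indep' by simp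
  also have "\<dots> = PiM (noise_and_samples K) (\<lambda>i. case i of Inl s \<Rightarrow> distr M borel (\<xi> 1) | Inr _ \<Rightarrow> D)"
  proof (rule PiM_cong[OF refl])
    fix i assume i: "i \<in> noise_and_samples K"
    show "distr M borel (driver i) = (case i of Inl s \<Rightarrow> distr M borel (\<xi> 1) | Inr _ \<Rightarrow> D)"
    proof (cases i)
      case (Inl s)
      then have "1 \<le> s" using i by (auto simp: noise_and_samples_def Plus_def)
      then show ?thesis using noise_identical[of s] Inl by simp
    qed (use i in \<open>auto simp: noise_and_samples_def Plus_def intro: sample_law\<close>)
  qed
  finally show ?thesis .
qed

text \<open>The product measure on the right depends on the samples only through their common law
  \<open>D\<close>. Hence two sample families, such as a family and its relabelling, give canonical
  counts with the same law.\<close>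

lemma prob_canonical_count:
  assumes "1 \<le> K"
  shows "prob {\<omega> \<in> space M. P (pull_count (\<lambda>s. canonical_arm s \<omega>) b T)}
    = measure (PiM (noise_and_samples K) (\<lambda>i. case i of Inl s \<Rightarrow> distr M borel (\<xi> 1) | Inr _ \<Rightarrow> D))
        {y \<in> space (PiM (noise_and_samples K) (\<lambda>_. borel)). P (pull_count (run_arm K \<mu> \<sigma> y) b T)}"
proof -
  let ?N = "PiM (noise_and_samples K) (\<lambda>_. borel :: real measure)"
  let ?r = "\<lambda>\<omega>. \<lambda>i\<in>noise_and_samples K. driver i \<omega>"
  let ?E = "{y \<in> space ?N. P (pull_count (run_arm K \<mu> \<sigma> y) b T)}"
  have arm: "(\<lambda>y. run_arm K \<mu> \<sigma> y s) \<in> measurable ?N (count_space UNIV)" if s: "s \<ge> 1" for s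
  proof -
    obtain r where "s = Suc r" using s by (cases s) auto
    then show ?thesis
      using measurable_run_arm[of r "\<lambda>y. y" ?N K \<mu> \<sigma>]
      by (auto simp: noise_and_samples_def Plus_def intro!: measurable_component_singleton)
  qed
  have "(\<lambda>y. real (pull_count (run_arm K \<mu> \<sigma> y) b T)) \<in> borel_measurable ?N"
    unfolding pull_count_def of_nat_sum of_nat_of_bool
    by (intro borel_measurable_sum measurable_of_bool pred_eq_const1[OF arm]) auto
  then have "(\<lambda>y. nat \<lfloor>real (pull_count (run_arm K \<mu> \<sigma> y) b T)\<rfloor>) \<in> measurable ?N (count_space UNIV)"
    by measurable
  then have cm: "(\<lambda>y. pull_count (run_arm K \<mu> \<sigma> y) b T) \<in> measurable ?N (count_space UNIV)"
    by simp
  have "(\<lambda>y. pull_count (run_arm K \<mu> \<sigma> y) b T) -` Collect P \<inter> space ?N \<in> sets ?N"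
    by (rule measurable_sets[OF cm]) simp
  then have E: "?E \<in> sets ?N" by (simp add: vimage_def Int_def conj_commute)
  have r: "?r \<in> measurable M ?N"
    using indep' by (intro measurable_restrict) (auto simp: indep_vars_def)
  have "measure (distr M ?N ?r) ?E = prob (?r -` ?E \<inter> space M)"
    by (rule measure_distr[OF r E])
  also have "?r -` ?E \<inter> space M = {\<omega> \<in> space M. P (pull_count (\<lambda>s. canonical_arm s \<omega>) b T)}"
    using measurable_space[OF r] by (auto simp: canonical_arm_def)
  finally show ?thesis unfolding driver_distr[OF assms] by (rule sym)
qed

text \<open>Each run equals its canonical run almost surely, and the canonical runs share their law
  by \<open>prob_canonical_count\<close>; the rules by which \<open>A\<close> and \<open>A'\<close>
  break ties may differ.\<close>

lemma pull_count_law: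
  assumes ts': "thompson_sampling M K \<mu> \<sigma> D \<xi> Z' A'" and "1 \<le> K" "sampling_law D"
  shows "prob {\<omega> \<in> space M. P (pull_count (\<lambda>s. A s \<omega>) b T)}
    = prob {\<omega> \<in> space M. P (pull_count (\<lambda>s. A' s \<omega>) b T)}"
proof -
  have *: "prob {\<omega> \<in> space M. P (pull_count (\<lambda>s. A s \<omega>) b T)}
    = prob {\<omega> \<in> space M. P (pull_count (\<lambda>s. thompson_sampling.canonical_arm K \<mu> \<sigma> \<xi> Z s \<omega>) b T)}"
    if ts: "thompson_sampling M K \<mu> \<sigma> D \<xi> Z A" for Z A
  proof -
    interpret A: thompson_sampling M K \<mu> \<sigma> D \<xi> Z A by (rule ts)
    interpret C: adapted_thompson M K \<mu> \<sigma> D \<xi> Z A.canonical_arm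
      by (rule A.adapted_thompson_canonical) fact+
    have cnt_A: "A.cnt b T \<in> measurable M (count_space UNIV)"
    proof -
      have "(\<lambda>\<omega>. real (A.cnt b T \<omega>)) \<in> borel_measurable M"
        unfolding A.cnt_def pull_count_def of_nat_sum of_nat_of_bool
        by (intro borel_measurable_sum measurable_of_bool pred_eq_const1[OF A.pull_measurable]) auto
      then have "(\<lambda>\<omega>. nat \<lfloor>real (A.cnt b T \<omega>)\<rfloor>) \<in> measurable M (count_space UNIV)"
        by measurable
      then show ?thesis by simp
    qed
    have ms: "{\<omega> \<in> space M. P (f \<omega>)} \<in> sets M" if "f \<in> measurable M (count_space UNIV)" for f :: "'w \<Rightarrow> nat"
      using measurable_sets[OF that, of "Collect P"] by (simp add: vimage_def Int_def conj_commute)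
    have "AE \<omega> in M. A.cnt b T \<omega> = C.cnt b T \<omega>"
      using C.thompson_sampling_unique[OF ts]
    proof eventually_elim
      case (elim \<omega>)
      have "A s \<omega> = A.canonical_arm s \<omega>" if "1 \<le> s" for s
        using elim[rule_format, of "s - 1"] that by simp
      then show ?case by (simp add: A.cnt_def C.cnt_def pull_count_def)
    qed
    then show ?thesis
      unfolding A.cnt_def[symmetric] C.cnt_def[symmetric]
      by (intro finite_measure_eq_AE ms cnt_A C.cnt_measurable_M) (auto elim: eventually_mono)
  qed
  interpret T': thompson_sampling M K \<mu> \<sigma> D \<xi> Z' A' by (rule ts')
  show ?thesis
    unfolding *[OF thompson_sampling_axioms] *[OF ts']
    unfolding prob_canonical_count[OF assms(2)] T'.prob_canonical_count[OF assms(2)] ..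
qed

text \<open>An involution is its own inverse, so the pulled arms and the samples are relabelled by
  the same map. The means must be invariant because the rewards of the new run are computed from the
  relabelled arm.\<close>

lemma thompson_sampling_permuted:
  assumes \<pi>: "bij_betw \<pi> {1..K} {1..K}" "\<And>b. \<pi> (\<pi> b) = b" "\<And>b. \<mu> (\<pi> b) = \<mu> b"
  shows "thompson_sampling M K \<mu> \<sigma> D \<xi> (\<lambda>b. Z (\<pi> b)) (\<lambda>t \<omega>. \<pi> (A t \<omega>))"
proof unfold_locales
  have mem: "\<pi> b \<in> {1..K}" if "b \<in> {1..K}" for b
    using \<pi>(1) that by (auto simp: bij_betw_def)
  let ?\<rho> = "map_sum id (map_prod \<pi> id) :: nat + nat \<times> nat \<Rightarrow> _"
  have "indep_vars (\<lambda>_. borel) (\<lambda>i. driver (?\<rho> i)) (noise_and_samples K)"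
  proof (rule indep_vars_reindex[OF indep'])
    show "inj_on ?\<rho> (noise_and_samples K)"
      by (rule inj_on_inverseI[of _ ?\<rho>]) (auto simp: \<pi>(2) noise_and_samples_def Plus_def)
    show "?\<rho> ` noise_and_samples K \<subseteq> noise_and_samples K"
      using mem by (auto simp: noise_and_samples_def Plus_def)
  qed
  moreover have "driver (?\<rho> i) = case_sum \<xi> (case_prod (\<lambda>b. Z (\<pi> b))) i" for i
    by (auto split: sum.splits)
  ultimately show "indep_vars (\<lambda>_. borel) (case_sum \<xi> (case_prod (\<lambda>b. Z (\<pi> b)))) ({1..} <+> {1..K} \<times> {1..})"
    by (simp add: noise_and_samples_def)
  show "distr M borel (Z (\<pi> b) t) = D" if "b \<in> {1..K}" "t \<ge> 1" for b t
    using sample_law mem that by blast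
  show "(\<lambda>\<omega>. \<pi> (A t \<omega>)) \<in> measurable M (count_space UNIV)" if "t \<ge> 1" for t
    by (rule measurable_compose[OF pull_measurable[OF that]]) simp
  have flip: "(\<pi> x = b) = (x = \<pi> b)" for x b using \<pi>(2) by metis
  have nbar: "nbar (\<lambda>s. \<pi> (A s \<omega>)) b t = nbar (\<lambda>s. A s \<omega>) (\<pi> b) t" for b t \<omega>
    by (induction t) (auto simp: flip)
  have mubar: "mubar (\<lambda>s. \<pi> (A s \<omega>)) R b t = mubar (\<lambda>s. A s \<omega>) R (\<pi> b) t" for R b t \<omega>
    by (induction t) (auto simp: flip nbar)
  show "is_arg_max
        (\<lambda>b. mubar (\<lambda>s. \<pi> (A s \<omega>)) (\<lambda>s. \<mu> (\<pi> (A s \<omega>)) + \<sigma> * \<xi> s \<omega>) b t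
             + \<sigma> * nbar (\<lambda>s. \<pi> (A s \<omega>)) b t powr (- 1 / 2) * Z (\<pi> b) (Suc t) \<omega>)
        (\<lambda>b. b \<in> {1..K}) (\<pi> (A (Suc t) \<omega>))" if "\<omega> \<in> space M" for t \<omega>
    using pull_argmax[OF that, of t] mem unfolding is_arg_max_linorder nbar mubar \<pi>(2,3) by blast
qed (fact sigma_pos noise_identical noise_integrable noise_sq_integrable noise_mean noise_variance)+

text \<open>Swapping the labels of \<open>i\<close> and \<open>j\<close> turns the run into another
  run with the same noises, whose count of \<open>i\<close> is the old count of
  \<open>j\<close>.\<close>

lemma pull_count_law_symmetric:
  assumes "i \<in> {1..K}" "j \<in> {1..K}" "\<mu> i = \<mu> j" "sampling_law D"
  shows "prob {\<omega> \<in> space M. P (cnt i T \<omega>)} = prob {\<omega> \<in> space M. P (cnt j T \<omega>)}"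
proof -
  let ?\<pi> = "\<lambda>b. if b = i then j else if b = j then i else b"
  have K: "1 \<le> K" using assms by auto
  have "thompson_sampling M K \<mu> \<sigma> D \<xi> (\<lambda>b. Z (?\<pi> b)) (\<lambda>t \<omega>. ?\<pi> (A t \<omega>))"
  proof (rule thompson_sampling_permuted)
    show "bij_betw ?\<pi> {1..K} {1..K}"
      by (rule bij_betw_byWitness[of _ ?\<pi>]) (use assms in auto)
  qed (use assms in auto)
  from pull_count_law[OF this K assms(4), where P = P and b = i and T = T]
  have "prob {\<omega> \<in> space M. P (cnt i T \<omega>)} = prob {\<omega> \<in> space M. P (pull_count (\<lambda>s. ?\<pi> (A s \<omega>)) i T)}"
    unfolding cnt_def .
  moreover have "pull_count (\<lambda>s. ?\<pi> (A s \<omega>)) i T = cnt j T \<omega>" for \<omega>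
    unfolding cnt_def pull_count_def by (intro sum.cong refl) auto
  ultimately show ?thesis by (simp add: cnt_def)
qed

end

section \<open>Uniform concentration of the empirical means\<close>

text \<open>Ville's inequality for a nonnegative supermartingale. The supermartingale property is
  asked for in integrated form, on the event that level \<open>c\<close> has not been reached so
  far; this form avoids filtrations and stopping times.\<close>

lemma (in prob_space) maximal_inequality:
  fixes Y :: "nat \<Rightarrow> 'a \<Rightarrow> real"
  assumes int: "\<And>t. integrable M (Y t)" and nonneg: "\<And>t \<omega>. Y t \<omega> \<ge> 0" and c: "c > 0"
    and step: "\<And>t. expectation (\<lambda>\<omega>. indicator {\<omega> \<in> space M. \<forall>s\<le>t. Y s \<omega> < c} \<omega> * Y (Suc t) \<omega>)
      \<le> expectation (\<lambda>\<omega>. indicator {\<omega> \<in> space M. \<forall>s\<le>t. Y s \<omega> < c} \<omega> * Y t \<omega>)"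
  shows "prob {\<omega> \<in> space M. \<exists>t. Y t \<omega> \<ge> c} \<le> expectation (Y 0) / c"
proof -
  note [measurable] = borel_measurable_integrable[OF int]
  define H where "H t = {\<omega> \<in> space M. \<forall>s\<le>t. Y s \<omega> < c}" for t
  have [measurable]: "H t \<in> sets M" for t unfolding H_def by measurable
  have intH: "integrable M (\<lambda>\<omega>. indicator B \<omega> * Y t \<omega>)" if "B \<in> sets M" for B t
    by (rule Bochner_Integration.integrable_bound[OF int[of t]]) (use that nonneg in \<open>auto simp: indicator_def\<close>)
  have Hmono: "H (Suc t) \<subseteq> H t" for t by (auto simp: H_def)
  have ind_le: "c * prob B \<le> expectation (\<lambda>\<omega>. indicator B \<omega> * Y t \<omega>)"
    if B[measurable]: "B \<in> sets M" and ge: "\<And>\<omega>. \<omega> \<in> B \<Longrightarrow> Y t \<omega> \<ge> c" for B t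
  proof -
    have "c * prob B = expectation (\<lambda>\<omega>. indicator B \<omega> * c)" by simp
    also have "\<dots> \<le> expectation (\<lambda>\<omega>. indicator B \<omega> * Y t \<omega>)"
    proof (rule integral_mono[OF _ intH[OF B]])
      show "integrable M (\<lambda>\<omega>. indicator B \<omega> * c)" by (simp add: emeasure_eq_measure)
    qed (use ge in \<open>auto simp: indicator_def\<close>)
    finally show ?thesis .
  qed
  have split: "expectation (\<lambda>\<omega>. indicator B \<omega> * Y t \<omega>) + expectation (\<lambda>\<omega>. indicator B' \<omega> * Y t \<omega>)
      = expectation (\<lambda>\<omega>. indicator (B \<union> B') \<omega> * Y t \<omega>)"
    if "B \<in> sets M" "B' \<in> sets M" "B \<inter> B' = {}" for B B' t
  proof -
    have "indicator (B \<union> B') \<omega> * Y t \<omega> = indicator B \<omega> * Y t \<omega> + indicator B' \<omega> * Y t \<omega>" for \<omega>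
      using that(3) by (auto simp: indicator_def)
    then show ?thesis using Bochner_Integration.integral_add[OF intH[OF that(1)] intH[OF that(2)], of t t] by simp
  qed
  \<comment> \<open>Mass that has crossed level \<open>c\<close> is charged at \<open>c\<close>, the
    rest at its current value; this total never increases.\<close>
  have main: "c * prob (space M - H t) + expectation (\<lambda>\<omega>. indicator (H t) \<omega> * Y t \<omega>) \<le> expectation (Y 0)" for t
  proof (induction t)
    case 0
    have "c * prob (space M - H 0) \<le> expectation (\<lambda>\<omega>. indicator (space M - H 0) \<omega> * Y 0 \<omega>)"
      by (rule ind_le) (auto simp: H_def)
    moreover have "expectation (\<lambda>\<omega>. indicator (space M - H 0) \<omega> * Y 0 \<omega>) + expectation (\<lambda>\<omega>. indicator (H 0) \<omega> * Y 0 \<omega>)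
        = expectation (Y 0)"
    proof -
      have "expectation (\<lambda>\<omega>. indicator ((space M - H 0) \<union> H 0) \<omega> * Y 0 \<omega>) = expectation (Y 0)"
        by (intro Bochner_Integration.integral_cong) (auto simp: indicator_def)
      then show ?thesis by (subst split) auto
    qed
    ultimately show ?case by simp
  next
    case (Suc t)
    have "prob (space M - H (Suc t)) = prob (space M - H t) + prob (H t - H (Suc t))"
    proof -
      have "space M - H (Suc t) = (space M - H t) \<union> (H t - H (Suc t))"
        using Hmono[of t] by (auto simp: H_def)
      then show ?thesis by (simp only:) (rule finite_measure_Union; auto)
    qed
    moreover have "c * prob (H t - H (Suc t)) \<le> expectation (\<lambda>\<omega>. indicator (H t - H (Suc t)) \<omega> * Y (Suc t) \<omega>)"
      by (rule ind_le) (auto simp: H_def not_less le_Suc_eq)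
    moreover have "expectation (\<lambda>\<omega>. indicator (H t - H (Suc t)) \<omega> * Y (Suc t) \<omega>)
        + expectation (\<lambda>\<omega>. indicator (H (Suc t)) \<omega> * Y (Suc t) \<omega>)
        = expectation (\<lambda>\<omega>. indicator (H t) \<omega> * Y (Suc t) \<omega>)"
    proof -
      have "(H t - H (Suc t)) \<union> H (Suc t) = H t" using Hmono[of t] by auto
      then show ?thesis by (subst split) auto
    qed
    moreover note step[of t, folded H_def] Suc
    ultimately show ?case by (simp add: distrib_left)
  qed
  have bound: "prob (space M - H t) \<le> expectation (Y 0) / c" for t
  proof -
    have "0 \<le> expectation (\<lambda>\<omega>. indicator (H t) \<omega> * Y t \<omega>)"
      by (rule Bochner_Integration.integral_nonneg) (use nonneg in \<open>auto simp: indicator_def\<close>)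
    then show ?thesis using main[of t] c by (simp add: field_simps)
  qed
  have "(\<lambda>t. prob (space M - H t)) \<longlonglongrightarrow> prob (\<Union>t. space M - H t)"
    by (rule finite_Lim_measure_incseq) (use Hmono in \<open>auto intro!: incseq_SucI\<close>)
  then have "prob (\<Union>t. space M - H t) \<le> expectation (Y 0) / c"
    by (rule LIMSEQ_le_const2) (use bound in auto)
  moreover have "(\<Union>t. space M - H t) = {\<omega> \<in> space M. \<exists>t. Y t \<omega> \<ge> c}"
    by (auto simp: H_def not_less) (meson leD order_refl)
  ultimately show ?thesis by simp
qed

context adapted_thompson
begin

lemma expectation_noise_sq: "t \<ge> 1 \<Longrightarrow> expectation (\<lambda>\<omega>. (\<xi> t \<omega>)\<^sup>2) = 1"
  using noise_variance[of t] noise_mean[of t] by simp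

lemma noise_mult:
  assumes f: "f \<in> borel_measurable (gen (pre_index K t))" "integrable M f"
    and g[measurable]: "g \<in> borel_measurable borel" and "integrable M (\<lambda>\<omega>. g (\<xi> (Suc t) \<omega>))"
  shows "integrable M (\<lambda>\<omega>. f \<omega> * g (\<xi> (Suc t) \<omega>) :: real)"
    and "expectation (\<lambda>\<omega>. f \<omega> * g (\<xi> (Suc t) \<omega>)) = expectation f * expectation (\<lambda>\<omega>. g (\<xi> (Suc t) \<omega>))"
proof -
  have "\<xi> (Suc t) \<in> borel_measurable (gen {Inl (Suc t)})" by (rule noise_measurable) simp
  then have "(\<lambda>\<omega>. g (\<xi> (Suc t) \<omega>)) \<in> borel_measurable (gen {Inl (Suc t)})"
    by measurable
  from expectation_gen_algebra_mult[OF indep' index_subset(2,4) index_disjoint(2) f this assms(4)]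
  show "integrable M (\<lambda>\<omega>. f \<omega> * g (\<xi> (Suc t) \<omega>) :: real)"
    and "expectation (\<lambda>\<omega>. f \<omega> * g (\<xi> (Suc t) \<omega>)) = expectation f * expectation (\<lambda>\<omega>. g (\<xi> (Suc t) \<omega>))"
    by auto
qed

lemmas noise_mult_id = noise_mult[where g = "\<lambda>x. x", OF _ _ measurable_ident_sets[OF refl]]
lemmas noise_mult_sq = noise_mult[where g = "\<lambda>x. x\<^sup>2", OF _ _ borel_measurable_power[OF measurable_ident_sets[OF refl]]]

lemma integrable_of_sq:
  assumes [measurable]: "f \<in> borel_measurable M" and "integrable M (\<lambda>\<omega>. (f \<omega>)\<^sup>2)"
  shows "integrable M (f :: 'w \<Rightarrow> real)"
proof (rule Bochner_Integration.integrable_bound)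
  show "integrable M (\<lambda>\<omega>. 1 + (f \<omega>)\<^sup>2)" using assms by simp
  have "\<bar>x\<bar> \<le> 1 + x\<^sup>2" for x :: real
    using zero_le_power2[of "\<bar>x\<bar> - 1/2"] by (simp add: power2_eq_square algebra_simps)
  then show "AE \<omega> in M. norm (f \<omega>) \<le> norm (1 + (f \<omega>)\<^sup>2)" by (auto simp: abs_of_nonneg)
qed simp

lemma integrable_bounded_mult:
  assumes [measurable]: "w \<in> borel_measurable M" and f: "integrable M f" and "\<And>\<omega>. \<bar>w \<omega>\<bar> \<le> B"
  shows "integrable M (\<lambda>\<omega>. w \<omega> * f \<omega> :: real)"
proof (rule Bochner_Integration.integrable_bound)
  note [measurable] = borel_measurable_integrable[OF f]
  show "integrable M (\<lambda>\<omega>. B * f \<omega>)" using f by simp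
  show "AE \<omega> in M. norm (w \<omega> * f \<omega>) \<le> norm (B * f \<omega>)"
    using order_trans[OF assms(3) abs_ge_self] by (auto simp: abs_mult intro!: mult_right_mono)
  show "(\<lambda>\<omega>. w \<omega> * f \<omega>) \<in> borel_measurable M" by measurable
qed

lemma pulled_measurable_pre: "(\<lambda>\<omega>. of_bool (A (Suc t) \<omega> = b) :: real) \<in> borel_measurable (gen (pre_index K t))"
  by (intro measurable_of_bool pred_eq_const1[OF adapted]) simp

text \<open>Squaring \<open>pn + \<xi>\<close> at a pull leaves a cross term that vanishes in mean
  and a squared noise of mean 1. The weight may depend on the pull of round \<open>Suc t\<close>, as
  weights built from the updated count do.\<close>

lemma weighted_sq_step:
  assumes w: "w \<in> borel_measurable (gen (pre_index K t))" "\<And>\<omega>. \<bar>w \<omega>\<bar> \<le> B"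
    and int: "integrable M (\<lambda>\<omega>. (pn b t \<omega>)\<^sup>2)"
  shows "integrable M (\<lambda>\<omega>. w \<omega> * (pn b (Suc t) \<omega>)\<^sup>2)"
    and "expectation (\<lambda>\<omega>. w \<omega> * (pn b (Suc t) \<omega>)\<^sup>2)
      = expectation (\<lambda>\<omega>. w \<omega> * ((pn b t \<omega>)\<^sup>2 + of_bool (A (Suc t) \<omega> = b)))"
proof -
  let ?a = "\<lambda>\<omega>. of_bool (A (Suc t) \<omega> = b) :: real"
  note a = pulled_measurable_pre[of t b]
  note p = pn_measurable[THEN hist_imp_pre, of b t]
  note [measurable] = w(1)[THEN pre_imp_M] a[THEN pre_imp_M]
  have int1: "integrable M (pn b t)" by (rule integrable_of_sq[OF _ int]) simp
  have B: "0 \<le> B" using order_trans[OF abs_ge_zero w(2)] .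
  have wa: "\<bar>w \<omega> * ?a \<omega>\<bar> \<le> B" for \<omega> using w(2)[of \<omega>] B by (auto simp: abs_mult)
  have m1: "(\<lambda>\<omega>. w \<omega> * ?a \<omega>) \<in> borel_measurable (gen (pre_index K t))" using w(1) a by measurable
  have i1: "integrable M (\<lambda>\<omega>. w \<omega> * ?a \<omega> * pn b t \<omega>)"
    by (rule integrable_bounded_mult[OF _ int1 wa]) measurable
  have m2: "(\<lambda>\<omega>. w \<omega> * ?a \<omega> * pn b t \<omega>) \<in> borel_measurable (gen (pre_index K t))" using m1 p by measurable
  have i2: "integrable M (\<lambda>\<omega>. w \<omega> * ?a \<omega>)"
    using integrable_bounded_mult[of "\<lambda>\<omega>. w \<omega> * ?a \<omega>" "\<lambda>_. 1" B] wa by simp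
  have i3: "integrable M (\<lambda>\<omega>. w \<omega> * (pn b t \<omega>)\<^sup>2)"
    by (rule integrable_bounded_mult[OF _ int w(2)]) measurable
  note X1 = noise_mult_id[OF m2 i1 noise_integrable[of "Suc t", simplified]]
  note X2 = noise_mult_sq[OF m1 i2 noise_sq_integrable[of "Suc t", simplified]]
  have eq: "w \<omega> * (pn b (Suc t) \<omega>)\<^sup>2 = w \<omega> * (pn b t \<omega>)\<^sup>2
      + (2 * (w \<omega> * ?a \<omega> * pn b t \<omega> * \<xi> (Suc t) \<omega>) + w \<omega> * ?a \<omega> * (\<xi> (Suc t) \<omega>)\<^sup>2)" for \<omega>
    by (cases "A (Suc t) \<omega> = b") (simp_all add: pn_Suc power2_sum algebra_simps)
  show "integrable M (\<lambda>\<omega>. w \<omega> * (pn b (Suc t) \<omega>)\<^sup>2)"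
    unfolding eq using i3 X1(1) X2(1) by simp
  have "expectation (\<lambda>\<omega>. w \<omega> * (pn b (Suc t) \<omega>)\<^sup>2)
    = expectation (\<lambda>\<omega>. w \<omega> * (pn b t \<omega>)\<^sup>2) + expectation (\<lambda>\<omega>. w \<omega> * ?a \<omega>)"
    unfolding eq using i3 X1 X2 noise_mean[of "Suc t"] expectation_noise_sq[of "Suc t"] by simp
  also have "\<dots> = expectation (\<lambda>\<omega>. w \<omega> * ((pn b t \<omega>)\<^sup>2 + ?a \<omega>))"
    using i2 i3 by (simp add: distrib_left)
  finally show "expectation (\<lambda>\<omega>. w \<omega> * (pn b (Suc t) \<omega>)\<^sup>2)
      = expectation (\<lambda>\<omega>. w \<omega> * ((pn b t \<omega>)\<^sup>2 + ?a \<omega>))" .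
qed

lemma integrable_pn_sq: "integrable M (\<lambda>\<omega>. (pn b t \<omega>)\<^sup>2)"
proof (induction t)
  case (Suc t)
  then show ?case using weighted_sq_step(1)[of "\<lambda>_. 1" t 1 b] by simp
qed simp

lemma integrable_pn: "integrable M (pn b t)"
  by (rule integrable_of_sq[OF _ integrable_pn_sq]) simp

lemma cnt_le: "cnt b t \<omega> \<le> t"
  unfolding cnt_def by (rule pull_count_le)

lemma integrable_cnt: "integrable M (\<lambda>\<omega>. real (cnt b t \<omega>))"
  by (rule integrable_const_bound[of _ "real t"]) (use cnt_le in auto)

lemma expectation_pn_sq: "expectation (\<lambda>\<omega>. (pn b t \<omega>)\<^sup>2) = expectation (\<lambda>\<omega>. real (cnt b t \<omega>))"
proof (induction t)
  case (Suc t)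
  have "integrable M (\<lambda>\<omega>. of_bool (A (Suc t) \<omega> = b) :: real)"
    by (rule integrable_const_bound[of _ 1]) auto
  then show ?case
    using weighted_sq_step(2)[of "\<lambda>_. 1" t 1 b] integrable_pn_sq[of b t] integrable_cnt[of b t] Suc
    by (simp add: cnt_Suc)
qed simp

lemma expectation_pn_sq_le: "expectation (\<lambda>\<omega>. (pn b t \<omega>)\<^sup>2) \<le> real t"
  unfolding expectation_pn_sq using integral_mono[OF integrable_cnt, of "\<lambda>_. real t" b t] cnt_le
  by (simp add: prob_space)

lemma expectation_pn: "expectation (pn b t) = 0"
proof (induction t)
  case (Suc t)
  let ?a = "\<lambda>\<omega>. of_bool (A (Suc t) \<omega> = b) :: real"
  have "integrable M ?a" by (rule integrable_const_bound[of _ 1]) auto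
  note X = noise_mult_id[OF pulled_measurable_pre this noise_integrable[of "Suc t", simplified]]
  have "pn b (Suc t) = (\<lambda>\<omega>. pn b t \<omega> + ?a \<omega> * \<xi> (Suc t) \<omega>)" by (simp add: pn_Suc fun_eq_iff)
  then show ?case using X integrable_pn[of b t] Suc noise_mean[of "Suc t"] by simp
qed (simp add: pn_0[abs_def])

text \<open>With \<open>m = nb + N\<close> before a pull, the first term grows in mean by at most
  \<open>1 / (m + 1)\<^sup>2\<close>, while the second drops by \<open>1 / m - 1 / (m + 1)\<close>,
  which is no less. The process starts at \<open>1 / (1 + N)\<close>, so a large offset
  \<open>N\<close> makes the bound small uniformly over all rounds.\<close>

lemma prob_weighted_sq_ge:
  assumes "c > 0" "N \<ge> 0"
  shows "prob {\<omega> \<in> space M. \<exists>t. (pn b t \<omega>)\<^sup>2 / (nb b t \<omega> + N)\<^sup>2 + 1 / (nb b t \<omega> + N) \<ge> c} \<le> 1 / ((1 + N) * c)"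
proof -
  define Y where "Y t \<omega> = (pn b t \<omega>)\<^sup>2 / (nb b t \<omega> + N)\<^sup>2 + 1 / (nb b t \<omega> + N)" for t \<omega>
  have nb1: "nb b t \<omega> \<ge> 1" for t \<omega> by (simp add: nb_eq)
  have w01: "0 < 1 / (nb b t \<omega> + N)" "1 / (nb b t \<omega> + N) \<le> 1" for t \<omega>
    using nb1[of t \<omega>] assms by auto
  have Ym: "Y t \<in> borel_measurable (gen (hist_index K t))" for t
    unfolding Y_def[abs_def] using pn_measurable[of b t] nb_measurable[of b t] by measurable
  have wsq: "\<bar>x\<^sup>2\<bar> \<le> 1" if "0 < x" "x \<le> 1" for x :: real
    using that by (simp add: power_le_one)
  have bdd: "\<bar>(1 / (nb b t \<omega> + N))\<^sup>2\<bar> \<le> 1" "\<bar>1 / (nb b t \<omega> + N)\<bar> \<le> 1" for t \<omega>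
    using w01[of t \<omega>] wsq by (auto simp only: abs_of_pos)
  have Yeq: "Y t \<omega> = (1 / (nb b t \<omega> + N))\<^sup>2 * (pn b t \<omega>)\<^sup>2 + 1 / (nb b t \<omega> + N)" for t \<omega>
    by (simp add: Y_def power_divide)
  have iw: "integrable M (\<lambda>\<omega>. 1 / (nb b t \<omega> + N))" for t
    by (rule integrable_const_bound[of _ 1]) (use bdd in auto)
  have "prob {\<omega> \<in> space M. \<exists>t. Y t \<omega> \<ge> c} \<le> expectation (Y 0) / c"
  proof (rule maximal_inequality)
    show "integrable M (Y t)" for t
    proof -
      have "integrable M (\<lambda>\<omega>. (1 / (nb b t \<omega> + N))\<^sup>2 * (pn b t \<omega>)\<^sup>2)"
        by (rule integrable_bounded_mult[OF _ integrable_pn_sq bdd(1)]) measurable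
      then show ?thesis unfolding Yeq[abs_def] using iw by simp
    qed
    then have Yint: "integrable M (Y t)" for t .
    show "Y t \<omega> \<ge> 0" for t \<omega> unfolding Yeq using w01[of t \<omega>] by simp
    fix t
    define H where "H = {\<omega> \<in> space M. \<forall>s\<le>t. Y s \<omega> < c}"
    have Ys: "Y s \<in> borel_measurable (gen (hist_index K t))" if "s \<le> t" for s
      by (rule measurable_gen_algebra_mono[OF index_subset(8)[OF that] Ym])
    have "Measurable.pred (gen (hist_index K t)) (\<lambda>\<omega>. \<forall>s\<in>{..t}. Y s \<omega> < c)"
    proof (rule pred_intros_finite)
      fix s assume "s \<in> {..t}"
      then have [measurable]: "Y s \<in> borel_measurable (gen (hist_index K t))" using Ys by simp
      show "Measurable.pred (gen (hist_index K t)) (\<lambda>\<omega>. Y s \<omega> < c)" by measurable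
    qed simp
    then have "{\<omega> \<in> space (gen (hist_index K t)). \<forall>s\<in>{..t}. Y s \<omega> < c} \<in> sets (gen (hist_index K t))"
      by (rule predE)
    moreover have "{\<omega> \<in> space (gen (hist_index K t)). \<forall>s\<in>{..t}. Y s \<omega> < c} = H"
      unfolding H_def space_gen_algebra by auto
    ultimately have Hh: "H \<in> sets (gen (hist_index K t))" by metis
    have Hpre: "indicator H \<in> borel_measurable (gen (pre_index K t))"
      by (intro hist_imp_pre borel_measurable_indicator Hh)
    note [measurable] = Hpre[THEN pre_imp_M]
    let ?a = "\<lambda>\<omega>. of_bool (A (Suc t) \<omega> = b) :: real"
    \<comment> \<open>The weight of the next round is already determined by the pull, before its
      noise, so \<open>weighted_sq_step\<close> applies to it.\<close>
    define w where "w \<omega> = 1 / (nb b t \<omega> + ?a \<omega> + N)" for \<omega>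
    have w_Suc: "w \<omega> = 1 / (nb b (Suc t) \<omega> + N)" for \<omega> by (simp add: w_def nb_eq cnt_Suc)
    have wpre: "w \<in> borel_measurable (gen (pre_index K t))"
      unfolding w_def[abs_def] using nb_measurable[THEN hist_imp_pre, of b t] pulled_measurable_pre[of t b]
      by measurable
    note [measurable] = wpre[THEN pre_imp_M] pulled_measurable_pre[THEN pre_imp_M]
    have Hw: "(\<lambda>\<omega>. indicator H \<omega> * (w \<omega>)\<^sup>2) \<in> borel_measurable (gen (pre_index K t))"
      using Hpre wpre by measurable
    have Hwb: "\<bar>indicator H \<omega> * (w \<omega>)\<^sup>2\<bar> \<le> 1" for \<omega>
      using bdd(1)[of "Suc t" \<omega>] unfolding w_Suc by (auto simp: indicator_def)
    note step = weighted_sq_step[OF Hw Hwb integrable_pn_sq[of b t]]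
    have iHw: "integrable M (\<lambda>\<omega>. indicator H \<omega> * w \<omega>)"
    proof (rule integrable_const_bound[of _ 1])
      show "AE \<omega> in M. norm (indicator H \<omega> * w \<omega>) \<le> 1"
        using bdd(2)[of "Suc t"] by (auto simp: w_Suc indicator_def)
      show "(\<lambda>\<omega>. indicator H \<omega> * w \<omega>) \<in> borel_measurable M" by measurable
    qed
    have isum: "integrable M (\<lambda>\<omega>. (pn b t \<omega>)\<^sup>2 + ?a \<omega>)"
      using integrable_pn_sq by (intro Bochner_Integration.integrable_add integrable_const_bound[of ?a 1]) auto
    have iHp: "integrable M (\<lambda>\<omega>. indicator H \<omega> * (w \<omega>)\<^sup>2 * ((pn b t \<omega>)\<^sup>2 + ?a \<omega>))"
      by (rule integrable_bounded_mult[OF _ isum Hwb]) measurable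
    have "expectation (\<lambda>\<omega>. indicator H \<omega> * Y (Suc t) \<omega>)
        = expectation (\<lambda>\<omega>. indicator H \<omega> * (w \<omega>)\<^sup>2 * (pn b (Suc t) \<omega>)\<^sup>2 + indicator H \<omega> * w \<omega>)"
      by (intro Bochner_Integration.integral_cong) (auto simp: Yeq w_Suc algebra_simps)
    also have "\<dots> = expectation (\<lambda>\<omega>. indicator H \<omega> * (w \<omega>)\<^sup>2 * ((pn b t \<omega>)\<^sup>2 + ?a \<omega>)) + expectation (\<lambda>\<omega>. indicator H \<omega> * w \<omega>)"
      using step iHw by simp
    also have "\<dots> = expectation (\<lambda>\<omega>. indicator H \<omega> * (w \<omega>)\<^sup>2 * ((pn b t \<omega>)\<^sup>2 + ?a \<omega>) + indicator H \<omega> * w \<omega>)"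
      using iHp iHw by simp
    also have "\<dots> \<le> expectation (\<lambda>\<omega>. indicator H \<omega> * Y t \<omega>)"
    proof (rule integral_mono)
      show "integrable M (\<lambda>\<omega>. indicator H \<omega> * (w \<omega>)\<^sup>2 * ((pn b t \<omega>)\<^sup>2 + ?a \<omega>) + indicator H \<omega> * w \<omega>)"
        using iHp iHw by simp
      show "integrable M (\<lambda>\<omega>. indicator H \<omega> * Y t \<omega>)"
        by (rule integrable_bounded_mult[OF Hpre[THEN pre_imp_M] Yint, of 1]) (auto simp: indicator_def)
      fix \<omega>
      have key: "(S\<^sup>2 + 1) / (m + 1)\<^sup>2 + 1 / (m + 1) \<le> S\<^sup>2 / m\<^sup>2 + 1 / m" if "m \<ge> 1" for S m :: real
      proof -
        have "S\<^sup>2 / (m + 1)\<^sup>2 \<le> S\<^sup>2 / m\<^sup>2"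
          using that by (intro divide_left_mono power_mono) auto
        moreover have "1 / (m + 1)\<^sup>2 + 1 / (m + 1) \<le> 1 / m"
          using that by (simp add: divide_simps power2_eq_square) (simp add: algebra_simps)
        ultimately show ?thesis by (simp add: add_divide_distrib)
      qed
      have "(w \<omega>)\<^sup>2 * ((pn b t \<omega>)\<^sup>2 + ?a \<omega>) + w \<omega> \<le> Y t \<omega>"
        using key[of "nb b t \<omega> + N" "pn b t \<omega>"] nb1[of t \<omega>] assms
        by (cases "A (Suc t) \<omega> = b") (simp_all add: w_def Y_def power_divide add_ac)
      then show "indicator H \<omega> * (w \<omega>)\<^sup>2 * ((pn b t \<omega>)\<^sup>2 + ?a \<omega>) + indicator H \<omega> * w \<omega> \<le> indicator H \<omega> * Y t \<omega>"
        by (auto simp: indicator_def)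
    qed
    finally show "expectation (\<lambda>\<omega>. indicator {\<omega> \<in> space M. \<forall>s\<le>t. Y s \<omega> < c} \<omega> * Y (Suc t) \<omega>)
      \<le> expectation (\<lambda>\<omega>. indicator {\<omega> \<in> space M. \<forall>s\<le>t. Y s \<omega> < c} \<omega> * Y t \<omega>)"
      unfolding H_def .
  qed fact
  moreover have "expectation (Y 0) = 1 / (1 + N)"
    by (simp add: Y_def[abs_def] nb_eq prob_space)
  ultimately show ?thesis unfolding Y_def by simp
qed

text \<open>Accuracy \<open>\<epsilon>\<close> can be had only for arms with many observations, and
  nothing forces an arm to get them early; the crude bound \<open>C\<close> covers the
  meantime.\<close>

definition good :: "real \<Rightarrow> real \<Rightarrow> real \<Rightarrow> nat \<Rightarrow> 'w set" where
  "good \<epsilon> C N t = {\<omega> \<in> space M. \<forall>b\<in>{1..K}. \<bar>mb b t \<omega> - \<mu> b\<bar> \<le> C \<and> (nb b t \<omega> \<ge> N \<longrightarrow> \<bar>mb b t \<omega> - \<mu> b\<bar> \<le> \<epsilon>)}"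

lemma good_hist: "good \<epsilon> C N t \<in> sets (gen (hist_index K t))"
proof -
  let ?G = "gen (hist_index K t)"
  have "Measurable.pred ?G (\<lambda>\<omega>. \<forall>b\<in>{1..K}. \<bar>mb b t \<omega> - \<mu> b\<bar> \<le> C \<and> (nb b t \<omega> \<ge> N \<longrightarrow> \<bar>mb b t \<omega> - \<mu> b\<bar> \<le> \<epsilon>))"
  proof (rule pred_intros_finite)
    fix b
    note [measurable] = mb_measurable[of b t] nb_measurable[of b t]
    show "Measurable.pred ?G (\<lambda>\<omega>. \<bar>mb b t \<omega> - \<mu> b\<bar> \<le> C \<and> (nb b t \<omega> \<ge> N \<longrightarrow> \<bar>mb b t \<omega> - \<mu> b\<bar> \<le> \<epsilon>))"
      by measurable
  qed simp
  then have "{\<omega> \<in> space ?G. \<forall>b\<in>{1..K}. \<bar>mb b t \<omega> - \<mu> b\<bar> \<le> C \<and> (nb b t \<omega> \<ge> N \<longrightarrow> \<bar>mb b t \<omega> - \<mu> b\<bar> \<le> \<epsilon>)} \<in> sets ?G"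
    by (rule predE)
  then show ?thesis unfolding good_def space_gen_algebra .
qed

lemma good_sets [measurable]: "good \<epsilon> C N t \<in> sets M"
  by (rule sets_gen_algebra_imp[OF indep' index_subset(1) good_hist])

lemma ex_good:
  assumes "\<epsilon> > 0" "\<delta> > 0"
  shows "\<exists>C N. C > 0 \<and> N > 0 \<and> prob {\<omega> \<in> space M. \<exists>t. \<omega> \<notin> good \<epsilon> C N t} \<le> \<delta>"
proof -
  \<comment> \<open>\<open>l0\<close> gives failure probability \<open>\<delta> / (2 * K)\<close>
    per arm in the maximal inequality with offset 0. From
    \<open>sqrt l1 = \<epsilon> / (4 * \<sigma>)\<close> the noise error is at most
    \<open>\<epsilon> / 2\<close> once \<open>nb \<ge> N\<close>, because then
    \<open>nb + N \<le> 2 * nb\<close>.\<close>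
  define l0 where "l0 = 2 * real K / \<delta>"
  define l1 where "l1 = (\<epsilon> / (4 * \<sigma>))\<^sup>2"
  define m where "m = (\<Sum>b\<in>{1..K}. \<bar>\<mu> b\<bar>)"
  define C where "C = \<sigma> * sqrt l0 + m + 1"
  \<comment> \<open>The first summand bounds the failure probability at level \<open>l1\<close>; the
    second keeps the bias \<open>m / N\<close> of the fictitious observation below
    \<open>\<epsilon> / 2\<close>.\<close>
  define N where "N = 2 * real K / (\<delta> * l1) + 2 * (m + 1) / \<epsilon>"
  have Kpos: "real K > 0" using K_ge_1 by simp
  have l0: "l0 > 0" and l1: "l1 > 0" using Kpos assms sigma_pos by (auto simp: l0_def l1_def)
  have m: "m \<ge> 0" "\<And>b. b \<in> {1..K} \<Longrightarrow> \<bar>\<mu> b\<bar> \<le> m"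
    unfolding m_def by (auto intro!: sum_nonneg member_le_sum)
  have C: "C > 0" using m l0 sigma_pos by (simp add: C_def add_nonneg_pos)
  have N: "N > 0" using m l1 assms Kpos by (simp add: N_def add_pos_pos)
  have Nm: "m / N \<le> \<epsilon> / 2"
  proof -
    have "2 * m / \<epsilon> \<le> N" using assms m l1 Kpos by (simp add: N_def divide_right_mono add_increasing)
    then show ?thesis using N assms by (simp add: field_simps)
  qed
  define B0 where "B0 b = {\<omega> \<in> space M. \<exists>t. (pn b t \<omega>)\<^sup>2 / (nb b t \<omega> + 0)\<^sup>2 + 1 / (nb b t \<omega> + 0) \<ge> l0}" for b
  define B1 where "B1 b = {\<omega> \<in> space M. \<exists>t. (pn b t \<omega>)\<^sup>2 / (nb b t \<omega> + N)\<^sup>2 + 1 / (nb b t \<omega> + N) \<ge> l1}" for b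
  have [measurable]: "B0 b \<in> sets M" "B1 b \<in> sets M" for b unfolding B0_def B1_def by measurable
  have "prob (B0 b) \<le> \<delta> / (2 * real K)" for b
    using prob_weighted_sq_ge[OF l0, of 0 b] by (simp add: B0_def l0_def)
  moreover have "prob (B1 b) \<le> \<delta> / (2 * real K)" for b
  proof -
    have "prob (B1 b) \<le> 1 / ((1 + N) * l1)"
      unfolding B1_def by (rule prob_weighted_sq_ge) (use l1 N in auto)
    also have "\<dots> \<le> \<delta> / (2 * real K)"
    proof -
      have "2 * real K / (\<delta> * l1) \<le> 1 + N" using m assms by (simp add: N_def add_increasing)
      then have "2 * real K \<le> (1 + N) * l1 * \<delta>" using assms l1 by (simp add: divide_le_eq mult_ac)
      moreover have "0 < (1 + N) * l1" using l1 N by simp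
      ultimately show ?thesis using Kpos by (simp add: divide_le_eq pos_le_divide_eq mult_ac)
    qed
    finally show ?thesis .
  qed
  ultimately have b: "prob (B0 b \<union> B1 b) \<le> \<delta> / real K" for b
  proof -
    assume B: "\<And>b. prob (B0 b) \<le> \<delta> / (2 * real K)" "\<And>b. prob (B1 b) \<le> \<delta> / (2 * real K)"
    have "prob (B0 b \<union> B1 b) \<le> prob (B0 b) + prob (B1 b)" by (rule measure_Un_le) measurable
    also have "\<dots> \<le> \<delta> / (2 * real K) + \<delta> / (2 * real K)" by (intro add_mono B)
    also have "\<dots> = \<delta> / real K" by simp
    finally show ?thesis .
  qed
  have sub: "{\<omega> \<in> space M. \<exists>t. \<omega> \<notin> good \<epsilon> C N t} \<subseteq> (\<Union>b\<in>{1..K}. B0 b \<union> B1 b)"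
  proof (rule subsetI, rule ccontr)
    fix \<omega> assume "\<omega> \<in> {\<omega> \<in> space M. \<exists>t. \<omega> \<notin> good \<epsilon> C N t}"
    then obtain t where \<omega>: "\<omega> \<in> space M" "\<omega> \<notin> good \<epsilon> C N t" by blast
    assume "\<omega> \<notin> (\<Union>b\<in>{1..K}. B0 b \<union> B1 b)"
    then have nB: "\<And>b. b \<in> {1..K} \<Longrightarrow> \<omega> \<notin> B0 b" "\<And>b. b \<in> {1..K} \<Longrightarrow> \<omega> \<notin> B1 b" by blast+
    have "\<omega> \<in> good \<epsilon> C N t"
      unfolding good_def
    proof (intro CollectI conjI ballI \<omega> impI)
      fix b assume b: "b \<in> {1..K}"
      let ?n = "nb b t \<omega>" and ?S = "pn b t \<omega>"
      have n1: "?n \<ge> 1" by (simp add: nb_eq)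
      have dev: "\<bar>mb b t \<omega> - \<mu> b\<bar> \<le> \<sigma> * (\<bar>?S\<bar> / ?n) + m / ?n"
      proof -
        have "\<bar>mb b t \<omega> - \<mu> b\<bar> = \<bar>\<sigma> * ?S - \<mu> b\<bar> / ?n" using n1 by (simp add: mb_eq)
        also have "\<dots> \<le> (\<sigma> * \<bar>?S\<bar> + m) / ?n"
        proof (rule divide_right_mono)
          have "\<bar>\<sigma> * ?S - \<mu> b\<bar> \<le> \<bar>\<sigma> * ?S\<bar> + \<bar>\<mu> b\<bar>" by simp
          then show "\<bar>\<sigma> * ?S - \<mu> b\<bar> \<le> \<sigma> * \<bar>?S\<bar> + m" using m(2)[OF b] sigma_pos by (simp add: abs_mult)
        qed (use n1 in simp)
        finally show ?thesis by (simp add: add_divide_distrib)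
      qed
      have "?S\<^sup>2 / ?n\<^sup>2 \<le> l0" using nB(1)[OF b] \<omega>(1) n1
        by (auto simp: B0_def not_le) (smt (verit) divide_nonneg_nonneg)
      then have "sqrt (?S\<^sup>2 / ?n\<^sup>2) \<le> sqrt l0" by simp
      then have "\<bar>?S\<bar> / ?n \<le> sqrt l0" using n1 by (simp add: real_sqrt_divide)
      then have "\<sigma> * (\<bar>?S\<bar> / ?n) \<le> \<sigma> * sqrt l0" using sigma_pos by (intro mult_left_mono) auto
      moreover have "m / ?n \<le> m" using divide_left_mono[of 1 ?n m] n1 m by simp
      ultimately show "\<bar>mb b t \<omega> - \<mu> b\<bar> \<le> C" using dev by (simp add: C_def)
      assume nN: "nb b t \<omega> \<ge> N"
      have "?S\<^sup>2 / (?n + N)\<^sup>2 \<le> l1" using nB(2)[OF b] \<omega>(1) n1 N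
        by (auto simp: B1_def not_le) (smt (verit) divide_nonneg_nonneg)
      then have "sqrt (?S\<^sup>2 / (?n + N)\<^sup>2) \<le> sqrt l1" by simp
      then have "\<bar>?S\<bar> / (?n + N) \<le> \<epsilon> / (4 * \<sigma>)"
        using n1 N assms sigma_pos by (simp add: real_sqrt_divide l1_def)
      then have "\<bar>?S\<bar> \<le> \<epsilon> / (4 * \<sigma>) * (?n + N)" using n1 N by (simp add: divide_le_eq)
      also have "\<dots> \<le> \<epsilon> / (4 * \<sigma>) * (2 * ?n)" using nN assms sigma_pos by (intro mult_left_mono) auto
      finally have "\<sigma> * (\<bar>?S\<bar> / ?n) \<le> \<epsilon> / 2" using n1 sigma_pos by (simp add: field_simps)
      moreover have "m / ?n \<le> m / N" using nN N m by (intro divide_left_mono) auto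
      ultimately show "\<bar>mb b t \<omega> - \<mu> b\<bar> \<le> \<epsilon>" using dev Nm by linarith
    qed
    then show False using \<omega> by simp
  qed
  have "prob {\<omega> \<in> space M. \<exists>t. \<omega> \<notin> good \<epsilon> C N t} \<le> prob (\<Union>b\<in>{1..K}. B0 b \<union> B1 b)"
    by (intro finite_measure_mono sub) measurable
  also have "\<dots> \<le> (\<Sum>b\<in>{1..K}. prob (B0 b \<union> B1 b))"
    by (intro finite_measure_subadditive_finite) auto
  also have "\<dots> \<le> (\<Sum>b\<in>{1..K}. \<delta> / real K)" by (intro sum_mono b)
  also have "\<dots> = \<delta>" using Kpos by simp
  finally show ?thesis using C N by blast
qed

end

section \<open>Suboptimal arms\<close>

lemma (in prob_space) prob_eq_expectation_of_bool:
  assumes "Measurable.pred M P"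
  shows "prob {\<omega> \<in> space M. P \<omega>} = expectation (\<lambda>\<omega>. of_bool (P \<omega>))"
proof -
  have "{\<omega> \<in> space M. P \<omega>} \<in> sets M" using assms by (rule predE)
  then have "prob {\<omega> \<in> space M. P \<omega>} = expectation (indicator {\<omega> \<in> space M. P \<omega>})" by simp
  also have "\<dots> = expectation (\<lambda>\<omega>. of_bool (P \<omega>))"
    by (intro Bochner_Integration.integral_cong) (auto simp: indicator_def)
  finally show ?thesis .
qed

lemma (in prob_space) integrable_of_bool:
  assumes "Measurable.pred M P"
  shows "integrable M (\<lambda>\<omega>. of_bool (P \<omega>) :: real)"
proof (rule integrable_const_bound[of _ 1])
  show "(\<lambda>\<omega>. of_bool (P \<omega>) :: real) \<in> borel_measurable M" using assms by (rule measurable_of_bool)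
qed auto

lemma (in prob_space) sum_prob_le:
  assumes "\<And>t. Measurable.pred M (P t)"
    and "\<And>\<omega>. \<omega> \<in> space M \<Longrightarrow> (\<Sum>t<T. of_bool (P t \<omega>)) \<le> (x::real)"
  shows "(\<Sum>t<(T::nat). prob {\<omega> \<in> space M. P t \<omega>}) \<le> x"
proof -
  have "(\<Sum>t<T. prob {\<omega> \<in> space M. P t \<omega>}) = expectation (\<lambda>\<omega>. \<Sum>t<T. of_bool (P t \<omega>))"
    by (subst Bochner_Integration.integral_sum)
       (simp_all only: prob_eq_expectation_of_bool[OF assms(1)] integrable_of_bool[OF assms(1)])
  also have "\<dots> \<le> expectation (\<lambda>_. x)"
  proof (rule integral_mono)
    show "integrable M (\<lambda>\<omega>. \<Sum>t<T. of_bool (P t \<omega>) :: real)"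
      by (intro Bochner_Integration.integrable_sum integrable_of_bool assms(1))
  qed (use assms(2) in auto)
  finally show ?thesis by (simp add: prob_space)
qed

section \<open>Rounds in which every index is low\<close>

context adapted_thompson
begin

lemma idx_eq_sqrt: "idx b t \<omega> = mb b t \<omega> + \<sigma> * Z b (Suc t) \<omega> / sqrt (nb b t \<omega>)"
proof -
  have "nb b t \<omega> powr (- 1 / 2) = 1 / sqrt (nb b t \<omega>)"
    using less_imp_le[OF nb_pos[of b t \<omega>]] by (simp add: powr_minus_divide powr_half_sqrt)
  then show ?thesis by (simp add: idx_eq)
qed

lemma idx_le_iff:
  "idx b t \<omega> \<le> y \<longleftrightarrow> Z b (Suc t) \<omega> \<le> (y - mb b t \<omega>) * sqrt (nb b t \<omega>) / \<sigma>"
proof -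
  have s: "sqrt (nb b t \<omega>) > 0" using nb_pos[of b t \<omega>] by simp
  have "idx b t \<omega> \<le> y \<longleftrightarrow> \<sigma> * Z b (Suc t) \<omega> / sqrt (nb b t \<omega>) \<le> y - mb b t \<omega>"
    by (auto simp: idx_eq_sqrt)
  also have "\<dots> \<longleftrightarrow> Z b (Suc t) \<omega> * \<sigma> \<le> (y - mb b t \<omega>) * sqrt (nb b t \<omega>)"
    using s by (simp add: pos_divide_le_eq mult.commute)
  also have "\<dots> \<longleftrightarrow> Z b (Suc t) \<omega> \<le> (y - mb b t \<omega>) * sqrt (nb b t \<omega>) / \<sigma>"
    using sigma_pos by (simp add: pos_le_divide_eq)
  finally show ?thesis .
qed

lemma good_D:
  assumes "\<omega> \<in> good \<epsilon> C N t" "b \<in> {1..K}"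
  shows "\<bar>mb b t \<omega> - \<mu> b\<bar> \<le> C" and "nb b t \<omega> \<ge> N \<Longrightarrow> \<bar>mb b t \<omega> - \<mu> b\<bar> \<le> \<epsilon>"
  using assms by (auto simp: good_def)

lemma cnt_eq_hist: "{\<omega> \<in> space M. cnt b t \<omega> = k} \<in> sets (gen (hist_index K t))"
proof -
  have "Measurable.pred (gen (hist_index K t)) (\<lambda>\<omega>. cnt b t \<omega> = k)"
    by (rule pred_eq_const1[OF cnt_measurable]) simp
  from predE[OF this] show ?thesis unfolding space_gen_algebra .
qed

lemma sample_row_measurable: "b \<in> {1..K} \<Longrightarrow> Z b (Suc t) \<in> borel_measurable (gen (row_index K (Suc t)))"
  by (rule sample_measurable) (auto simp: row_index_def)

text \<open>
  Given the past and the samples of the other arms, replacing the event that arm \<open>i\<close> is below \<open>y\<close> by its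
  complement turns ``all indices are below \<open>y\<close>'' into a pull of \<open>i\<close>, at the cost of an odds ratio.
\<close>

lemma prob_all_below_step:
  assumes i: "i \<in> {1..K}"
    and z: "\<And>\<omega>. \<omega> \<in> good \<epsilon> C N t \<Longrightarrow> cnt i t \<omega> = k \<Longrightarrow> (y - mb i t \<omega>) * sqrt (nb i t \<omega>) / \<sigma> \<le> z"
  shows "prob {\<omega> \<in> good \<epsilon> C N t. cnt i t \<omega> = k \<and> (\<forall>b\<in>{1..K}. idx b t \<omega> \<le> y)}
    \<le> cdf D z / ccdf D z * prob {\<omega> \<in> space M. A (Suc t) \<omega> = i \<and> cnt i t \<omega> = k}"
proof -
  define G where "G = good \<epsilon> C N t \<inter> {\<omega> \<in> space M. cnt i t \<omega> = k}"
  define thr where "thr b \<omega> = (y - mb b t \<omega>) * sqrt (nb b t \<omega>) / \<sigma>" for b \<omega>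
  \<comment> \<open>\<open>Q\<close> and \<open>Q'\<close> differ only at arm \<open>i\<close>, so
    the product over the other arms is a common factor of both probabilities.\<close>
  define Q where "Q \<omega> \<omega>' \<longleftrightarrow> (\<forall>b\<in>{1..K}. Z b (Suc t) \<omega>' \<in> {..thr b \<omega>})" for \<omega> \<omega>'
  define Q' where "Q' \<omega> \<omega>' \<longleftrightarrow> (\<forall>b\<in>{1..K}. Z b (Suc t) \<omega>' \<in> (if b = i then {thr b \<omega><..} else {..thr b \<omega>}))" for \<omega> \<omega>'
  let ?G1 = "gen (hist_index K t)" and ?G2 = "gen (row_index K (Suc t))"
  have G: "G \<in> sets ?G1" unfolding G_def by (intro sets.Int good_hist cnt_eq_hist)
  have thr: "thr b \<in> borel_measurable ?G1" for b
    unfolding thr_def[abs_def] using mb_measurable[of b t] nb_measurable[of b t] by measurable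
  have c: "cdf D z / ccdf D z \<ge> 0" using law.cdf_pos law.ccdf_pos by (simp add: less_imp_le)
  have "prob {\<omega> \<in> G. Q \<omega> \<omega>} \<le> cdf D z / ccdf D z * prob {\<omega> \<in> G. Q' \<omega> \<omega>}"
  proof (rule prob_gen_algebra_freeze_le[OF indep' index_subset(1) index_subset(3) index_disjoint(1) G, where Q = Q and Q' = Q'])
    show "Measurable.pred (?G1 \<Otimes>\<^sub>M ?G2) (\<lambda>p. Q (fst p) (snd p))"
      unfolding Q_def
    proof (rule pred_intros_finite)
      fix b assume "b \<in> {1..K}"
      note [measurable] = thr[of b] sample_row_measurable[OF this, of t]
      show "Measurable.pred (?G1 \<Otimes>\<^sub>M ?G2) (\<lambda>p. Z b (Suc t) (snd p) \<in> {..thr b (fst p)})"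
        unfolding atMost_iff by measurable
    qed simp
    show "Measurable.pred (?G1 \<Otimes>\<^sub>M ?G2) (\<lambda>p. Q' (fst p) (snd p))"
      unfolding Q'_def
    proof (rule pred_intros_finite)
      fix b assume "b \<in> {1..K}"
      note [measurable] = thr[of b] sample_row_measurable[OF this, of t]
      show "Measurable.pred (?G1 \<Otimes>\<^sub>M ?G2) (\<lambda>p. Z b (Suc t) (snd p) \<in> (if b = i then {thr b (fst p)<..} else {..thr b (fst p)}))"
      proof (cases "b = i")
        case True
        have "Measurable.pred (?G1 \<Otimes>\<^sub>M ?G2) (\<lambda>p. Z b (Suc t) (snd p) > thr b (fst p))" by measurable
        then show ?thesis using True by simp
      next
        case False
        have "Measurable.pred (?G1 \<Otimes>\<^sub>M ?G2) (\<lambda>p. Z b (Suc t) (snd p) \<le> thr b (fst p))" by measurable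
        then show ?thesis using False by simp
      qed
    qed simp
    fix \<omega> assume \<omega>: "\<omega> \<in> G"
    define q where "q = (\<Prod>b\<in>{1..K} - {i}. cdf D (thr b \<omega>))"
    have q: "q \<ge> 0" unfolding q_def by (intro prod_nonneg) (simp add: cdf_def)
    have "prob {\<omega>' \<in> space M. Q \<omega> \<omega>'} = (\<Prod>b\<in>{1..K}. measure D {..thr b \<omega>})"
      unfolding Q_def by (rule prob_row[OF K_ge_1]) auto
    also have "\<dots> = cdf D (thr i \<omega>) * q"
      unfolding q_def cdf_def by (rule prod.remove) (use i in auto)
    finally have P: "prob {\<omega>' \<in> space M. Q \<omega> \<omega>'} = cdf D (thr i \<omega>) * q" .
    have "prob {\<omega>' \<in> space M. Q' \<omega> \<omega>'} = (\<Prod>b\<in>{1..K}. measure D (if b = i then {thr b \<omega><..} else {..thr b \<omega>}))"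
      unfolding Q'_def by (rule prob_row[OF K_ge_1]) auto
    also have "\<dots> = measure D (if i = i then {thr i \<omega><..} else {..thr i \<omega>})
        * (\<Prod>b\<in>{1..K} - {i}. measure D (if b = i then {thr b \<omega><..} else {..thr b \<omega>}))"
      by (rule prod.remove) (use i in auto)
    also have "(\<Prod>b\<in>{1..K} - {i}. measure D (if b = i then {thr b \<omega><..} else {..thr b \<omega>})) = q"
      unfolding q_def cdf_def by (intro prod.cong) auto
    finally have P': "prob {\<omega>' \<in> space M. Q' \<omega> \<omega>'} = ccdf D (thr i \<omega>) * q"
      by (simp add: law.ccdf_eq)
    have le: "thr i \<omega> \<le> z" using z[of \<omega>] \<omega> by (simp add: G_def thr_def)
    have "cdf D (thr i \<omega>) * ccdf D z \<le> cdf D z * ccdf D (thr i \<omega>)"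
      by (intro mult_mono law.cdf_nondecreasing law.ccdf_antimono le less_imp_le law.cdf_pos law.ccdf_pos)
    then have "cdf D (thr i \<omega>) \<le> cdf D z / ccdf D z * ccdf D (thr i \<omega>)"
      using law.ccdf_pos[of z] by (simp add: pos_le_divide_eq)
    then show "prob {\<omega>' \<in> space M. Q \<omega> \<omega>'} \<le> cdf D z / ccdf D z * prob {\<omega>' \<in> space M. Q' \<omega> \<omega>'}"
      unfolding P P' using mult_right_mono[OF _ q, of "cdf D (thr i \<omega>)"] by (simp only: mult.assoc[symmetric])
  qed (use c in auto)
  also have "\<dots> \<le> cdf D z / ccdf D z * prob {\<omega> \<in> space M. A (Suc t) \<omega> = i \<and> cnt i t \<omega> = k}"
  proof (intro mult_left_mono c finite_measure_mono)
    have "Measurable.pred M (\<lambda>\<omega>. A (Suc t) \<omega> = i)" "Measurable.pred M (\<lambda>\<omega>. cnt i t \<omega> = k)"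
      by (intro pred_eq_const1[OF pull_measurable_M] pred_eq_const1[OF cnt_measurable_M]; simp)+
    from predE[OF pred_intros_logic(3)[OF this]]
    show "{\<omega> \<in> space M. A (Suc t) \<omega> = i \<and> cnt i t \<omega> = k} \<in> sets M" .
    \<comment> \<open>Under \<open>Q'\<close> arm \<open>i\<close> has the only index above
      \<open>y\<close>, hence it is the maximiser.\<close>
    show "{\<omega> \<in> G. Q' \<omega> \<omega>} \<subseteq> {\<omega> \<in> space M. A (Suc t) \<omega> = i \<and> cnt i t \<omega> = k}"
    proof safe
      fix \<omega> assume \<omega>: "\<omega> \<in> G" and Q': "Q' \<omega> \<omega>"
      show sp: "\<omega> \<in> space M" and "cnt i t \<omega> = k" using \<omega> by (auto simp: G_def)
      have "Z i (Suc t) \<omega> > thr i \<omega>" using bspec[OF Q'[unfolded Q'_def] i] by simp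
      then have 1: "idx i t \<omega> > y" using idx_le_iff[of i t \<omega> y] by (auto simp: thr_def not_le[symmetric])
      have 2: "idx b t \<omega> \<le> y" if "b \<in> {1..K}" "b \<noteq> i" for b
        using bspec[OF Q'[unfolded Q'_def] that(1)] that(2) by (simp add: idx_le_iff thr_def)
      show "A (Suc t) \<omega> = i"
        using 1 2[of "A (Suc t) \<omega>"] idx_le_pull[OF sp i, of t] pull_in_arms[OF sp, of t] by fastforce
    qed
  qed
  also have "{\<omega> \<in> G. Q \<omega> \<omega>} = {\<omega> \<in> good \<epsilon> C N t. cnt i t \<omega> = k \<and> (\<forall>b\<in>{1..K}. idx b t \<omega> \<le> y)}"
    unfolding G_def Q_def idx_le_iff thr_def good_def by auto
  finally show ?thesis .
qed

lemma all_below_measurable: "Measurable.pred M (\<lambda>\<omega>. \<forall>b\<in>{1..K}. idx b t \<omega> \<le> y)"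
proof (rule pred_intros_finite)
  fix b assume "b \<in> {1..K}"
  note [measurable] = idx_measurable_M[OF this, of t]
  show "Measurable.pred M (\<lambda>\<omega>. idx b t \<omega> \<le> y)" by measurable
qed simp

lemma good_pred: "Measurable.pred M (\<lambda>\<omega>. \<omega> \<in> good \<epsilon> C N t)"
  by (rule pred_sets2[OF good_sets]) simp

lemma good_subset: "good \<epsilon> C N t \<subseteq> space M"
  by (auto simp: good_def)

lemma cnt_eq_pred: "Measurable.pred M (\<lambda>\<omega>. cnt b t \<omega> = k)"
  by (rule pred_eq_const1[OF cnt_measurable_M]) simp

lemma pull_eq_pred: "Measurable.pred M (\<lambda>\<omega>. A (Suc t) \<omega> = b)"
  by (rule pred_eq_const1[OF pull_measurable_M]) simp

text \<open>Rounds are sorted by the count \<open>k\<close> of arm \<open>i\<close>. The odds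
  \<open>g k\<close> are summable over \<open>k\<close>, and arm \<open>i\<close> is pulled at most
  once at each count, so summing over the rounds first leaves \<open>suminf g\<close>, whatever
  \<open>T\<close> is.\<close>

lemma sum_prob_all_below:
  assumes i: "i \<in> {1..K}" and pos: "\<epsilon> > 0" "C > 0"
  shows "\<exists>B. \<forall>T. (\<Sum>t<T. prob {\<omega> \<in> space M. \<omega> \<in> good \<epsilon> C N t \<and> (\<forall>b\<in>{1..K}. idx b t \<omega> \<le> \<mu> i - 2 * \<epsilon>)}) \<le> B"
proof -
  \<comment> \<open>A bound on the threshold for the sample of \<open>i\<close>: with at least
    \<open>N\<close> observations the mean is at least \<open>\<mu> i - \<epsilon>\<close>, one
    \<open>\<epsilon>\<close> above the level, so the threshold is negative. The finitely many
    smaller counts get the crude bound.\<close>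
  define z where "z k = (if 1 + real k \<ge> N then - (\<epsilon> / \<sigma> * sqrt (real (Suc k))) else C / \<sigma> * sqrt (real (Suc k)))" for k
  define g where "g k = cdf D (z k) / ccdf D (z k)" for k
  let ?E = "\<lambda>t \<omega>. \<omega> \<in> good \<epsilon> C N t \<and> (\<forall>b\<in>{1..K}. idx b t \<omega> \<le> \<mu> i - 2 * \<epsilon>)"
  have g_pos: "g k \<ge> 0" for k
    unfolding g_def using law.cdf_pos law.ccdf_pos by (simp add: less_imp_le)
  have "summable g"
  proof (rule summable_comparison_test_ev)
    show "summable (\<lambda>k. cdf D (- (\<epsilon> / \<sigma> * sqrt (real (Suc k)))) / ccdf D 0)"
      using pos sigma_pos
      by (intro summable_divide summable_Suc_iff[of "\<lambda>k. cdf D (- (\<epsilon> / \<sigma> * sqrt (real k)))", THEN iffD2] law.summable_cdf_sqrt)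
         auto
    have "eventually (\<lambda>k. 1 + real k \<ge> N) sequentially" by real_asymp
    then show "eventually (\<lambda>k. norm (g k) \<le> cdf D (- (\<epsilon> / \<sigma> * sqrt (real (Suc k)))) / ccdf D 0) sequentially"
    proof eventually_elim
      case (elim k)
      then have zk: "z k = - (\<epsilon> / \<sigma> * sqrt (real (Suc k)))" by (simp add: z_def)
      have "z k \<le> 0" unfolding zk using pos sigma_pos by simp
      then have "ccdf D 0 \<le> ccdf D (z k)" by (rule law.ccdf_antimono)
      then show ?case unfolding zk[symmetric] using g_pos[of k] law.ccdf_pos law.cdf_pos[of "z k"]
        by (simp add: g_def) (intro divide_left_mono mult_pos_pos, auto simp: less_imp_le)
    qed
  qed
  define p where "p t k = prob {\<omega> \<in> space M. A (Suc t) \<omega> = i \<and> cnt i t \<omega> = k}" for t k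
  have step: "prob {\<omega> \<in> good \<epsilon> C N t. cnt i t \<omega> = k \<and> (\<forall>b\<in>{1..K}. idx b t \<omega> \<le> \<mu> i - 2 * \<epsilon>)} \<le> g k * p t k" for t k
    unfolding g_def p_def
  proof (rule prob_all_below_step[OF i])
    fix \<omega> assume \<omega>: "\<omega> \<in> good \<epsilon> C N t" "cnt i t \<omega> = k"
    have nb: "nb i t \<omega> = real (Suc k)" using \<omega>(2) by (simp add: nb_eq)
    show "(\<mu> i - 2 * \<epsilon> - mb i t \<omega>) * sqrt (nb i t \<omega>) / \<sigma> \<le> z k"
    proof (cases "1 + real k \<ge> N")
      case True
      then have "\<mu> i - 2 * \<epsilon> - mb i t \<omega> \<le> - \<epsilon>" using good_D(2)[OF \<omega>(1) i] nb by auto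
      then have "(\<mu> i - 2 * \<epsilon> - mb i t \<omega>) * sqrt (nb i t \<omega>) / \<sigma> \<le> - \<epsilon> * sqrt (nb i t \<omega>) / \<sigma>"
        using sigma_pos nb by (intro divide_right_mono mult_right_mono) auto
      then show ?thesis using True by (simp add: z_def nb)
    next
      case False
      have "\<mu> i - 2 * \<epsilon> - mb i t \<omega> \<le> C" using good_D(1)[OF \<omega>(1) i] pos by auto
      then have "(\<mu> i - 2 * \<epsilon> - mb i t \<omega>) * sqrt (nb i t \<omega>) / \<sigma> \<le> C * sqrt (nb i t \<omega>) / \<sigma>"
        using sigma_pos nb by (intro divide_right_mono mult_right_mono) auto
      then show ?thesis using False by (simp add: z_def nb)
    qed
  qed
  have psum: "(\<Sum>t<T. p t k) \<le> 1" for T k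
    unfolding p_def
  proof (rule sum_prob_le)
    show "Measurable.pred M (\<lambda>\<omega>. A (Suc t) \<omega> = i \<and> cnt i t \<omega> = k)" for t
      by (intro pred_intros_logic pull_eq_pred cnt_eq_pred)
    show "(\<Sum>t<T. of_bool (A (Suc t) \<omega> = i \<and> cnt i t \<omega> = k)) \<le> (1::real)" for \<omega>
      unfolding cnt_def by (rule pulls_at_count_le)
  qed
  have split: "prob {\<omega> \<in> space M. ?E t \<omega>} \<le> (\<Sum>k<T. g k * p t k)" if "t < T" for t T
  proof -
    have "{\<omega> \<in> space M. ?E t \<omega>} \<subseteq> (\<Union>k\<in>{..<T}. {\<omega> \<in> good \<epsilon> C N t. cnt i t \<omega> = k \<and> (\<forall>b\<in>{1..K}. idx b t \<omega> \<le> \<mu> i - 2 * \<epsilon>)})"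
      using cnt_le[of i t] that by (auto intro: le_less_trans)
    moreover have ms: "{\<omega> \<in> good \<epsilon> C N t. cnt i t \<omega> = k \<and> (\<forall>b\<in>{1..K}. idx b t \<omega> \<le> \<mu> i - 2 * \<epsilon>)} \<in> sets M" for k
    proof -
      have "Measurable.pred M (\<lambda>\<omega>. \<omega> \<in> good \<epsilon> C N t \<and> cnt i t \<omega> = k \<and> (\<forall>b\<in>{1..K}. idx b t \<omega> \<le> \<mu> i - 2 * \<epsilon>))"
        by (intro pred_intros_logic(3) good_pred cnt_eq_pred all_below_measurable)
      moreover have "{\<omega> \<in> good \<epsilon> C N t. cnt i t \<omega> = k \<and> (\<forall>b\<in>{1..K}. idx b t \<omega> \<le> \<mu> i - 2 * \<epsilon>)}
        = {\<omega> \<in> space M. \<omega> \<in> good \<epsilon> C N t \<and> cnt i t \<omega> = k \<and> (\<forall>b\<in>{1..K}. idx b t \<omega> \<le> \<mu> i - 2 * \<epsilon>)}"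
        using good_subset[of \<epsilon> C N t] by auto
      ultimately show ?thesis by (simp only: predE)
    qed
    ultimately have "prob {\<omega> \<in> space M. ?E t \<omega>}
        \<le> prob (\<Union>k\<in>{..<T}. {\<omega> \<in> good \<epsilon> C N t. cnt i t \<omega> = k \<and> (\<forall>b\<in>{1..K}. idx b t \<omega> \<le> \<mu> i - 2 * \<epsilon>)})"
      by (intro finite_measure_mono) auto
    also have "\<dots> \<le> (\<Sum>k<T. prob {\<omega> \<in> good \<epsilon> C N t. cnt i t \<omega> = k \<and> (\<forall>b\<in>{1..K}. idx b t \<omega> \<le> \<mu> i - 2 * \<epsilon>)})"
      using ms by (intro finite_measure_subadditive_finite) auto
    also have "\<dots> \<le> (\<Sum>k<T. g k * p t k)" by (intro sum_mono step)
    finally show ?thesis .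
  qed
  have "(\<Sum>t<T. prob {\<omega> \<in> space M. ?E t \<omega>}) \<le> suminf g" for T
  proof -
    have "(\<Sum>t<T. prob {\<omega> \<in> space M. ?E t \<omega>}) \<le> (\<Sum>t<T. \<Sum>k<T. g k * p t k)"
      by (intro sum_mono split) auto
    also have "\<dots> = (\<Sum>k<T. g k * (\<Sum>t<T. p t k))"
      by (subst sum.swap) (simp add: sum_distrib_left)
    also have "\<dots> \<le> (\<Sum>k<T. g k * 1)" by (intro sum_mono mult_left_mono psum g_pos)
    also have "\<dots> \<le> suminf g" using sum_le_suminf[OF \<open>summable g\<close>, of "{..<T}"] g_pos by simp
    finally show ?thesis .
  qed
  then show ?thesis by blast
qed

end

text \<open>The good event fails with a small but fixed probability \<open>\<delta>\<close>, so the
  limit in \<open>T\<close> is taken first and \<open>\<delta>\<close> is sent to 0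
  afterwards.\<close>

lemma tendsto_zero_by_slack:
  fixes f :: "nat \<Rightarrow> real"
  assumes nonneg: "\<And>T. f T \<ge> 0"
    and slack: "\<And>\<delta>. \<delta> > 0 \<Longrightarrow> \<exists>h. h \<longlonglongrightarrow> 0 \<and> eventually (\<lambda>T. f T \<le> \<delta> + h T) sequentially"
  shows "f \<longlonglongrightarrow> 0"
proof (rule order_tendstoI)
  fix e :: real assume "e < 0"
  then show "eventually (\<lambda>T. e < f T) sequentially" using nonneg less_le_trans by (intro always_eventually allI) blast
next
  fix e :: real assume e: "0 < e"
  obtain h where h: "h \<longlonglongrightarrow> 0" "eventually (\<lambda>T. f T \<le> e / 2 + h T) sequentially"
    using slack[of "e / 2"] e by auto
  have "eventually (\<lambda>T. h T < e / 2) sequentially" by (rule order_tendstoD(2)[OF h(1)]) (use e in simp)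
  with h(2) show "eventually (\<lambda>T. f T < e) sequentially" by eventually_elim (simp add: field_simps)
qed

lemma (in prob_space) prob_Markov_le:
  assumes "integrable M X" "\<And>\<omega>. X \<omega> \<ge> 0" "c > 0" "E \<in> sets M" "\<And>\<omega>. \<omega> \<in> E \<Longrightarrow> X \<omega> \<ge> c"
  shows "prob E \<le> expectation X / c"
proof -
  have "c * prob E = expectation (\<lambda>\<omega>. c * indicator E \<omega>)" using assms(4) by simp
  also have "\<dots> \<le> expectation X"
  proof (rule integral_mono)
    show "integrable M (\<lambda>\<omega>. c * indicator E \<omega>)" using assms(4) by (simp add: emeasure_eq_measure)
  qed (use assms in \<open>auto simp: indicator_def\<close>)
  finally show ?thesis using assms(3) by (simp add: field_simps)
qed

section \<open>Upper and lower bounds for the pulls of a suboptimal arm\<close>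

context adapted_thompson
begin

lemma cnt_real_measurable_M: "(\<lambda>\<omega>. real (cnt b t \<omega>)) \<in> borel_measurable M"
  by (rule measurable_compose[OF cnt_measurable_M]) simp

lemma cnt_gt_sets: "{\<omega> \<in> space M. real (cnt b t \<omega>) > x} \<in> sets M"
  by (intro borel_measurable_less borel_measurable_const cnt_real_measurable_M)

lemma cnt_lt_sets: "{\<omega> \<in> space M. real (cnt b t \<omega>) < x} \<in> sets M"
  by (intro borel_measurable_less borel_measurable_const cnt_real_measurable_M)

lemma bad_sets: "{\<omega> \<in> space M. \<exists>t. \<omega> \<notin> good \<epsilon> C N t} \<in> sets M"
proof -
  have "Measurable.pred M (\<lambda>\<omega>. \<exists>t. \<omega> \<notin> good \<epsilon> C N t)"
    by (intro pred_intros_countable(2) pred_intros_logic(2) good_pred)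
  then show ?thesis by (rule predE)
qed

text \<open>The count at which a sample at the \<open>1 / T\<close> quantile \<open>z\<close> just
  bridges the gap: it solves \<open>\<sigma> * z / sqrt n = \<Delta>\<close>.\<close>

definition nstar :: "real \<Rightarrow> nat \<Rightarrow> real" where
  "nstar \<Delta> T = (\<sigma> * law.tail_quantile T / \<Delta>)\<^sup>2"

lemma nstar_at_top: "\<Delta> > 0 \<Longrightarrow> filterlim (nstar \<Delta>) at_top sequentially"
proof -
  assume "\<Delta> > 0"
  then have "filterlim (\<lambda>T. \<sigma> / \<Delta> * law.tail_quantile T) at_top sequentially"
    using sigma_pos by (intro filterlim_tendsto_pos_mult_at_top[OF tendsto_const] law.tail_quantile_at_top) auto
  from filterlim_compose[OF filterlim_pow_at_top[OF _ filterlim_ident] this, of 2]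
  have "filterlim (\<lambda>T. (\<sigma> / \<Delta> * law.tail_quantile T)\<^sup>2) at_top sequentially" by simp
  then show ?thesis by (simp add: nstar_def[abs_def])
qed

lemma nstar_over_T: "\<Delta> > 0 \<Longrightarrow> (\<lambda>T. nstar \<Delta> T / real T) \<longlonglongrightarrow> 0"
  using tendsto_mult_right_zero[OF law.tail_quantile_sq_over, of "(\<sigma> / \<Delta>)\<^sup>2"]
  by (simp add: nstar_def power_mult_distrib power_divide mult.commute)

context
  fixes i a :: nat
  assumes i: "i \<in> {1..K}" and a: "a \<in> {1..K}"
    and best: "\<And>b. b \<in> {1..K} \<Longrightarrow> \<mu> b \<le> \<mu> i" and gap_pos: "\<mu> a < \<mu> i"
begin

text \<open>On the good event, a pull of \<open>a\<close> beyond \<open>(1 + d / 2) * nstar\<close>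
  needs a round in which all indices are at most \<open>\<mu> i - 2 * \<epsilon>\<close>, or a
  sample above \<open>c * z\<close> with \<open>c > 1\<close>. The expected number of the former is
  bounded, that of the latter vanishes, whereas an excess of \<open>d / 2 * nstar\<close> such
  rounds, which tends to infinity, would be required.\<close>

lemma overpull_prob:
  assumes d: "d > 0"
  shows "(\<lambda>T. prob {\<omega> \<in> space M. real (cnt a T \<omega>) > (1 + d) * nstar (\<mu> i - \<mu> a) T}) \<longlonglongrightarrow> 0"
proof (rule tendsto_zero_by_slack)
  fix \<delta> :: real assume \<delta>: "\<delta> > 0"
  define \<Delta> where "\<Delta> = \<mu> i - \<mu> a"
  have \<Delta>: "\<Delta> > 0" using gap_pos by (simp add: \<Delta>_def)
  \<comment> \<open>Half of \<open>d\<close> goes into the threshold \<open>x\<close>, the other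
    half is left for Markov's inequality. \<open>c\<close> is the midpoint of 1 and
    \<open>s\<close>, and \<open>\<epsilon>\<close> is chosen so that
    \<open>(\<Delta> - 3 * \<epsilon>) * s = c * \<Delta>\<close>: two \<open>\<epsilon>\<close>
    come from the level, one from the mean of \<open>a\<close>.\<close>
  define s where "s = sqrt (1 + d / 2)"
  have s: "s > 1" using d by (simp add: s_def)
  define c where "c = (s + 1) / 2"
  have c: "c > 1" using s by (simp add: c_def)
  define \<epsilon> where "\<epsilon> = \<Delta> * (s - 1) / (6 * s)"
  have \<epsilon>: "\<epsilon> > 0" using \<Delta> s by (simp add: \<epsilon>_def)
  have \<epsilon>c: "(\<Delta> - 3 * \<epsilon>) * s = c * \<Delta>" using s by (simp add: \<epsilon>_def c_def field_simps)
  obtain C N where CN: "C > 0" "N > 0" and bad: "prob {\<omega> \<in> space M. \<exists>t. \<omega> \<notin> good \<epsilon> C N t} \<le> \<delta>"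
    using ex_good[OF \<epsilon> \<delta>] by blast
  let ?E = "\<lambda>t \<omega>. \<omega> \<in> good \<epsilon> C N t \<and> (\<forall>b\<in>{1..K}. idx b t \<omega> \<le> \<mu> i - 2 * \<epsilon>)"
  obtain B where B: "\<And>T. (\<Sum>t<T. prob {\<omega> \<in> space M. ?E t \<omega>}) \<le> B"
    using sum_prob_all_below[OF i \<epsilon> CN(1), of N] by blast
  let ?z = law.tail_quantile and ?n = "nstar \<Delta>"
  define h where "h T = (B + real T * ccdf D (c * ?z T)) / (d / 2 * ?n T)" for T
  have "h \<longlonglongrightarrow> 0"
  proof -
    have "filterlim (\<lambda>T. d / 2 * ?n T) at_infinity sequentially"
      by (intro filterlim_at_top_imp_at_infinity filterlim_tendsto_pos_mult_at_top[OF tendsto_const] nstar_at_top \<Delta>)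
         (use d in auto)
    moreover have "(\<lambda>T. B + real T * ccdf D (c * ?z T)) \<longlonglongrightarrow> B + 0"
      by (intro tendsto_add tendsto_const law.T_mult_ccdf_limit c)
    ultimately show ?thesis unfolding h_def[abs_def] by (intro tendsto_divide_0) auto
  qed
  moreover have "eventually (\<lambda>T. prob {\<omega> \<in> space M. real (cnt a T \<omega>) > (1 + d) * ?n T} \<le> \<delta> + h T) sequentially"
  proof -
    have "eventually (\<lambda>T. ?n T > N) sequentially"
      using nstar_at_top[OF \<Delta>] by (simp add: filterlim_at_top_dense)
    moreover have "eventually (\<lambda>T. ?z T > 0) sequentially"
      using law.tail_quantile_at_top by (simp add: filterlim_at_top_dense)
    ultimately show ?thesis
    proof eventually_elim
      case (elim T)
      have n0: "?n T > 0" using elim CN by linarith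
      define x where "x = (1 + d / 2) * ?n T"
      have xN: "x \<ge> N" using elim d n0 unfolding x_def by (simp add: algebra_simps add_increasing2 less_imp_le)
      have x0: "x > 0" using xN CN by linarith
      have sqx: "sqrt x = s * (\<sigma> * ?z T / \<Delta>)"
        using elim sigma_pos \<Delta> by (simp add: x_def s_def nstar_def real_sqrt_mult)
      let ?W = "\<lambda>t \<omega>. Z a (Suc t) \<omega> > c * ?z T"
      have pW: "Measurable.pred M (?W t)" for t
      proof -
        note [measurable] = sample_rv[OF a, of "Suc t"]
        show ?thesis by measurable
      qed
      have pE: "Measurable.pred M (?E t)" for t
        by (intro pred_intros_logic(3) good_pred all_below_measurable)
      define R where "R \<omega> = (\<Sum>t<T. of_bool (?E t \<omega>) + of_bool (?W t \<omega>) :: real)" for \<omega>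
      have Rint: "integrable M R"
        unfolding R_def[abs_def]
        by (intro Bochner_Integration.integrable_sum Bochner_Integration.integrable_add integrable_of_bool pE pW)
      have "expectation R = (\<Sum>t<T. prob {\<omega> \<in> space M. ?E t \<omega>} + prob {\<omega> \<in> space M. ?W t \<omega>})"
        unfolding R_def[abs_def]
        by (subst Bochner_Integration.integral_sum)
           (simp_all only: prob_eq_expectation_of_bool[OF pE] prob_eq_expectation_of_bool[OF pW]
              Bochner_Integration.integral_add integrable_of_bool[OF pE] integrable_of_bool[OF pW]
              Bochner_Integration.integrable_add)
      moreover have "prob {\<omega> \<in> space M. ?W t \<omega>} = ccdf D (c * ?z T)" for t
        using prob_sample[OF a, of "Suc t" "{c * ?z T<..}"] by (simp add: law.ccdf_eq)
      ultimately have ER: "expectation R \<le> B + real T * ccdf D (c * ?z T)"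
        using B[of T] by (simp add: sum.distrib)
      have key: "d / 2 * ?n T \<le> R \<omega>"
        if \<omega>: "\<omega> \<in> space M" and g: "\<And>t. \<omega> \<in> good \<epsilon> C N t" and big: "real (cnt a T \<omega>) > (1 + d) * ?n T" for \<omega>
      proof -
        have late: "of_bool (A (Suc t) \<omega> = a \<and> nb a t \<omega> \<ge> x) \<le> (of_bool (?E t \<omega>) + of_bool (?W t \<omega>) :: real)" for t
        proof (cases "A (Suc t) \<omega> = a \<and> nb a t \<omega> \<ge> x \<and> \<not> ?E t \<omega>")
          case True
          then obtain b where b: "b \<in> {1..K}" "idx b t \<omega> > \<mu> i - 2 * \<epsilon>" using g by (auto simp: not_le)
          then have "\<not> idx a t \<omega> \<le> \<mu> i - 2 * \<epsilon>" using idx_le_pull[OF \<omega> b(1), of t] True by auto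
          then have Za: "Z a (Suc t) \<omega> > (\<mu> i - 2 * \<epsilon> - mb a t \<omega>) * sqrt (nb a t \<omega>) / \<sigma>"
            by (simp add: idx_le_iff)
          have "mb a t \<omega> \<le> \<mu> a + \<epsilon>" using good_D(2)[OF g a, of t] True xN by auto
          then have m: "\<mu> i - 2 * \<epsilon> - mb a t \<omega> \<ge> \<Delta> - 3 * \<epsilon>" by (simp add: \<Delta>_def)
          have "\<Delta> - 3 * \<epsilon> > 0"
          proof -
            have "(\<Delta> - 3 * \<epsilon>) * s > 0" unfolding \<epsilon>c using c \<Delta> by simp
            then show ?thesis using s by (simp add: zero_less_mult_iff)
          qed
          then have "(\<mu> i - 2 * \<epsilon> - mb a t \<omega>) * sqrt (nb a t \<omega>) \<ge> (\<Delta> - 3 * \<epsilon>) * sqrt x"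
            using m True x0 by (intro mult_mono) auto
          also have "(\<Delta> - 3 * \<epsilon>) * sqrt x = \<sigma> * (c * ?z T)"
          proof -
            have "(\<Delta> - 3 * \<epsilon>) * sqrt x = ((\<Delta> - 3 * \<epsilon>) * s) * (\<sigma> * ?z T / \<Delta>)" unfolding sqx by simp
            also have "\<dots> = \<sigma> * (c * ?z T)" unfolding \<epsilon>c using \<Delta> by simp
            finally show ?thesis .
          qed
          finally have "(\<mu> i - 2 * \<epsilon> - mb a t \<omega>) * sqrt (nb a t \<omega>) / \<sigma> \<ge> c * ?z T"
            using sigma_pos by (simp add: pos_le_divide_eq mult.commute)
          then have "?W t \<omega>" using Za by linarith
          then show ?thesis by simp
        qed auto
        have "real (cnt a T \<omega>) \<le> x + (\<Sum>t<T. of_bool (A (Suc t) \<omega> = a \<and> nb a t \<omega> \<ge> x))"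
          unfolding cnt_def nb_def by (rule pull_count_le_late_pulls) (use x0 in simp)
        also have "\<dots> \<le> x + R \<omega>"
          unfolding R_def by (intro add_left_mono sum_mono late)
        finally show ?thesis using big by (simp add: x_def algebra_simps)
      qed
      let ?bad = "{\<omega> \<in> space M. \<exists>t. \<omega> \<notin> good \<epsilon> C N t}"
      define F where "F = {\<omega> \<in> space M. real (cnt a T \<omega>) > (1 + d) * ?n T} - ?bad"
      have F: "F \<in> sets M" unfolding F_def by (intro sets.Diff cnt_gt_sets bad_sets)
      have "prob F \<le> expectation R / (d / 2 * ?n T)"
      proof (rule prob_Markov_le[OF Rint _ _ F])
        show "R \<omega> \<ge> 0" for \<omega> unfolding R_def by (intro sum_nonneg) auto
        show "d / 2 * ?n T > 0" using d n0 by simp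
        show "d / 2 * ?n T \<le> R \<omega>" if "\<omega> \<in> F" for \<omega>
          using that by (intro key) (auto simp: F_def)
      qed
      also have "\<dots> \<le> h T" unfolding h_def using d n0 by (intro divide_right_mono ER) simp
      finally have F_le: "prob F \<le> h T" .
      have "prob {\<omega> \<in> space M. real (cnt a T \<omega>) > (1 + d) * ?n T} \<le> prob (?bad \<union> F)"
        by (rule finite_measure_mono[OF _ sets.Un[OF bad_sets F]]) (auto simp: F_def)
      also have "\<dots> \<le> prob ?bad + prob F" by (rule measure_Un_le[OF bad_sets F])
      finally show ?case using bad F_le by linarith
    qed
  qed
  ultimately show "\<exists>h. h \<longlonglongrightarrow> 0 \<and> eventually (\<lambda>T. prob {\<omega> \<in> space M. real (cnt a T \<omega>) > (1 + d) * nstar (\<mu> i - \<mu> a) T} \<le> \<delta> + h T) sequentially"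
    unfolding \<Delta>_def by blast
qed simp

text \<open>While \<open>a\<close> has few pulls and the means are good, each round pulls it with
  probability at least \<open>\<kappa> * ccdf D (c * z)\<close>, through a high sample of
  \<open>a\<close> and low samples of all other arms. Staying below the target for \<open>T\<close>
  rounds would produce more early pulls than there can be, since \<open>T * ccdf D (c * z)\<close>
  outgrows \<open>nstar\<close> for \<open>c < 1\<close>.\<close>

lemma underpull_prob:
  assumes d: "0 < d" "d < 1"
  shows "(\<lambda>T. prob {\<omega> \<in> space M. real (cnt a T \<omega>) < (1 - d) * nstar (\<mu> i - \<mu> a) T}) \<longlonglongrightarrow> 0"
proof (rule tendsto_zero_by_slack)
  fix \<delta> :: real assume \<delta>: "\<delta> > 0"
  define \<Delta> where "\<Delta> = \<mu> i - \<mu> a"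
  have \<Delta>: "\<Delta> > 0" using gap_pos by (simp add: \<Delta>_def)
  define s where "s = sqrt (1 - d / 2)"
  have s: "0 < s" "s < 1" using d by (simp_all add: s_def)
  define c where "c = (s + 1) / 2"
  have c: "0 < c" "c < 1" using s by (simp_all add: c_def)
  define \<epsilon> where "\<epsilon> = \<Delta> * (1 - s) / (6 * s)"
  have \<epsilon>: "\<epsilon> > 0" using \<Delta> s by (simp add: \<epsilon>_def)
  have \<epsilon>c: "(\<Delta> + 3 * \<epsilon>) * s = c * \<Delta>" using s by (simp add: \<epsilon>_def c_def field_simps)
  obtain C N where CN: "C > 0" "N > 0" and bad: "prob {\<omega> \<in> space M. \<exists>t. \<omega> \<notin> good \<epsilon> C N t} \<le> \<delta>"
    using ex_good[OF \<epsilon> \<delta>] by blast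
  let ?z = law.tail_quantile and ?n = "nstar \<Delta>"
  \<comment> \<open>So low that even an arm with fewer than \<open>N\<close> observations, whose
    mean is known only up to \<open>C\<close>, has index at most
    \<open>\<mu> i + \<epsilon>\<close>.\<close>
  define v where "v = - (C * sqrt N / \<sigma>)"
  define \<kappa> where "\<kappa> = (\<Prod>b\<in>{1..K} - {a}. cdf D v)"
  have \<kappa>: "\<kappa> > 0" unfolding \<kappa>_def by (intro prod_pos) (simp add: law.cdf_pos)
  define h where "h T = ?n T / (\<kappa> * real T * ccdf D (c * ?z T))" for T
  have "h \<longlonglongrightarrow> 0"
  proof -
    have "(\<lambda>T. (\<sigma> / \<Delta>)\<^sup>2 / \<kappa> * ((?z T)\<^sup>2 / (real T * ccdf D (c * ?z T)))) \<longlonglongrightarrow> 0"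
      by (intro tendsto_mult_right_zero law.tail_quantile_sq_ratio_limit c)
    then show ?thesis by (simp add: h_def[abs_def] nstar_def power_mult_distrib power_divide mult_ac)
  qed
  moreover have "eventually (\<lambda>T. prob {\<omega> \<in> space M. real (cnt a T \<omega>) < (1 - d) * ?n T} \<le> \<delta> + h T) sequentially"
  proof -
    have "eventually (\<lambda>T. ?n T > 2 / d) sequentially"
      using nstar_at_top[OF \<Delta>] by (simp add: filterlim_at_top_dense)
    \<comment> \<open>This covers arm \<open>a\<close> itself while it has fewer than
      \<open>N\<close> observations.\<close>
    moreover have "eventually (\<lambda>T. ?z T > (\<Delta> + C + \<epsilon>) * sqrt N / (\<sigma> * c)) sequentially"
      using law.tail_quantile_at_top by (simp add: filterlim_at_top_dense)
    moreover have "eventually (\<lambda>T::nat. T > 0) sequentially" by (rule eventually_gt_at_top)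
    ultimately show ?thesis
    proof eventually_elim
      case (elim T)
      have n0: "?n T > 0" using elim d by (smt (verit) divide_pos_pos)
      have z0: "?z T > 0" using elim \<Delta> CN \<epsilon> sigma_pos c
        by (smt (verit) divide_nonneg_pos mult_nonneg_nonneg real_sqrt_ge_zero mult_pos_pos)
      \<comment> \<open>The \<open>+ 1\<close> converts a bound on the count into one on
        \<open>nb\<close>; for large \<open>T\<close> it is absorbed by
        \<open>d / 2 * nstar\<close>.\<close>
      define x where "x = (1 - d) * ?n T + 1"
      have x0: "x > 0" using d n0 by (simp add: x_def add_pos_pos)
      have x_le: "x \<le> (1 - d / 2) * ?n T"
        using elim(1) d by (simp add: x_def field_simps)
      have sqx: "sqrt x \<le> s * (\<sigma> * ?z T / \<Delta>)"
      proof -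
        have "sqrt x \<le> sqrt ((1 - d / 2) * ?n T)" using x_le by simp
        also have "\<dots> = s * (\<sigma> * ?z T / \<Delta>)"
          using z0 sigma_pos \<Delta> by (simp add: s_def nstar_def real_sqrt_mult)
        finally show ?thesis .
      qed
      define G where "G t = good \<epsilon> C N t \<inter> {\<omega> \<in> space M. nb a t \<omega> < x}" for t
      define W where "W t = {\<omega> \<in> space M. \<forall>b\<in>{1..K}. Z b (Suc t) \<omega> \<in> (if b = a then {c * ?z T<..} else {..v})}" for t
      have Gs: "G t \<in> sets (gen (hist_index K t))" for t
      proof -
        note [measurable] = nb_measurable[of a t]
        have "Measurable.pred (gen (hist_index K t)) (\<lambda>\<omega>. nb a t \<omega> < x)" by measurable
        from predE[OF this] show ?thesis unfolding G_def space_gen_algebra by (intro sets.Int good_hist)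
      qed
      have Ws: "W t \<in> sets (gen (row_index K (Suc t)))" for t
      proof -
        have "Measurable.pred (gen (row_index K (Suc t))) (\<lambda>\<omega>. \<forall>b\<in>{1..K}. Z b (Suc t) \<omega> \<in> (if b = a then {c * ?z T<..} else {..v}))"
          by (intro pred_intros_finite pred_sets2[OF _ sample_row_measurable]) auto
        from predE[OF this] show ?thesis unfolding W_def space_gen_algebra .
      qed
      have PW: "prob (W t) = \<kappa> * ccdf D (c * ?z T)" for t
      proof -
        have "prob (W t) = (\<Prod>b\<in>{1..K}. measure D (if b = a then {c * ?z T<..} else {..v}))"
          unfolding W_def by (rule prob_row[OF K_ge_1]) auto
        also have "\<dots> = measure D (if a = a then {c * ?z T<..} else {..v}) * (\<Prod>b\<in>{1..K} - {a}. measure D (if b = a then {c * ?z T<..} else {..v}))"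
          by (rule prod.remove) (use a in auto)
        also have "(\<Prod>b\<in>{1..K} - {a}. measure D (if b = a then {c * ?z T<..} else {..v})) = \<kappa>"
          unfolding \<kappa>_def cdf_def by (intro prod.cong) auto
        finally show ?thesis by (simp add: law.ccdf_eq)
      qed
      have sub: "G t \<inter> W t \<subseteq> {\<omega> \<in> space M. A (Suc t) \<omega> = a \<and> nb a t \<omega> < x}" for t
      proof safe
        fix \<omega> assume G: "\<omega> \<in> G t" and W: "\<omega> \<in> W t"
        show sp: "\<omega> \<in> space M" and nbx: "nb a t \<omega> < x" using G by (auto simp: G_def)
        have g: "\<omega> \<in> good \<epsilon> C N t" using G by (simp add: G_def)
        have Zw: "Z b (Suc t) \<omega> \<in> (if b = a then {c * ?z T<..} else {..v})" if "b \<in> {1..K}" for b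
          using W that by (simp add: W_def)
        have sq0: "sqrt (nb b t \<omega>) > 0" for b by simp
        have others: "idx b t \<omega> \<le> \<mu> i + \<epsilon>" if b: "b \<in> {1..K}" "b \<noteq> a" for b
        proof -
          have "Z b (Suc t) \<omega> \<le> v" using Zw[OF b(1)] b(2) by simp
          also have "v \<le> (\<mu> i + \<epsilon> - mb b t \<omega>) * sqrt (nb b t \<omega>) / \<sigma>"
          proof (cases "nb b t \<omega> \<ge> N")
            case True
            then have "mb b t \<omega> \<le> \<mu> i + \<epsilon>" using good_D(2)[OF g b(1)] best[OF b(1)] by auto
            then have "0 \<le> (\<mu> i + \<epsilon> - mb b t \<omega>) * sqrt (nb b t \<omega>) / \<sigma>"
              using sigma_pos less_imp_le[OF sq0[of b]] by (intro divide_nonneg_pos mult_nonneg_nonneg) auto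
            moreover have "v \<le> 0" using CN sigma_pos by (simp add: v_def)
            ultimately show ?thesis by linarith
          next
            case False
            have "mb b t \<omega> \<le> \<mu> i + C" using good_D(1)[OF g b(1)] best[OF b(1)] by auto
            then have "- C * sqrt (nb b t \<omega>) \<le> (\<mu> i + \<epsilon> - mb b t \<omega>) * sqrt (nb b t \<omega>)"
              using \<epsilon> less_imp_le[OF sq0[of b]] by (intro mult_right_mono) linarith+
            moreover have "- C * sqrt N \<le> - C * sqrt (nb b t \<omega>)" using False CN by simp
            ultimately have "- C * sqrt N / \<sigma> \<le> (\<mu> i + \<epsilon> - mb b t \<omega>) * sqrt (nb b t \<omega>) / \<sigma>"
              using sigma_pos by (intro divide_right_mono) auto
            then show ?thesis by (simp add: v_def)
          qed
          finally show ?thesis by (simp add: idx_le_iff)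
        qed
        have "(\<mu> i + \<epsilon> - mb a t \<omega>) * sqrt (nb a t \<omega>) / \<sigma> \<le> c * ?z T"
        proof (cases "nb a t \<omega> \<ge> N")
          case True
          then have "\<mu> i + \<epsilon> - mb a t \<omega> \<le> \<Delta> + 3 * \<epsilon>" using good_D(2)[OF g a] \<epsilon> by (auto simp: \<Delta>_def)
          then have "(\<mu> i + \<epsilon> - mb a t \<omega>) * sqrt (nb a t \<omega>) \<le> (\<Delta> + 3 * \<epsilon>) * sqrt (nb a t \<omega>)"
            using less_imp_le[OF sq0[of a]] by (intro mult_right_mono) linarith+
          also have "\<dots> \<le> (\<Delta> + 3 * \<epsilon>) * sqrt x" using nbx \<Delta> \<epsilon> by (intro mult_left_mono) auto
          also have "\<dots> \<le> (\<Delta> + 3 * \<epsilon>) * (s * (\<sigma> * ?z T / \<Delta>))" using sqx \<Delta> \<epsilon> by (intro mult_left_mono) auto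
          also have "\<dots> = ((\<Delta> + 3 * \<epsilon>) * s) * (\<sigma> * ?z T / \<Delta>)" by simp
          also have "\<dots> = c * ?z T * \<sigma>" unfolding \<epsilon>c using \<Delta> by simp
          finally show ?thesis using sigma_pos by (simp add: pos_divide_le_eq)
        next
          case False
          have "\<mu> i + \<epsilon> - mb a t \<omega> \<le> \<Delta> + C + \<epsilon>" using good_D(1)[OF g a] by (auto simp: \<Delta>_def)
          then have "(\<mu> i + \<epsilon> - mb a t \<omega>) * sqrt (nb a t \<omega>) \<le> (\<Delta> + C + \<epsilon>) * sqrt (nb a t \<omega>)"
            using less_imp_le[OF sq0[of a]] by (intro mult_right_mono) linarith+
          also have "\<dots> \<le> (\<Delta> + C + \<epsilon>) * sqrt N" using False \<Delta> CN \<epsilon> by (intro mult_left_mono) auto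
          also have "\<dots> \<le> c * ?z T * \<sigma>"
            using less_imp_le[OF elim(2)] sigma_pos c by (simp add: pos_divide_le_eq mult_ac)
          finally show ?thesis using sigma_pos by (simp add: pos_divide_le_eq)
        qed
        also have "c * ?z T < Z a (Suc t) \<omega>" using Zw[OF a] by simp
        finally have "\<not> idx a t \<omega> \<le> \<mu> i + \<epsilon>" by (simp add: idx_le_iff)
        then show "A (Suc t) \<omega> = a"
          using others[of "A (Suc t) \<omega>"] idx_le_pull[OF sp a, of t] pull_in_arms[OF sp, of t] by fastforce
      qed
      have pm: "Measurable.pred M (\<lambda>\<omega>. A (Suc t) \<omega> = a \<and> nb a t \<omega> < x)" for t
      proof -
        note [measurable] = nb_measurable_M[of a t]
        have "Measurable.pred M (\<lambda>\<omega>. nb a t \<omega> < x)" by measurable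
        then show ?thesis by (intro pred_intros_logic(3) pull_eq_pred)
      qed
      let ?k = "\<kappa> * ccdf D (c * ?z T)"
      have k: "?k > 0" using \<kappa> law.ccdf_pos by simp
      have step: "prob (G t) * ?k \<le> prob {\<omega> \<in> space M. A (Suc t) \<omega> = a \<and> nb a t \<omega> < x}" for t
      proof -
        have "prob (G t \<inter> W t) = prob (G t) * prob (W t)"
          by (rule prob_gen_algebra_Int[OF indep' index_subset(1) index_subset(3) index_disjoint(1) Gs Ws]) simp
        then show ?thesis using finite_measure_mono[OF sub predE[OF pm], of t] PW by simp
      qed
      have total: "(\<Sum>t<T. prob {\<omega> \<in> space M. A (Suc t) \<omega> = a \<and> nb a t \<omega> < x}) \<le> x"
        by (rule sum_prob_le[OF pm]) (use early_pulls_le[of x] x0 in \<open>simp add: nb_def less_imp_le\<close>)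
      let ?bad = "{\<omega> \<in> space M. \<exists>t. \<omega> \<notin> good \<epsilon> C N t}"
      define F where "F = {\<omega> \<in> space M. real (cnt a T \<omega>) < (1 - d) * ?n T} - ?bad"
      have F: "F \<in> sets M" unfolding F_def by (intro sets.Diff cnt_lt_sets bad_sets)
      \<comment> \<open>Counts increase with time, so a low count at \<open>T\<close> means a low
        count in every earlier round.\<close>
      have FG: "prob F \<le> prob (G t)" if "t < T" for t
      proof (rule finite_measure_mono)
        show "G t \<in> sets M" by (rule sets_gen_algebra_imp[OF indep' index_subset(1) Gs])
        show "F \<subseteq> G t"
        proof
          fix \<omega> assume \<omega>: "\<omega> \<in> F"
          have "cnt a t \<omega> \<le> cnt a T \<omega>" unfolding cnt_def using that by (intro pull_count_mono) simp
          then have "nb a t \<omega> < x" using \<omega> unfolding F_def x_def nb_eq by auto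
          then show "\<omega> \<in> G t" using \<omega> by (auto simp: G_def F_def)
        qed
      qed
      have "real T * (prob F * ?k) = (\<Sum>t<T. prob F * ?k)" by simp
      also have "\<dots> \<le> (\<Sum>t<T. prob (G t) * ?k)"
        by (intro sum_mono mult_right_mono FG) (use k in auto)
      also have "\<dots> \<le> (\<Sum>t<T. prob {\<omega> \<in> space M. A (Suc t) \<omega> = a \<and> nb a t \<omega> < x})"
        by (intro sum_mono step)
      also have "\<dots> \<le> x" by (rule total)
      also have "\<dots> \<le> ?n T" using order_trans[OF x_le mult_right_mono[of "1 - d / 2" 1 "?n T"]] d n0 by simp
      finally have "prob F * (\<kappa> * real T * ccdf D (c * ?z T)) \<le> ?n T" by (simp add: mult_ac)
      moreover have "\<kappa> * real T * ccdf D (c * ?z T) > 0" using \<kappa> law.ccdf_pos elim(3) by simp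
      ultimately have F_le: "prob F \<le> h T" unfolding h_def by (simp add: pos_le_divide_eq)
      have "prob {\<omega> \<in> space M. real (cnt a T \<omega>) < (1 - d) * ?n T} \<le> prob (?bad \<union> F)"
        by (rule finite_measure_mono[OF _ sets.Un[OF bad_sets F]]) (auto simp: F_def)
      also have "\<dots> \<le> prob ?bad + prob F" by (rule measure_Un_le[OF bad_sets F])
      finally show ?case using bad F_le by linarith
    qed
  qed
  ultimately show "\<exists>h. h \<longlonglongrightarrow> 0 \<and> eventually (\<lambda>T. prob {\<omega> \<in> space M. real (cnt a T \<omega>) < (1 - d) * nstar (\<mu> i - \<mu> a) T} \<le> \<delta> + h T) sequentially"
    unfolding \<Delta>_def by blast
qed simp

lemma suboptimal_count_ratio:
  "tendsto_in_prob M (\<lambda>T \<omega>. real (cnt a T \<omega>) / nstar (\<mu> i - \<mu> a) T) 1"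
  unfolding tendsto_in_prob_def
proof (intro allI impI)
  fix \<epsilon> :: real assume \<epsilon>: "\<epsilon> > 0"
  let ?n = "nstar (\<mu> i - \<mu> a)"
  define d where "d = min \<epsilon> (1 / 2)"
  have d: "0 < d" "d < 1" "d \<le> \<epsilon>" using \<epsilon> by (auto simp: d_def)
  let ?U = "\<lambda>T. {\<omega> \<in> space M. real (cnt a T \<omega>) > (1 + d) * ?n T}"
  let ?L = "\<lambda>T. {\<omega> \<in> space M. real (cnt a T \<omega>) < (1 - d) * ?n T}"
  have lim: "(\<lambda>T. prob (?U T) + prob (?L T)) \<longlonglongrightarrow> 0"
    using tendsto_add[OF overpull_prob[OF d(1)] underpull_prob[OF d(1,2)]] by simp
  have "eventually (\<lambda>T. ?n T > 0) sequentially"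
    using nstar_at_top[of "\<mu> i - \<mu> a"] gap_pos by (simp add: filterlim_at_top_dense)
  then have "eventually (\<lambda>T. prob {\<omega> \<in> space M. \<epsilon> < \<bar>real (cnt a T \<omega>) / ?n T - 1\<bar>} \<le> prob (?U T) + prob (?L T)) sequentially"
  proof eventually_elim
    case (elim T)
    have "{\<omega> \<in> space M. \<epsilon> < \<bar>real (cnt a T \<omega>) / ?n T - 1\<bar>} \<subseteq> ?U T \<union> ?L T"
    proof safe
      fix \<omega> assume "\<epsilon> < \<bar>real (cnt a T \<omega>) / ?n T - 1\<bar>" "\<not> real (cnt a T \<omega>) < (1 - d) * ?n T"
      then have "real (cnt a T \<omega>) / ?n T > 1 + d" "\<omega> \<in> space M \<Longrightarrow> True"
        using d elim by (auto simp: not_less pos_le_divide_eq[symmetric] abs_if split: if_splits)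
      then show "(1 + d) * ?n T < real (cnt a T \<omega>)" using elim by (simp add: pos_less_divide_eq)
    qed
    then have "prob {\<omega> \<in> space M. \<epsilon> < \<bar>real (cnt a T \<omega>) / ?n T - 1\<bar>} \<le> prob (?U T \<union> ?L T)"
      by (intro finite_measure_mono sets.Un cnt_gt_sets cnt_lt_sets)
    also have "\<dots> \<le> prob (?U T) + prob (?L T)" by (intro measure_Un_le cnt_gt_sets cnt_lt_sets)
    finally show ?case .
  qed
  then show "(\<lambda>T. prob {\<omega> \<in> space M. \<epsilon> < \<bar>real (cnt a T \<omega>) / ?n T - 1\<bar>}) \<longlonglongrightarrow> 0"
    by (intro tendsto_sandwich[OF _ _ tendsto_const lim]) auto
qed

lemma suboptimal_count_sublinear:
  assumes "e > 0"
  shows "(\<lambda>T. prob {\<omega> \<in> space M. real (cnt a T \<omega>) > e * real T}) \<longlonglongrightarrow> 0"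
proof -
  let ?n = "nstar (\<mu> i - \<mu> a)"
  have "eventually (\<lambda>T. ?n T / real T < e / 2) sequentially"
    using nstar_over_T[of "\<mu> i - \<mu> a"] gap_pos assms by (intro order_tendstoD(2)) auto
  then have "eventually (\<lambda>T. prob {\<omega> \<in> space M. real (cnt a T \<omega>) > e * real T}
      \<le> prob {\<omega> \<in> space M. real (cnt a T \<omega>) > (1 + 1) * ?n T}) sequentially"
    using eventually_gt_at_top[of 0]
  proof eventually_elim
    case (elim T)
    then have "2 * ?n T \<le> e * real T" by (simp add: field_simps)
    then show ?case by (intro finite_measure_mono cnt_gt_sets) auto
  qed
  then show ?thesis
    by (intro tendsto_sandwich[OF _ _ tendsto_const overpull_prob[of 1]]) auto
qed

end

end

section \<open>Tied arms\<close>

text \<open>A substitute for uniform integrability: a variable with second moment of order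
  \<open>H\<^sup>2\<close> costs \<open>c\<close> on the event considered and about
  \<open>H\<^sup>2 / c\<close> overall, with the level \<open>c\<close> left free.\<close>

lemma truncate_le:
  fixes v c :: real
  assumes "v \<ge> 0" "c > 0"
  shows "v \<le> c + v\<^sup>2 / c"
proof (cases "v \<le> c")
  case True
  then show ?thesis using assms by (simp add: add_increasing2)
next
  case False
  then have "v * c \<le> v\<^sup>2" using assms by (simp add: power2_eq_square)
  then have "v \<le> v\<^sup>2 / c" using assms by (simp add: pos_le_divide_eq)
  then show ?thesis using assms by simp
qed

lemma abs_sqrt_minus_1_le:
  assumes "0 \<le> (r::real)"
  shows "\<bar>sqrt r - 1\<bar> \<le> \<bar>r - 1\<bar>"
proof -
  have "r - 1 = (sqrt r - 1) * (sqrt r + 1)" using assms by (simp add: algebra_simps)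
  then have "\<bar>r - 1\<bar> = \<bar>sqrt r - 1\<bar> * (sqrt r + 1)" using assms by (simp add: abs_mult)
  moreover have "\<bar>sqrt r - 1\<bar> * 1 \<le> \<bar>sqrt r - 1\<bar> * (sqrt r + 1)" using assms by (intro mult_left_mono) auto
  ultimately show ?thesis by simp
qed

text \<open>\<open>n\<close> stands for \<open>nbar\<close>, and the \<open>- 1\<close> removes its
  fictitious observation; the last assumption makes that 1 as small as the relative error.\<close>

lemma ratio_near_1:
  fixes s n \<delta> :: real
  assumes "0 < \<delta>" "\<delta> \<le> 1 / 2" "\<bar>n - 1 - s\<bar> \<le> \<delta> * s" "1 \<le> \<delta> * s"
  shows "\<bar>s / n - 1\<bar> \<le> 2 * \<delta>" and "0 < n"
proof -
  have s: "0 < s" using assms by (smt (verit) mult_nonneg_nonpos)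
  have lo: "(1 - \<delta>) * s \<le> n" and hi: "n \<le> (1 + 2 * \<delta>) * s"
    using assms by (simp_all add: algebra_simps)
  have "0 < (1 - \<delta>) * s" using s assms by simp
  then show n: "0 < n" using lo by linarith
  have d: "(1 + 2 * \<delta>) * (1 - \<delta>) \<ge> 1" "(1 - 2 * \<delta>) * (1 + 2 * \<delta>) \<le> 1"
    using assms by (simp_all add: algebra_simps)
  have "s \<le> (1 + 2 * \<delta>) * ((1 - \<delta>) * s)"
    using mult_right_mono[OF d(1), of s] s by (simp add: mult.assoc)
  also have "\<dots> \<le> (1 + 2 * \<delta>) * n" using lo assms by (intro mult_left_mono) auto
  finally have 1: "s / n \<le> 1 + 2 * \<delta>" using n by (simp add: pos_divide_le_eq)
  have "(1 - 2 * \<delta>) * n \<le> (1 - 2 * \<delta>) * ((1 + 2 * \<delta>) * s)" using hi assms by (intro mult_left_mono) auto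
  also have "\<dots> \<le> s" using mult_right_mono[OF d(2), of s] s by (simp add: mult.assoc)
  finally have 2: "1 - 2 * \<delta> \<le> s / n" using n by (simp add: pos_le_divide_eq)
  show "\<bar>s / n - 1\<bar> \<le> 2 * \<delta>" using 1 2 by linarith
qed

context adapted_thompson
begin

text \<open>Subtracting the tied mean from the indices and rescaling by \<open>s / \<sigma>\<close>
  at a common count \<open>s\<close>, the algorithm compares \<open>pn b + sqrt s * Z b\<close>.
  Actual counts differ from \<open>s\<close>, which perturbs each term by a relative error
  \<open>2 * \<delta>\<close>; two arms give the factor 4 in the constant terms.\<close>

lemma pulled_imp_score_ge:
  assumes \<omega>: "\<omega> \<in> space M" and k: "A (Suc t) \<omega> = k" and j: "j \<in> {1..K}"
    and \<mu>: "\<mu> k = \<mu>s" "\<mu> j = \<mu>s"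
    and \<delta>: "0 < \<delta>" "\<delta> \<le> 1 / 2" "1 \<le> \<delta> * s"
    and cnt: "\<bar>real (cnt k t \<omega>) - s\<bar> \<le> \<delta> * s" "\<bar>real (cnt j t \<omega>) - s\<bar> \<le> \<delta> * s"
    and Z: "\<bar>Z k (Suc t) \<omega>\<bar> \<le> L" "\<bar>Z j (Suc t) \<omega>\<bar> \<le> L"
  shows "pn k t \<omega> - pn j t \<omega> \<ge> sqrt s * (Z j (Suc t) \<omega> - Z k (Suc t) \<omega>)
    - 2 * \<delta> * (\<bar>pn k t \<omega>\<bar> + \<bar>pn j t \<omega>\<bar>) - 4 * \<delta> * L * sqrt s - 4 * \<delta> * \<bar>\<mu>s\<bar> / \<sigma>"
proof -
  have s: "0 < s" using \<delta> by (smt (verit) mult_nonneg_nonpos)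
  define r where "r b = s / nb b t \<omega>" for b
  \<comment> \<open>Chosen so that \<open>idx = \<mu>s + \<sigma> / s * y\<close>; the last term is
    the bias of the fictitious observation.\<close>
  define y where "y b = r b * pn b t \<omega> + sqrt s * sqrt (r b) * Z b (Suc t) \<omega> - \<mu>s / \<sigma> * r b" for b
  have idx: "idx b t \<omega> = \<mu>s + \<sigma> / s * y b" if "\<mu> b = \<mu>s" for b
  proof -
    have sq: "sqrt s * sqrt (r b) = s / sqrt (nb b t \<omega>)"
      using s by (simp add: r_def real_sqrt_divide)
    have "\<sigma> / s * y b = \<sigma> / s * (s / nb b t \<omega> * pn b t \<omega>) + \<sigma> / s * (s / sqrt (nb b t \<omega>) * Z b (Suc t) \<omega>)
        - \<sigma> / s * (\<mu>s / \<sigma> * (s / nb b t \<omega>))"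
      unfolding y_def sq by (simp add: r_def algebra_simps)
    also have "\<dots> = \<sigma> * pn b t \<omega> / nb b t \<omega> + \<sigma> * Z b (Suc t) \<omega> / sqrt (nb b t \<omega>) - \<mu>s / nb b t \<omega>"
      using s sigma_pos by simp
    finally show ?thesis unfolding idx_eq_sqrt mb_eq that by (simp add: diff_divide_distrib)
  qed
  have "idx j t \<omega> \<le> idx k t \<omega>" using idx_le_pull[OF \<omega> j, of t] k by simp
  then have "\<sigma> / s * y j \<le> \<sigma> / s * y k" unfolding idx[OF \<mu>(1)] idx[OF \<mu>(2)] by simp
  moreover have "0 < \<sigma> / s" using s sigma_pos by simp
  ultimately have yy: "y j \<le> y k" by (simp only: mult_le_cancel_left_pos)
  have err: "\<bar>y b - (pn b t \<omega> + sqrt s * Z b (Suc t) \<omega> - \<mu>s / \<sigma>)\<bar>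
      \<le> 2 * \<delta> * \<bar>pn b t \<omega>\<bar> + 2 * \<delta> * L * sqrt s + 2 * \<delta> * \<bar>\<mu>s\<bar> / \<sigma>"
    if c: "\<bar>real (cnt b t \<omega>) - s\<bar> \<le> \<delta> * s" and z: "\<bar>Z b (Suc t) \<omega>\<bar> \<le> L" for b
  proof -
    have "\<bar>nb b t \<omega> - 1 - s\<bar> \<le> \<delta> * s" using c by (simp add: nb_eq)
    from ratio_near_1[OF \<delta>(1,2) this \<delta>(3)] have r: "\<bar>r b - 1\<bar> \<le> 2 * \<delta>" "0 < r b"
      using s by (simp_all add: r_def)
    have sr: "\<bar>sqrt (r b) - 1\<bar> \<le> 2 * \<delta>" using abs_sqrt_minus_1_le[of "r b"] r by linarith
    have "y b - (pn b t \<omega> + sqrt s * Z b (Suc t) \<omega> - \<mu>s / \<sigma>)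
      = (r b - 1) * pn b t \<omega> + sqrt s * ((sqrt (r b) - 1) * Z b (Suc t) \<omega>) - \<mu>s / \<sigma> * (r b - 1)"
      by (simp add: y_def algebra_simps)
    moreover have "\<bar>(r b - 1) * pn b t \<omega>\<bar> \<le> 2 * \<delta> * \<bar>pn b t \<omega>\<bar>"
      unfolding abs_mult by (intro mult_right_mono r) simp
    moreover have "\<bar>sqrt s * ((sqrt (r b) - 1) * Z b (Suc t) \<omega>)\<bar> \<le> sqrt s * (2 * \<delta> * L)"
    proof -
      have "\<bar>sqrt (r b) - 1\<bar> * \<bar>Z b (Suc t) \<omega>\<bar> \<le> 2 * \<delta> * L" using \<delta> by (intro mult_mono sr z) auto
      then show ?thesis using s by (simp add: abs_mult mult_left_mono)
    qed
    moreover have "\<bar>\<mu>s / \<sigma> * (r b - 1)\<bar> \<le> \<bar>\<mu>s\<bar> / \<sigma> * (2 * \<delta>)"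
    proof -
      have "\<bar>\<mu>s\<bar> / \<sigma> * \<bar>r b - 1\<bar> \<le> \<bar>\<mu>s\<bar> / \<sigma> * (2 * \<delta>)"
        using sigma_pos by (intro mult_left_mono r) auto
      then show ?thesis using sigma_pos by (simp add: abs_mult)
    qed
    moreover have "\<bar>e\<bar> \<le> u + v + w" if "e = u' + v' - w'" "\<bar>u'\<bar> \<le> u" "\<bar>v'\<bar> \<le> v" "\<bar>w'\<bar> \<le> w" for e u v w u' v' w' :: real
      using that by linarith
    ultimately have "\<bar>y b - (pn b t \<omega> + sqrt s * Z b (Suc t) \<omega> - \<mu>s / \<sigma>)\<bar>
      \<le> 2 * \<delta> * \<bar>pn b t \<omega>\<bar> + sqrt s * (2 * \<delta> * L) + \<bar>\<mu>s\<bar> / \<sigma> * (2 * \<delta>)" by blast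
    then show ?thesis by (simp only: mult_ac times_divide_eq_right times_divide_eq_left)
  qed
  have final: "pk - pj \<ge> sk - (ek + ej)"
    if "yj \<le> yk" "\<bar>yk - (pk + zk - m)\<bar> \<le> ek" "\<bar>yj - (pj + zj - m)\<bar> \<le> ej" "sk = zj - zk"
    for pk pj yk yj zk zj m ek ej sk :: real
    using that by linarith
  have "pn k t \<omega> - pn j t \<omega> \<ge> sqrt s * (Z j (Suc t) \<omega> - Z k (Suc t) \<omega>) -
    ((2 * \<delta> * \<bar>pn k t \<omega>\<bar> + 2 * \<delta> * L * sqrt s + 2 * \<delta> * \<bar>\<mu>s\<bar> / \<sigma>)
      + (2 * \<delta> * \<bar>pn j t \<omega>\<bar> + 2 * \<delta> * L * sqrt s + 2 * \<delta> * \<bar>\<mu>s\<bar> / \<sigma>))"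
    by (rule final[OF yy err[OF cnt(1) Z(1)] err[OF cnt(2) Z(2)]]) (rule right_diff_distrib)
  then show ?thesis unfolding distrib_left by linarith
qed

text \<open>A choice made from the samples of round \<open>Suc t\<close> alone is independent of the
  history, and every noise sum has mean zero. This is the baseline against which the pulled arm is
  measured.\<close>

lemma expectation_row_selected_pn:
  assumes "finite S" "S \<subseteq> {1..K}"
  shows "integrable M (\<lambda>\<omega>. \<Sum>b\<in>S. of_bool (argmax_sel S (\<lambda>b. Z b (Suc t) \<omega>) = b) * pn b t \<omega>)"
    and "expectation (\<lambda>\<omega>. \<Sum>b\<in>S. of_bool (argmax_sel S (\<lambda>b. Z b (Suc t) \<omega>) = b) * pn b t \<omega>) = 0"
proof -
  let ?B = "\<lambda>\<omega>. argmax_sel S (\<lambda>b. Z b (Suc t) \<omega>)"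
  have B: "?B \<in> measurable (gen (row_index K (Suc t))) (count_space UNIV)"
    by (rule measurable_argmax_sel) (use assms sample_row_measurable in auto)
  have *: "integrable M (\<lambda>\<omega>. of_bool (?B \<omega> = b) * pn b t \<omega>)"
    "expectation (\<lambda>\<omega>. of_bool (?B \<omega> = b) * pn b t \<omega>) = 0" for b
  proof -
    have m: "(\<lambda>\<omega>. of_bool (?B \<omega> = b) :: real) \<in> borel_measurable (gen (row_index K (Suc t)))"
      by (intro measurable_of_bool pred_eq_const1[OF B]) simp
    have "Measurable.pred M (\<lambda>\<omega>. ?B \<omega> = b)"
      by (rule pred_eq_const1[OF measurable_gen_algebra_imp[OF indep' index_subset(3) B]]) auto
    then have i: "integrable M (\<lambda>\<omega>. of_bool (?B \<omega> = b) :: real)" by (rule integrable_of_bool)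
    have sub: "row_index K (Suc t) \<subseteq> noise_and_samples K" by (rule index_subset(3)) simp
    note X = expectation_gen_algebra_mult[OF indep' index_subset(1) sub index_disjoint(1)
        pn_measurable integrable_pn m i, of b]
    show "integrable M (\<lambda>\<omega>. of_bool (?B \<omega> = b) * pn b t \<omega>)"
      using X(1) by (simp only: mult.commute)
    show "expectation (\<lambda>\<omega>. of_bool (?B \<omega> = b) * pn b t \<omega>) = 0"
      using X(2) by (simp only: mult.commute[of "of_bool _"] expectation_pn mult_zero_left)
  qed
  show "integrable M (\<lambda>\<omega>. \<Sum>b\<in>S. of_bool (?B \<omega> = b) * pn b t \<omega>)"
    by (intro Bochner_Integration.integrable_sum *)
  show "expectation (\<lambda>\<omega>. \<Sum>b\<in>S. of_bool (?B \<omega> = b) * pn b t \<omega>) = 0"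
    by (subst Bochner_Integration.integral_sum) (use * in auto)
qed

lemma integrable_pulled_pn: "integrable M (\<lambda>\<omega>. of_bool (A (Suc t) \<omega> = b) * pn b t \<omega>)"
  by (rule integrable_bounded_mult[OF pulled_measurable_pre[THEN pre_imp_M] integrable_pn, of _ _ 1]) auto

lemma integrable_pn_cnt: "integrable M (\<lambda>\<omega>. real (cnt b t \<omega>) * pn b t \<omega>)"
  by (rule integrable_bounded_mult[OF cnt_real_measurable_M integrable_pn, of _ _ "real t"]) (use cnt_le in auto)

text \<open>At a pull, \<open>(n + 1) * (pn + \<xi>) - n * pn = pn + (n + 1) * \<xi>\<close>, and
  the last term has mean zero. So this correlation records the noise sums of the arms at the moments
  they are pulled.\<close>

lemma expectation_pn_cnt_Suc:
  "expectation (\<lambda>\<omega>. real (cnt b (Suc t) \<omega>) * pn b (Suc t) \<omega>)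
    = expectation (\<lambda>\<omega>. real (cnt b t \<omega>) * pn b t \<omega>) + expectation (\<lambda>\<omega>. of_bool (A (Suc t) \<omega> = b) * pn b t \<omega>)"
proof -
  let ?a = "\<lambda>\<omega>. of_bool (A (Suc t) \<omega> = b) :: real"
  let ?u = "\<lambda>\<omega>. (real (cnt b t \<omega>) + 1) * ?a \<omega>"
  have cm: "(\<lambda>\<omega>. real (cnt b t \<omega>)) \<in> borel_measurable (gen (pre_index K t))"
    by (rule measurable_compose[OF hist_imp_pre[OF cnt_measurable]]) simp
  have um: "?u \<in> borel_measurable (gen (pre_index K t))"
    using cm pulled_measurable_pre[of t b] by measurable
  have ui: "integrable M ?u"
  proof (rule integrable_const_bound[of _ "real t + 1"])
    show "AE \<omega> in M. norm (?u \<omega>) \<le> real t + 1" using cnt_le by (auto simp: abs_mult)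
    show "?u \<in> borel_measurable M" by (rule pre_imp_M[OF um])
  qed
  note X = noise_mult_id[OF um ui noise_integrable[of "Suc t", simplified]]
  have "real (cnt b (Suc t) \<omega>) * pn b (Suc t) \<omega> =
    real (cnt b t \<omega>) * pn b t \<omega> + (?a \<omega> * pn b t \<omega> + ?u \<omega> * \<xi> (Suc t) \<omega>)" for \<omega>
    by (cases "A (Suc t) \<omega> = b") (simp_all add: cnt_Suc pn_Suc algebra_simps)
  then show ?thesis
    using X integrable_pn_cnt[of b t] integrable_pulled_pn[of t b] noise_mean[of "Suc t"] by simp
qed

end

section \<open>Expected score gain among tied arms\<close>

locale tied_arms = adapted_thompson M K \<mu> \<sigma> D \<xi> Z A
  for M :: "'w measure" and K \<mu> \<sigma> D \<xi> Z A +
  fixes S :: "nat set" and \<mu>s :: real and i j :: nat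
  assumes S: "S \<subseteq> {1..K}" and \<mu>s: "\<And>b. b \<in> S \<Longrightarrow> \<mu> b = \<mu>s"
    and i: "i \<in> S" and j: "j \<in> S" and ij: "i \<noteq> j"
begin

definition total_noise :: "nat \<Rightarrow> 'w \<Rightarrow> real" where
  "total_noise t \<omega> = (\<Sum>b\<in>S. \<bar>pn b t \<omega>\<bar>)"

text \<open>The second conjunct lets the additive 1 in \<open>nb\<close> be absorbed into the
  relative error \<open>\<delta>\<close>; the first excludes rounds that pull an arm outside the
  tie.\<close>

definition balanced :: "real \<Rightarrow> nat \<Rightarrow> 'w \<Rightarrow> bool" where
  "balanced \<delta> t \<omega> \<longleftrightarrow> A (Suc t) \<omega> \<in> S \<and> 1 \<le> \<delta> * (real t / real (card S)) \<and>
     (\<forall>b\<in>S. \<bar>real (cnt b t \<omega>) - real t / real (card S)\<bar> \<le> \<delta> * (real t / real (card S)))"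

definition large_sample :: "real \<Rightarrow> nat \<Rightarrow> 'w \<Rightarrow> bool" where
  "large_sample L t \<omega> \<longleftrightarrow> (\<exists>b\<in>S. \<bar>Z b (Suc t) \<omega>\<bar> > L)"

text \<open>
  On this event arm \<open>j\<close> has the largest sample among the arms in \<open>S\<close>, but arm \<open>i\<close> follows
  within \<open>v - u\<close>.
\<close>

definition close_race :: "real \<Rightarrow> real \<Rightarrow> real \<Rightarrow> nat \<Rightarrow> 'w \<Rightarrow> bool" where
  "close_race u x v t \<omega> \<longleftrightarrow> (\<forall>b\<in>{1..K}. Z b (Suc t) \<omega> \<in>
     (if b = j then {x<..v} else if b = i then {u<..x} else {..x}))"

definition leader :: "nat \<Rightarrow> 'w \<Rightarrow> nat" where
  "leader t \<omega> = argmax_sel S (\<lambda>b. Z b (Suc t) \<omega>)"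

text \<open>The pulled arm against the arm that the samples alone would select. Subtracting the
  latter leaves the mean unchanged and makes the quantity nearly nonnegative in typical rounds. A
  pull outside \<open>S\<close> contributes 0 to the first sum.\<close>

definition score_gain :: "nat \<Rightarrow> 'w \<Rightarrow> real" where
  "score_gain t \<omega> = (\<Sum>b\<in>S. of_bool (A (Suc t) \<omega> = b) * pn b t \<omega>) - (\<Sum>b\<in>S. of_bool (leader t \<omega> = b) * pn b t \<omega>)"

lemma fin_S [simp]: "finite S" and ne_S: "S \<noteq> {}"
  using S i finite_subset by auto

lemma card_S: "real (card S) \<ge> 1"
  using ne_S by (simp add: Suc_le_eq card_gt_0_iff)

lemma leader_in: "leader t \<omega> \<in> S" and leader_max: "b \<in> S \<Longrightarrow> Z b (Suc t) \<omega> \<le> Z (leader t \<omega>) (Suc t) \<omega>"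
  unfolding leader_def using argmax_sel(1)[OF fin_S ne_S] argmax_sel(2)[OF fin_S ne_S] by auto

lemma abs_pn_le_total: "b \<in> S \<Longrightarrow> \<bar>pn b t \<omega>\<bar> \<le> total_noise t \<omega>"
  unfolding total_noise_def by (rule member_le_sum) auto

lemma total_noise_nonneg: "total_noise t \<omega> \<ge> 0"
  unfolding total_noise_def by (rule sum_nonneg) auto

lemma sum_of_bool_pn: "b \<in> S \<Longrightarrow> (\<Sum>c\<in>S. of_bool (b = c) * pn c t \<omega>) = pn b t \<omega>"
  by (simp add: of_bool_def if_distrib[of "\<lambda>x. x * _"] cong: if_cong)

lemma score_gain_ge_crude: "score_gain t \<omega> \<ge> - (2 * total_noise t \<omega>)"
proof -
  have *: "\<bar>\<Sum>b\<in>S. of_bool (P b) * pn b t \<omega>\<bar> \<le> total_noise t \<omega>" for P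
    unfolding total_noise_def by (rule order_trans[OF sum_abs sum_mono]) (auto simp: abs_mult)
  show ?thesis
    unfolding score_gain_def using *[of "\<lambda>b. A (Suc t) \<omega> = b"] *[of "\<lambda>b. leader t \<omega> = b"] by linarith
qed

text \<open>The pulled arm beats the leader up to the error, which settles the case without a race.
  In a race the leader is \<open>j\<close>, and no sample in \<open>S\<close> exceeds that of
  \<open>i\<close> by more than \<open>\<eta> / 2\<close>. So the pulled noise sum is at least that
  of \<open>i\<close> less \<open>\<eta> / 2 * H\<close>, which is still
  \<open>\<eta> / 2 * H\<close> above that of \<open>j\<close>, up to the error.\<close>

lemma score_gain_ge:
  assumes \<omega>: "\<omega> \<in> space M" and bal: "balanced \<delta> t \<omega>" and small: "\<not> large_sample L t \<omega>"
    and \<delta>: "0 < \<delta>" "\<delta> \<le> 1 / 2" and L: "L > 0" and H: "sqrt (real t) \<le> H"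
    and vu: "v - u \<le> \<eta> / 2" and \<eta>: "\<eta> > 0"
  shows "score_gain t \<omega> \<ge> \<eta> / 2 * H * of_bool (pn i t \<omega> - pn j t \<omega> \<ge> \<eta> * H \<and> close_race u x v t \<omega>)
    - (4 * \<delta> * total_noise t \<omega> + 4 * \<delta> * L * H + 4 * \<delta> * \<bar>\<mu>s\<bar> / \<sigma>)"
proof -
  define s where "s = real t / real (card S)"
  define k where "k = A (Suc t) \<omega>"
  define err where "err = 4 * \<delta> * total_noise t \<omega> + 4 * \<delta> * L * H + 4 * \<delta> * \<bar>\<mu>s\<bar> / \<sigma>"
  have k: "k \<in> S" using bal by (simp add: balanced_def k_def)
  have s0: "s \<ge> 0" by (simp add: s_def)
  have H0: "H \<ge> 0" using order_trans[OF _ H] by simp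
  have sH: "sqrt s \<le> H"
  proof -
    have "s \<le> real t" unfolding s_def using card_S by (simp add: divide_le_eq mult_le_cancel_left1)
    then show ?thesis using H by (meson order_trans real_sqrt_le_mono)
  qed
  have cmp: "pn k t \<omega> - pn b t \<omega> \<ge> sqrt s * (Z b (Suc t) \<omega> - Z k (Suc t) \<omega>) - err" if b: "b \<in> S" for b
  proof -
    have "pn k t \<omega> - pn b t \<omega> \<ge> sqrt s * (Z b (Suc t) \<omega> - Z k (Suc t) \<omega>)
      - 2 * \<delta> * (\<bar>pn k t \<omega>\<bar> + \<bar>pn b t \<omega>\<bar>) - 4 * \<delta> * L * sqrt s - 4 * \<delta> * \<bar>\<mu>s\<bar> / \<sigma>"
      by (rule pulled_imp_score_ge)
         (use \<omega> S b k bal small \<delta> \<mu>s in \<open>auto simp: k_def balanced_def s_def large_sample_def not_less\<close>)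
    moreover have "2 * \<delta> * (\<bar>pn k t \<omega>\<bar> + \<bar>pn b t \<omega>\<bar>) \<le> 4 * \<delta> * total_noise t \<omega>"
    proof -
      have "2 * \<delta> * (\<bar>pn k t \<omega>\<bar> + \<bar>pn b t \<omega>\<bar>) \<le> 2 * \<delta> * (total_noise t \<omega> + total_noise t \<omega>)"
        using \<delta> by (intro mult_left_mono add_mono abs_pn_le_total k b) auto
      then show ?thesis by simp
    qed
    moreover have "4 * \<delta> * L * sqrt s \<le> 4 * \<delta> * L * H" using \<delta> L by (intro mult_left_mono sH) auto
    moreover have "p \<ge> w - (x' + y' + z)" if "p \<ge> w - x - y - z" "x \<le> x'" "y \<le> y'" for p w x x' y y' z :: real
      using that by linarith
    ultimately show ?thesis unfolding err_def by blast
  qed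
  have gain: "score_gain t \<omega> = pn k t \<omega> - pn (leader t \<omega>) t \<omega>"
    unfolding score_gain_def k_def[symmetric] by (simp add: sum_of_bool_pn k leader_in)
  have lead: "sqrt s * (Z (leader t \<omega>) (Suc t) \<omega> - Z k (Suc t) \<omega>) \<ge> 0"
    using leader_max[OF k, of t \<omega>] s0 by simp
  show ?thesis
  proof (cases "pn i t \<omega> - pn j t \<omega> \<ge> \<eta> * H \<and> close_race u x v t \<omega>")
    case True
    have race: "Z b (Suc t) \<omega> \<in> (if b = j then {x<..v} else if b = i then {u<..x} else {..x})" if "b \<in> S" for b
      using True S that unfolding close_race_def by blast
    have Zj: "x < Z j (Suc t) \<omega>" "Z j (Suc t) \<omega> \<le> v" and Zi: "u < Z i (Suc t) \<omega>"
      using race[OF j] race[OF i] ij by auto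
    \<comment> \<open>Only \<open>j\<close> has a sample above \<open>x\<close>, so no other arm can
      have the largest one.\<close>
    have "leader t \<omega> = j"
    proof (rule ccontr)
      assume "leader t \<omega> \<noteq> j"
      then have "Z (leader t \<omega>) (Suc t) \<omega> \<le> x" using race[OF leader_in, of t \<omega>] by (auto split: if_splits)
      then show False using leader_max[OF j, of t \<omega>] Zj by linarith
    qed
    then have Zk: "Z k (Suc t) \<omega> \<le> v" using leader_max[OF k, of t \<omega>] Zj by simp
    have "sqrt s * (Z i (Suc t) \<omega> - Z k (Suc t) \<omega>) \<ge> sqrt s * (- (\<eta> / 2))"
      using Zi Zk vu s0 by (intro mult_left_mono) auto
    moreover have "sqrt s * (\<eta> / 2) \<le> H * (\<eta> / 2)" using sH \<eta> by (intro mult_right_mono) auto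
    ultimately have "pn k t \<omega> - pn i t \<omega> \<ge> - (H * (\<eta> / 2)) - err" using cmp[OF i] by linarith
    moreover have "H * (\<eta> / 2) = \<eta> / 2 * H" "\<eta> * H = \<eta> / 2 * H + \<eta> / 2 * H" by simp_all
    ultimately have "pn k t \<omega> - pn j t \<omega> \<ge> \<eta> / 2 * H - err" using True by linarith
    then show ?thesis using True gain \<open>leader t \<omega> = j\<close> by (simp add: err_def)
  next
    case False
    then show ?thesis using cmp[OF leader_in, of t \<omega>] lead gain by (simp only: err_def of_bool_eq)
  qed
qed

text \<open>Makes the bound unconditional, so that expectations can be taken. Exceptional rounds use
  the crude bound truncated at \<open>\<Lambda> * H\<close>, ordinary rounds truncate the error at
  \<open>H\<close>; either way only the second moment of \<open>total_noise\<close> enters.\<close>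

lemma score_gain_lower_bound:
  assumes \<omega>: "\<omega> \<in> space M"
    and \<delta>: "0 < \<delta>" "\<delta> \<le> 1 / 2" and L: "L > 0" and \<Lambda>: "\<Lambda> > 0" and H: "sqrt (real t) \<le> H" "H > 0"
    and vu: "v - u \<le> \<eta> / 2" and \<eta>: "\<eta> > 0"
  shows "\<eta> / 2 * H * of_bool (pn i t \<omega> - pn j t \<omega> \<ge> \<eta> * H \<and> close_race u x v t \<omega>)
      \<le> score_gain t \<omega> + (4 * \<delta> * H + 4 * \<delta> * L * H + 4 * \<delta> * \<bar>\<mu>s\<bar> / \<sigma>)
      + (2 * \<Lambda> + \<eta> / 2) * H * (of_bool (\<not> balanced \<delta> t \<omega>) + of_bool (large_sample L t \<omega>))
      + (4 * \<delta> / H + 2 / (\<Lambda> * H)) * (total_noise t \<omega>)\<^sup>2"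
proof -
  let ?V = "total_noise t \<omega>" and ?g = "\<eta> / 2 * H * of_bool (pn i t \<omega> - pn j t \<omega> \<ge> \<eta> * H \<and> close_race u x v t \<omega>)"
  have sp: "0 \<le> 4 * \<delta> * L * H" "0 \<le> 4 * \<delta> * \<bar>\<mu>s\<bar> / \<sigma>" "0 \<le> (2 * \<Lambda> + \<eta> / 2) * H" "0 \<le> 4 * \<delta> * H" "0 \<le> 4 * \<delta> / H * ?V\<^sup>2"
    "0 \<le> 2 / (\<Lambda> * H) * ?V\<^sup>2"
    using \<delta> L H \<Lambda> \<eta> sigma_pos by (auto simp: less_imp_le)
  have t1: "4 * \<delta> * ?V \<le> 4 * \<delta> * H + 4 * \<delta> / H * ?V\<^sup>2"
    using mult_left_mono[OF truncate_le[OF total_noise_nonneg H(2)], of "4 * \<delta>" t \<omega>] \<delta> by (simp add: distrib_left)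
  have t2: "2 * ?V \<le> 2 * \<Lambda> * H + 2 / (\<Lambda> * H) * ?V\<^sup>2"
    using truncate_le[OF total_noise_nonneg, of "\<Lambda> * H" t \<omega>] \<Lambda> H by simp
  have dis: "(4 * \<delta> / H + 2 / (\<Lambda> * H)) * ?V\<^sup>2 = 4 * \<delta> / H * ?V\<^sup>2 + 2 / (\<Lambda> * H) * ?V\<^sup>2"
    "(2 * \<Lambda> + \<eta> / 2) * H = 2 * \<Lambda> * H + \<eta> / 2 * H"
    by (simp_all only: distrib_right)
  show ?thesis
  proof (cases "balanced \<delta> t \<omega> \<and> \<not> large_sample L t \<omega>")
    case True
    then have "score_gain t \<omega> \<ge> ?g - (4 * \<delta> * ?V + 4 * \<delta> * L * H + 4 * \<delta> * \<bar>\<mu>s\<bar> / \<sigma>)"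
      by (intro score_gain_ge[OF \<omega> _ _ \<delta> L H(1) vu \<eta>]) auto
    then show ?thesis using True t1 sp unfolding dis by simp
  next
    case False
    then have "(1::real) \<le> of_bool (\<not> balanced \<delta> t \<omega>) + of_bool (large_sample L t \<omega>)" by auto
    from mult_left_mono[OF this sp(3)]
    have 1: "(2 * \<Lambda> + \<eta> / 2) * H \<le> (2 * \<Lambda> + \<eta> / 2) * H * (of_bool (\<not> balanced \<delta> t \<omega>) + of_bool (large_sample L t \<omega>))"
      by simp
    have 2: "?g \<le> \<eta> / 2 * H" using \<eta> H by simp
    show ?thesis using 1 2 score_gain_ge_crude[of t \<omega>] t2 sp unfolding dis by linarith
  qed
qed

lemma balanced_pred: "Measurable.pred M (balanced \<delta> t)"
proof -
  have 1: "Measurable.pred M (\<lambda>\<omega>. A (Suc t) \<omega> \<in> S)" by (rule pred_sets2[OF _ pull_measurable_M]) simp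
  have 2: "Measurable.pred M (\<lambda>\<omega>. \<forall>b\<in>S. \<bar>real (cnt b t \<omega>) - real t / real (card S)\<bar> \<le> \<delta> * (real t / real (card S)))"
  proof (rule pred_intros_finite)
    fix b
    note [measurable] = cnt_real_measurable_M[of b t]
    show "Measurable.pred M (\<lambda>\<omega>. \<bar>real (cnt b t \<omega>) - real t / real (card S)\<bar> \<le> \<delta> * (real t / real (card S)))"
      by measurable
  qed simp
  show ?thesis unfolding balanced_def[abs_def] by (intro pred_intros_logic(3) 1 2) simp
qed

lemma large_sample_pred: "Measurable.pred M (large_sample L t)"
  unfolding large_sample_def[abs_def]
proof (rule pred_intros_finite)
  fix b assume "b \<in> S"
  then have "b \<in> {1..K}" using S by auto
  note [measurable] = sample_rv[OF this, of "Suc t"]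
  show "Measurable.pred M (\<lambda>\<omega>. \<bar>Z b (Suc t) \<omega>\<bar> > L)" by measurable
qed simp

lemma prob_large_sample:
  "prob {\<omega> \<in> space M. large_sample L t \<omega>} \<le> real (card S) * measure D {z. \<bar>z\<bar> > L}"
proof -
  have Lb: "{z::real. \<bar>z\<bar> > L} \<in> sets borel" by measurable
  have ms: "{\<omega> \<in> space M. Z b (Suc t) \<omega> \<in> {z. \<bar>z\<bar> > L}} \<in> sets M" if "b \<in> S" for b
    using that S by (intro predE pred_sets2[OF Lb sample_rv]) auto
  have "{\<omega> \<in> space M. large_sample L t \<omega>} = (\<Union>b\<in>S. {\<omega> \<in> space M. Z b (Suc t) \<omega> \<in> {z. \<bar>z\<bar> > L}})"
    by (auto simp: large_sample_def)
  then have "prob {\<omega> \<in> space M. large_sample L t \<omega>} \<le> (\<Sum>b\<in>S. prob {\<omega> \<in> space M. Z b (Suc t) \<omega> \<in> {z. \<bar>z\<bar> > L}})"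
    using finite_measure_subadditive_finite[OF fin_S, of "\<lambda>b. {\<omega> \<in> space M. Z b (Suc t) \<omega> \<in> {z. \<bar>z\<bar> > L}}"] ms by auto
  also have "\<dots> = (\<Sum>b\<in>S. measure D {z. \<bar>z\<bar> > L})"
    using S by (intro sum.cong refl prob_sample Lb) auto
  finally show ?thesis by simp
qed

lemma close_race_row: "{\<omega> \<in> space M. close_race u x v t \<omega>} \<in> sets (gen (row_index K (Suc t)))"
proof -
  have "Measurable.pred (gen (row_index K (Suc t))) (close_race u x v t)"
    unfolding close_race_def[abs_def]
    by (intro pred_intros_finite pred_sets2[OF _ sample_row_measurable]) auto
  from predE[OF this] show ?thesis unfolding space_gen_algebra .
qed

definition race_prob :: "real \<Rightarrow> real \<Rightarrow> real \<Rightarrow> real" where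
  "race_prob u x v = (\<Prod>b\<in>{1..K}. measure D (if b = j then {x<..v} else if b = i then {u<..x} else {..x}))"

lemma prob_close_race: "prob {\<omega> \<in> space M. close_race u x v t \<omega>} = race_prob u x v"
  unfolding close_race_def race_prob_def by (rule prob_row[OF K_ge_1]) auto

lemma race_prob_pos:
  assumes "u < x" "x < v" "cdf D u < cdf D x" "cdf D x < cdf D v"
  shows "race_prob u x v > 0"
  unfolding race_prob_def
proof (rule prod_pos)
  fix b
  have "measure D {x<..v} > 0" "measure D {u<..x} > 0" "measure D {..x} > 0"
    using law.cdf_diff_eq[of x v] law.cdf_diff_eq[of u x] law.cdf_pos[of x] assms by (simp_all add: cdf_def)
  then show "measure D (if b = j then {x<..v} else if b = i then {u<..x} else {..x}) > 0" by simp
qed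

lemma lead_hist: "{\<omega> \<in> space M. pn i t \<omega> - pn j t \<omega> \<ge> y} \<in> sets (gen (hist_index K t))"
proof -
  note [measurable] = pn_measurable[of i t] pn_measurable[of j t]
  have "Measurable.pred (gen (hist_index K t)) (\<lambda>\<omega>. pn i t \<omega> - pn j t \<omega> \<ge> y)" by measurable
  from predE[OF this] show ?thesis unfolding space_gen_algebra .
qed

text \<open>The lead belongs to the history and the race to the fresh samples. Frequent leads
  therefore force frequent gains, at a rate \<open>race_prob\<close> that does not depend on
  \<open>t\<close>.\<close>

lemma prob_lead_race:
  "prob {\<omega> \<in> space M. pn i t \<omega> - pn j t \<omega> \<ge> y \<and> close_race u x v t \<omega>}
    = prob {\<omega> \<in> space M. pn i t \<omega> - pn j t \<omega> \<ge> y} * race_prob u x v"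
proof -
  have "prob ({\<omega> \<in> space M. pn i t \<omega> - pn j t \<omega> \<ge> y} \<inter> {\<omega> \<in> space M. close_race u x v t \<omega>})
    = prob {\<omega> \<in> space M. pn i t \<omega> - pn j t \<omega> \<ge> y} * prob {\<omega> \<in> space M. close_race u x v t \<omega>}"
    by (rule prob_gen_algebra_Int[OF indep' index_subset(1) index_subset(3) index_disjoint(1) lead_hist close_race_row]) simp
  moreover have "{\<omega> \<in> space M. pn i t \<omega> - pn j t \<omega> \<ge> y} \<inter> {\<omega> \<in> space M. close_race u x v t \<omega>}
    = {\<omega> \<in> space M. pn i t \<omega> - pn j t \<omega> \<ge> y \<and> close_race u x v t \<omega>}" by auto
  ultimately show ?thesis by (simp add: prob_close_race)
qed

lemma lead_race_pred: "Measurable.pred M (\<lambda>\<omega>. pn i t \<omega> - pn j t \<omega> \<ge> y \<and> close_race u x v t \<omega>)"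
proof -
  have "Measurable.pred M (close_race u x v t)"
    unfolding close_race_def[abs_def]
    by (intro pred_intros_finite pred_sets2[OF _ sample_rv]) auto
  moreover have "Measurable.pred M (\<lambda>\<omega>. pn i t \<omega> - pn j t \<omega> \<ge> y)"
  proof -
    note [measurable] = pn_measurable_M[of i t] pn_measurable_M[of j t]
    show ?thesis by measurable
  qed
  ultimately show ?thesis by (intro pred_intros_logic(3))
qed

lemma total_noise_measurable_M: "total_noise t \<in> borel_measurable M"
  unfolding total_noise_def[abs_def]
proof (rule borel_measurable_sum)
  fix b
  note [measurable] = pn_measurable_M[of b t]
  show "(\<lambda>\<omega>. \<bar>pn b t \<omega>\<bar>) \<in> borel_measurable M" by measurable
qed

lemma total_noise_sq:
  shows "integrable M (\<lambda>\<omega>. (total_noise t \<omega>)\<^sup>2)"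
    and "expectation (\<lambda>\<omega>. (total_noise t \<omega>)\<^sup>2) \<le> (real (card S))\<^sup>2 * real t"
proof -
  have le: "(total_noise t \<omega>)\<^sup>2 \<le> (\<Sum>b\<in>S. (pn b t \<omega>)\<^sup>2) * real (card S)" for \<omega>
    using sum_squared_le_sum_of_squares[where I = S and f = "\<lambda>b. \<bar>pn b t \<omega>\<bar>"] by (simp add: total_noise_def)
  have int: "integrable M (\<lambda>\<omega>. (\<Sum>b\<in>S. (pn b t \<omega>)\<^sup>2) * real (card S))"
    using integrable_pn_sq by auto
  show i: "integrable M (\<lambda>\<omega>. (total_noise t \<omega>)\<^sup>2)"
  proof (rule Bochner_Integration.integrable_bound[OF int])
    show "(\<lambda>\<omega>. (total_noise t \<omega>)\<^sup>2) \<in> borel_measurable M"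
      using total_noise_measurable_M by (rule borel_measurable_power)
    show "AE \<omega> in M. norm ((total_noise t \<omega>)\<^sup>2) \<le> norm ((\<Sum>b\<in>S. (pn b t \<omega>)\<^sup>2) * real (card S))"
      using le by (auto intro!: AE_I2 simp: abs_mult sum_nonneg)
  qed
  have "expectation (\<lambda>\<omega>. (total_noise t \<omega>)\<^sup>2) \<le> expectation (\<lambda>\<omega>. (\<Sum>b\<in>S. (pn b t \<omega>)\<^sup>2) * real (card S))"
    by (rule integral_mono[OF i int le])
  also have "\<dots> = (\<Sum>b\<in>S. expectation (\<lambda>\<omega>. (pn b t \<omega>)\<^sup>2)) * real (card S)"
    using integrable_pn_sq by simp
  also have "\<dots> \<le> (\<Sum>b\<in>S. real t) * real (card S)"
    by (intro mult_right_mono sum_mono expectation_pn_sq_le) simp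
  finally show "expectation (\<lambda>\<omega>. (total_noise t \<omega>)\<^sup>2) \<le> (real (card S))\<^sup>2 * real t"
    by (simp add: power2_eq_square mult_ac)
qed

text \<open>
  As \<open>pn\<close> has mean zero, \<open>cnt b t\<close> may be replaced by \<open>cnt b t - real t / real (card S)\<close> here.
\<close>

definition noise_count_corr :: "nat \<Rightarrow> real" where
  "noise_count_corr t = (\<Sum>b\<in>S. expectation (\<lambda>\<omega>. real (cnt b t \<omega>) * pn b t \<omega>))"

lemma integrable_score_gain: "integrable M (score_gain t)"
  unfolding score_gain_def[abs_def] leader_def
  by (intro Bochner_Integration.integrable_diff Bochner_Integration.integrable_sum integrable_pulled_pn
      expectation_row_selected_pn(1) fin_S S)

lemma expectation_score_gain: "expectation (score_gain t) = noise_count_corr (Suc t) - noise_count_corr t"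
proof -
  have "expectation (score_gain t) = expectation (\<lambda>\<omega>. \<Sum>b\<in>S. of_bool (A (Suc t) \<omega> = b) * pn b t \<omega>)"
    unfolding score_gain_def[abs_def] leader_def
      Bochner_Integration.integral_diff[OF Bochner_Integration.integrable_sum[OF integrable_pulled_pn]
        expectation_row_selected_pn(1)[OF fin_S S]]
      expectation_row_selected_pn(2)[OF fin_S S] by (rule diff_zero)
  also have "\<dots> = (\<Sum>b\<in>S. expectation (\<lambda>\<omega>. of_bool (A (Suc t) \<omega> = b) * pn b t \<omega>))"
    by (rule Bochner_Integration.integral_sum) (rule integrable_pulled_pn)
  also have "\<dots> = noise_count_corr (Suc t) - noise_count_corr t"
    unfolding noise_count_corr_def expectation_pn_cnt_Suc by (simp only: sum.distrib add_diff_cancel_left')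
  finally show ?thesis .
qed

text \<open>Everything is measured in units of \<open>H = sqrt T\<close>: the second moment of
  \<open>total_noise\<close> is at most \<open>m\<^sup>2 * H\<^sup>2\<close>, so truncation at
  multiples of \<open>H\<close> loses only multiples of \<open>H\<close>.\<close>

lemma lead_race_step:
  assumes \<delta>: "0 < \<delta>" "\<delta> \<le> 1 / 2" and L: "L > 0" and \<Lambda>: "\<Lambda> > 0" and tT: "t < T"
    and vu: "v - u \<le> \<eta> / 2" and \<eta>: "\<eta> > 0"
  defines "m \<equiv> real (card S)"
  shows "\<eta> / 2 * sqrt (real T) * (race_prob u x v * prob {\<omega> \<in> space M. pn i t \<omega> - pn j t \<omega> \<ge> \<eta> * sqrt (real T)})
      \<le> noise_count_corr (Suc t) - noise_count_corr t
      + sqrt (real T) * (4 * \<delta> * (1 + L + \<bar>\<mu>s\<bar> / \<sigma> + m\<^sup>2) + 2 * m\<^sup>2 / \<Lambda>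
          + (2 * \<Lambda> + \<eta> / 2) * (prob {\<omega> \<in> space M. \<not> balanced \<delta> t \<omega>} + m * measure D {z. \<bar>z\<bar> > L}))"
proof -
  define H where "H = sqrt (real T)"
  have T1: "real T \<ge> 1" using tT by simp
  have H: "sqrt (real t) \<le> H" "H \<ge> 1" "H * H = real T" using tT T1 by (simp_all add: H_def)
  then have H0: "H > 0" by linarith
  let ?P = "\<lambda>\<omega>. pn i t \<omega> - pn j t \<omega> \<ge> \<eta> * H \<and> close_race u x v t \<omega>"
  let ?nb = "\<lambda>\<omega>. \<not> balanced \<delta> t \<omega>" and ?ls = "large_sample L t"
  have nbp: "Measurable.pred M ?nb" by (rule pred_intros_logic(2)[OF balanced_pred])
  let ?c1 = "4 * \<delta> * H + 4 * \<delta> * L * H + 4 * \<delta> * \<bar>\<mu>s\<bar> / \<sigma>"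
  let ?c2 = "(2 * \<Lambda> + \<eta> / 2) * H" and ?c3 = "4 * \<delta> / H + 2 / (\<Lambda> * H)"
  have c: "?c2 \<ge> 0" "?c3 \<ge> 0" using \<Lambda> \<eta> H0 \<delta> by simp_all
  note int = integrable_of_bool[OF lead_race_pred[where y = "\<eta> * H" and u = u and x = x and v = v and t = t]] integrable_score_gain[of t]
    integrable_of_bool[OF nbp] integrable_of_bool[OF large_sample_pred[of L t]] total_noise_sq(1)[of t]
  have "\<eta> / 2 * H * prob {\<omega> \<in> space M. ?P \<omega>} = expectation (\<lambda>\<omega>. \<eta> / 2 * H * of_bool (?P \<omega>))"
    unfolding prob_eq_expectation_of_bool[OF lead_race_pred] by (rule integral_mult_right_zero[symmetric])
  also have "\<dots> \<le> expectation (\<lambda>\<omega>. score_gain t \<omega> + ?c1 + ?c2 * (of_bool (?nb \<omega>) + of_bool (?ls \<omega>)) + ?c3 * (total_noise t \<omega>)\<^sup>2)"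
  proof (rule integral_mono)
    show "integrable M (\<lambda>\<omega>. \<eta> / 2 * H * of_bool (?P \<omega>))" by (intro integrable_mult_right int(1))
    show "integrable M (\<lambda>\<omega>. score_gain t \<omega> + ?c1 + ?c2 * (of_bool (?nb \<omega>) + of_bool (?ls \<omega>)) + ?c3 * (total_noise t \<omega>)\<^sup>2)"
      by (intro Bochner_Integration.integrable_add integrable_mult_right int integrable_const)
  qed (rule score_gain_lower_bound[OF _ \<delta> L \<Lambda> H(1) H0 vu \<eta>])
  also have "\<dots> = expectation (score_gain t) + ?c1
      + ?c2 * (prob {\<omega> \<in> space M. ?nb \<omega>} + prob {\<omega> \<in> space M. ?ls \<omega>}) + ?c3 * expectation (\<lambda>\<omega>. (total_noise t \<omega>)\<^sup>2)"
    unfolding prob_eq_expectation_of_bool[OF nbp] prob_eq_expectation_of_bool[OF large_sample_pred]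
    using int(2-5) by (simp add: prob_space del: of_bool_not_iff)
  also have "\<dots> \<le> expectation (score_gain t) + H * (4 * \<delta> * (1 + L + \<bar>\<mu>s\<bar> / \<sigma>))
      + ?c2 * (prob {\<omega> \<in> space M. ?nb \<omega>} + m * measure D {z. \<bar>z\<bar> > L}) + H * (4 * \<delta> * m\<^sup>2 + 2 * m\<^sup>2 / \<Lambda>)"
  proof (intro add_mono order_refl mult_left_mono c)
    have "4 * \<delta> * \<bar>\<mu>s\<bar> / \<sigma> * 1 \<le> 4 * \<delta> * \<bar>\<mu>s\<bar> / \<sigma> * H"
      using H \<delta> sigma_pos by (intro mult_left_mono) auto
    then show "?c1 \<le> H * (4 * \<delta> * (1 + L + \<bar>\<mu>s\<bar> / \<sigma>))" by (simp add: algebra_simps)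
    show "prob {\<omega> \<in> space M. ?ls \<omega>} \<le> m * measure D {z. \<bar>z\<bar> > L}"
      unfolding m_def by (rule prob_large_sample)
    have "expectation (\<lambda>\<omega>. (total_noise t \<omega>)\<^sup>2) \<le> m\<^sup>2 * real t"
      unfolding m_def by (rule total_noise_sq(2))
    also have "\<dots> \<le> m\<^sup>2 * (H * H)" unfolding H(3) using tT by (intro mult_left_mono) auto
    finally have "?c3 * expectation (\<lambda>\<omega>. (total_noise t \<omega>)\<^sup>2) \<le> ?c3 * (m\<^sup>2 * (H * H))"
      by (rule mult_left_mono[OF _ c(2)])
    also have "\<dots> = H * (4 * \<delta> * m\<^sup>2 + 2 * m\<^sup>2 / \<Lambda>)"
      using H0 \<Lambda> by (simp add: field_simps)
    finally show "?c3 * expectation (\<lambda>\<omega>. (total_noise t \<omega>)\<^sup>2) \<le> H * (4 * \<delta> * m\<^sup>2 + 2 * m\<^sup>2 / \<Lambda>)" .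
  qed
  finally show ?thesis
    unfolding prob_lead_race expectation_score_gain H_def[symmetric] by (simp add: algebra_simps)
qed

text \<open>Centring the count at \<open>T / m\<close> is free because \<open>pn\<close> has mean
  zero. After truncation at \<open>\<Lambda> * H\<close> the share deviation pays for the level; in
  the excess it is bounded by 1 and the second moment of \<open>pn\<close> pays.\<close>

lemma noise_count_corr_le:
  assumes \<Lambda>: "\<Lambda> > 0" and T: "T > 0"
  shows "noise_count_corr T \<le> real T * sqrt (real T) *
    (\<Sum>b\<in>S. \<Lambda> * expectation (\<lambda>\<omega>. \<bar>real (cnt b T \<omega>) / real T - 1 / real (card S)\<bar>) + 1 / \<Lambda>)"
  unfolding noise_count_corr_def sum_distrib_left
proof (rule sum_mono)
  fix b
  define H where "H = sqrt (real T)"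
  have H0: "H > 0" and HH: "H * H = real T" using T by (simp_all add: H_def)
  let ?d = "\<lambda>\<omega>. real (cnt b T \<omega>) / real T - 1 / real (card S)"
  have dm: "?d \<in> borel_measurable M"
  proof -
    note [measurable] = cnt_real_measurable_M[of b T]
    show ?thesis by measurable
  qed
  have d1: "\<bar>?d \<omega>\<bar> \<le> 1" for \<omega>
  proof -
    have "0 \<le> real (cnt b T \<omega>) / real T" "real (cnt b T \<omega>) / real T \<le> 1" using cnt_le[of b T \<omega>] T by auto
    moreover have "0 \<le> 1 / real (card S)" "1 / real (card S) \<le> 1" using card_S by auto
    ultimately show ?thesis by linarith
  qed
  have di: "integrable M (\<lambda>\<omega>. \<bar>?d \<omega>\<bar>)"
    by (rule integrable_const_bound[of _ 1]) (use d1 dm in auto)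
  have dpi: "integrable M (\<lambda>\<omega>. ?d \<omega> * pn b T \<omega>)"
    by (rule integrable_bounded_mult[OF dm integrable_pn d1])
  have "expectation (\<lambda>\<omega>. real (cnt b T \<omega>) * pn b T \<omega>)
      = expectation (\<lambda>\<omega>. real T * (?d \<omega> * pn b T \<omega>) + real T / real (card S) * pn b T \<omega>)"
    using T by (intro Bochner_Integration.integral_cong) (auto simp: field_simps)
  also have "\<dots> = real T * expectation (\<lambda>\<omega>. ?d \<omega> * pn b T \<omega>)"
    using dpi integrable_pn[of b T] by (simp add: expectation_pn)
  also have "\<dots> \<le> real T * expectation (\<lambda>\<omega>. \<Lambda> * H * \<bar>?d \<omega>\<bar> + (pn b T \<omega>)\<^sup>2 / (\<Lambda> * H))"
  proof (intro mult_left_mono integral_mono dpi)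
    show "integrable M (\<lambda>\<omega>. \<Lambda> * H * \<bar>?d \<omega>\<bar> + (pn b T \<omega>)\<^sup>2 / (\<Lambda> * H))"
      using di integrable_pn_sq[of b T] by simp
    fix \<omega>
    have "?d \<omega> * pn b T \<omega> \<le> \<bar>?d \<omega>\<bar> * \<bar>pn b T \<omega>\<bar>" by (metis abs_ge_self abs_mult)
    also have "\<dots> \<le> \<bar>?d \<omega>\<bar> * (\<Lambda> * H + (pn b T \<omega>)\<^sup>2 / (\<Lambda> * H))"
      using truncate_le[of "\<bar>pn b T \<omega>\<bar>" "\<Lambda> * H"] \<Lambda> H0 by (intro mult_left_mono) auto
    also have "\<dots> = \<Lambda> * H * \<bar>?d \<omega>\<bar> + \<bar>?d \<omega>\<bar> * ((pn b T \<omega>)\<^sup>2 / (\<Lambda> * H))" by (simp add: algebra_simps)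
    also have "\<bar>?d \<omega>\<bar> * ((pn b T \<omega>)\<^sup>2 / (\<Lambda> * H)) \<le> 1 * ((pn b T \<omega>)\<^sup>2 / (\<Lambda> * H))"
      using \<Lambda> H0 by (intro mult_right_mono d1) auto
    finally show "?d \<omega> * pn b T \<omega> \<le> \<Lambda> * H * \<bar>?d \<omega>\<bar> + (pn b T \<omega>)\<^sup>2 / (\<Lambda> * H)" by simp
  qed simp
  also have "\<dots> = real T * (\<Lambda> * H * expectation (\<lambda>\<omega>. \<bar>?d \<omega>\<bar>) + expectation (\<lambda>\<omega>. (pn b T \<omega>)\<^sup>2) / (\<Lambda> * H))"
    using di integrable_pn_sq[of b T] by simp
  also have "\<dots> \<le> real T * (\<Lambda> * H * expectation (\<lambda>\<omega>. \<bar>?d \<omega>\<bar>) + (H * H) / (\<Lambda> * H))"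
    unfolding HH using expectation_pn_sq_le[of b T] \<Lambda> H0 by (intro mult_left_mono add_left_mono divide_right_mono) auto
  also have "\<dots> = real T * H * (\<Lambda> * expectation (\<lambda>\<omega>. \<bar>?d \<omega>\<bar>) + 1 / \<Lambda>)"
    using H0 \<Lambda> by (simp add: field_simps)
  finally show "expectation (\<lambda>\<omega>. real (cnt b T \<omega>) * pn b T \<omega>)
      \<le> real T * sqrt (real T) * (\<Lambda> * expectation (\<lambda>\<omega>. \<bar>?d \<omega>\<bar>) + 1 / \<Lambda>)" unfolding H_def .
qed

lemma noise_count_corr_0: "noise_count_corr 0 = 0"
  by (simp add: noise_count_corr_def)

text \<open>The increments of \<open>noise_count_corr\<close> telescope from 0. Dividing the sum by
  \<open>T * sqrt T\<close> leaves on the right only terms that become small under balance, for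
  suitable \<open>\<Lambda>\<close>, \<open>L\<close> and \<open>\<delta>\<close>.\<close>

lemma lead_race_average:
  assumes \<delta>: "0 < \<delta>" "\<delta> \<le> 1 / 2" and L: "L > 0" and \<Lambda>: "\<Lambda> > 0" and T: "T > 0"
    and vu: "v - u \<le> \<eta> / 2" and \<eta>: "\<eta> > 0"
  defines "m \<equiv> real (card S)"
  shows "\<eta> / 2 * race_prob u x v * ((\<Sum>t<T. prob {\<omega> \<in> space M. pn i t \<omega> - pn j t \<omega> \<ge> \<eta> * sqrt (real T)}) / real T)
      \<le> (\<Sum>b\<in>S. \<Lambda> * expectation (\<lambda>\<omega>. \<bar>real (cnt b T \<omega>) / real T - 1 / m\<bar>) + 1 / \<Lambda>)
        + (4 * \<delta> * (1 + L + \<bar>\<mu>s\<bar> / \<sigma> + m\<^sup>2) + 2 * m\<^sup>2 / \<Lambda>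
          + (2 * \<Lambda> + \<eta> / 2) * ((\<Sum>t<T. prob {\<omega> \<in> space M. \<not> balanced \<delta> t \<omega>}) / real T + m * measure D {z. \<bar>z\<bar> > L}))"
proof -
  define H where "H = sqrt (real T)"
  have H0: "H > 0" using T by (simp add: H_def)
  define p where "p t = prob {\<omega> \<in> space M. pn i t \<omega> - pn j t \<omega> \<ge> \<eta> * H}" for t
  define q where "q t = prob {\<omega> \<in> space M. \<not> balanced \<delta> t \<omega>}" for t
  define c where "c = 4 * \<delta> * (1 + L + \<bar>\<mu>s\<bar> / \<sigma> + m\<^sup>2) + 2 * m\<^sup>2 / \<Lambda>"
  define d where "d = 2 * \<Lambda> + \<eta> / 2"
  define w where "w = m * measure D {z. \<bar>z\<bar> > L}"
  define R where "R = (\<Sum>b\<in>S. \<Lambda> * expectation (\<lambda>\<omega>. \<bar>real (cnt b T \<omega>) / real T - 1 / m\<bar>) + 1 / \<Lambda>)"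
  have step: "\<eta> / 2 * H * (race_prob u x v * p t) \<le> noise_count_corr (Suc t) - noise_count_corr t
      + H * (c + d * (q t + w))" if "t < T" for t
    using lead_race_step[OF \<delta> L \<Lambda> that vu \<eta>, of x]
    unfolding H_def[symmetric] p_def q_def c_def d_def w_def m_def by (simp only: add.assoc)
  have "(\<Sum>t<T. \<eta> / 2 * H * (race_prob u x v * p t))
      \<le> (\<Sum>t<T. noise_count_corr (Suc t) - noise_count_corr t + H * (c + d * (q t + w)))"
    by (intro sum_mono step) simp
  also have "\<dots> = noise_count_corr T + H * (real T * c + d * (sum q {..<T} + real T * w))"
    by (simp add: sum.distrib sum_lessThan_telescope noise_count_corr_0 sum_distrib_left[symmetric])
  also have "\<dots> \<le> real T * H * R + H * (real T * c + d * (sum q {..<T} + real T * w))"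
    using noise_count_corr_le[OF \<Lambda> T] unfolding R_def H_def m_def by simp
  also have "\<dots> = real T * H * (R + (c + d * (sum q {..<T} / real T + w)))"
    using T by (simp add: field_simps)
  finally have *: "(\<Sum>t<T. \<eta> / 2 * H * (race_prob u x v * p t)) \<le> real T * H * (R + (c + d * (sum q {..<T} / real T + w)))" .
  have "(\<Sum>t<T. \<eta> / 2 * H * (race_prob u x v * p t)) = real T * H * (\<eta> / 2 * race_prob u x v * (sum p {..<T} / real T))"
  proof -
    have "(\<Sum>t<T. \<eta> / 2 * H * (race_prob u x v * p t)) = \<eta> / 2 * H * race_prob u x v * sum p {..<T}"
      by (simp only: sum_distrib_left mult.assoc)
    then show ?thesis using T by simp
  qed
  with * have "real T * H * (\<eta> / 2 * race_prob u x v * (sum p {..<T} / real T)) \<le> real T * H * (R + (c + d * (sum q {..<T} / real T + w)))"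
    by (simp only:)
  moreover have "0 < real T * H" using T H0 by simp
  ultimately have "\<eta> / 2 * race_prob u x v * (sum p {..<T} / real T) \<le> R + (c + d * (sum q {..<T} / real T + w))"
    by (simp only: mult_le_cancel_left_pos)
  then show ?thesis unfolding R_def c_def d_def w_def p_def q_def H_def by (simp only: add.assoc)
qed

end

section \<open>Balanced tied arms have close noise sums\<close>

lemma cesaro_null:
  fixes f :: "nat \<Rightarrow> real"
  assumes "f \<longlonglongrightarrow> 0"
  shows "(\<lambda>T. (\<Sum>t<T. f t) / real T) \<longlonglongrightarrow> 0"
proof (rule LIMSEQ_I)
  fix e :: real assume e: "0 < e"
  obtain N where N: "\<And>t. t \<ge> N \<Longrightarrow> \<bar>f t\<bar> < e / 2"
    using LIMSEQ_D[OF assms, of "e / 2"] e by auto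
  define C where "C = (\<Sum>t<N. \<bar>f t\<bar>)"
  have C: "C \<ge> 0" unfolding C_def by (rule sum_nonneg) auto
  have bound: "(\<Sum>t<T. \<bar>f t\<bar>) \<le> C + e / 2 * real T" for T
  proof (induction T)
    case (Suc T)
    show ?case
    proof (cases "T < N")
      case True
      then have "(\<Sum>t<Suc T. \<bar>f t\<bar>) \<le> C" unfolding C_def by (intro sum_mono2) auto
      moreover have "0 \<le> e / 2 * real (Suc T)" using e by simp
      ultimately show ?thesis by linarith
    next
      case False
      then have "\<bar>f T\<bar> < e / 2" using N by simp
      moreover have "e / 2 * real (Suc T) = e / 2 * real T + e / 2" by (simp add: field_simps)
      ultimately show ?thesis using Suc unfolding sum.lessThan_Suc by linarith
    qed
  qed (use C in simp)
  obtain T0 where T0: "\<And>T. T \<ge> T0 \<Longrightarrow> C / real T < e / 2"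
  proof -
    have "(\<lambda>T. C / real T) \<longlonglongrightarrow> 0" by real_asymp
    then have "eventually (\<lambda>T. C / real T < e / 2) sequentially" by (rule order_tendstoD) (use e in simp)
    then show ?thesis using that unfolding eventually_sequentially by blast
  qed
  show "\<exists>no. \<forall>T\<ge>no. norm ((\<Sum>t<T. f t) / real T - 0) < e"
  proof (intro exI[of _ "max T0 1"] allI impI)
    fix T assume T: "T \<ge> max T0 1"
    then have T1: "real T > 0" by simp
    have "\<bar>\<Sum>t<T. f t\<bar> \<le> C + e / 2 * real T" using sum_abs bound by (rule order_trans)
    then have "\<bar>\<Sum>t<T. f t\<bar> / real T \<le> (C + e / 2 * real T) / real T" using T1 by (intro divide_right_mono) auto
    also have "\<dots> = C / real T + e / 2" using T1 by (simp add: add_divide_distrib)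
    also have "C / real T + e / 2 < e"
    proof -
      have "C / real T < e / 2" using T by (intro T0) simp
      then show ?thesis by linarith
    qed
    finally show "norm ((\<Sum>t<T. f t) / real T - 0) < e" using T1 by simp
  qed
qed

lemma (in sampling_law) two_sided_tail_null: "((\<lambda>L. measure D {z. \<bar>z\<bar> > L}) \<longlongrightarrow> 0) at_top"
proof (rule tendsto_sandwich[OF _ _ tendsto_const])
  have "((\<lambda>L. cdf D (- L)) \<longlongrightarrow> 0) at_top"
    using cdf_lim_at_bot by (simp add: filterlim_at_bot_mirror)
  from tendsto_add[OF ccdf_lim_at_top this] show "((\<lambda>L. ccdf D L + cdf D (- L)) \<longlongrightarrow> 0) at_top" by simp
  show "\<forall>\<^sub>F L in at_top. measure D {z. \<bar>z\<bar> > L} \<le> ccdf D L + cdf D (- L)"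
  proof (rule always_eventually, rule allI)
    fix L
    have "measure D {z. \<bar>z\<bar> > L} \<le> measure D ({L<..} \<union> {..- L})"
      by (intro finite_measure_mono) auto
    also have "\<dots> \<le> measure D {L<..} + measure D {..- L}" by (intro measure_Un_le) auto
    finally show "measure D {z. \<bar>z\<bar> > L} \<le> ccdf D L + cdf D (- L)" by (simp add: ccdf_eq cdf_def)
  qed
qed simp

context tied_arms
begin

context
  assumes balance: "\<And>b e. b \<in> S \<Longrightarrow> e > 0 \<Longrightarrow>
    (\<lambda>T. prob {\<omega> \<in> space M. \<bar>real (cnt b T \<omega>) / real T - 1 / real (card S)\<bar> > e}) \<longlonglongrightarrow> 0"
begin

lemma share_deviation_bounds:
  "\<bar>real (cnt b T \<omega>) / real T - 1 / real (card S)\<bar> \<le> 1"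
proof -
  have "0 \<le> real (cnt b T \<omega>) / real T" "real (cnt b T \<omega>) / real T \<le> 1"
    using cnt_le[of b T \<omega>] by (auto simp: divide_le_eq_1)
  moreover have "0 \<le> 1 / real (card S)" "1 / real (card S) \<le> 1" using card_S by auto
  ultimately show ?thesis by linarith
qed

lemma share_deviation_measurable:
  "(\<lambda>\<omega>. real (cnt b T \<omega>) / real T - 1 / real (card S)) \<in> borel_measurable M"
proof -
  note [measurable] = cnt_real_measurable_M[of b T]
  show ?thesis by measurable
qed

lemma integrable_share_deviation: "integrable M (\<lambda>\<omega>. real (cnt b T \<omega>) / real T - 1 / real (card S))"
  by (rule integrable_const_bound[of _ 1]) (use share_deviation_bounds share_deviation_measurable in auto)

lemma share_deviation_pred: "Measurable.pred M (\<lambda>\<omega>. \<bar>real (cnt b T \<omega>) / real T - 1 / real (card S)\<bar> > e)"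
proof -
  note [measurable] = share_deviation_measurable[of b T]
  show ?thesis by measurable
qed

text \<open>Shares deviate by at most 1, so convergence in probability already gives convergence in
  mean.\<close>

lemma expected_share_deviation:
  assumes b: "b \<in> S"
  shows "(\<lambda>T. expectation (\<lambda>\<omega>. \<bar>real (cnt b T \<omega>) / real T - 1 / real (card S)\<bar>)) \<longlonglongrightarrow> 0"
proof (rule tendsto_zero_by_slack)
  fix \<delta> :: real assume \<delta>: "\<delta> > 0"
  let ?d = "\<lambda>T \<omega>. \<bar>real (cnt b T \<omega>) / real T - 1 / real (card S)\<bar>"
  have "expectation (?d T) \<le> \<delta> + prob {\<omega> \<in> space M. ?d T \<omega> > \<delta>}" for T
  proof -
    have "expectation (?d T) \<le> expectation (\<lambda>\<omega>. \<delta> + of_bool (?d T \<omega> > \<delta>))"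
    proof (rule integral_mono)
      show "integrable M (?d T)" by (intro integrable_abs integrable_share_deviation)
      show "integrable M (\<lambda>\<omega>. \<delta> + of_bool (?d T \<omega> > \<delta>) :: real)"
        by (intro Bochner_Integration.integrable_add integrable_of_bool[OF share_deviation_pred]) simp
      show "?d T \<omega> \<le> \<delta> + of_bool (?d T \<omega> > \<delta>)" for \<omega>
        using share_deviation_bounds[of b T \<omega>] \<delta> by (cases "?d T \<omega> > \<delta>") (simp_all del: abs_le_iff)
    qed
    also have "\<dots> = \<delta> + prob {\<omega> \<in> space M. ?d T \<omega> > \<delta>}"
      unfolding prob_eq_expectation_of_bool[OF share_deviation_pred]
      by (subst Bochner_Integration.integral_add) (simp_all add: integrable_of_bool[OF share_deviation_pred] prob_space)
    finally show ?thesis .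
  qed
  then show "\<exists>h. h \<longlonglongrightarrow> 0 \<and> eventually (\<lambda>T. expectation (?d T) \<le> \<delta> + h T) sequentially"
    using balance[OF b \<delta>] by (intro exI[of _ "\<lambda>T. prob {\<omega> \<in> space M. ?d T \<omega> > \<delta>}"]) auto
qed (auto intro!: Bochner_Integration.integral_nonneg)

lemma outside_pred: "Measurable.pred M (\<lambda>\<omega>. A (Suc t) \<omega> \<notin> S)"
  by (rule pred_intros_logic(2)[OF pred_sets2[OF _ pull_measurable_M]]) simp

text \<open>The number of pulls outside \<open>S\<close> is the sum over \<open>S\<close> of the
  shortfalls \<open>T / m - cnt\<close>.\<close>

lemma outside_average: "(\<lambda>T. (\<Sum>t<T. prob {\<omega> \<in> space M. A (Suc t) \<omega> \<notin> S}) / real T) \<longlonglongrightarrow> 0"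
proof (rule tendsto_sandwich[OF _ _ tendsto_const])
  let ?e = "\<lambda>b T. expectation (\<lambda>\<omega>. \<bar>real (cnt b T \<omega>) / real T - 1 / real (card S)\<bar>)"
  show "(\<lambda>T. \<Sum>b\<in>S. ?e b T) \<longlonglongrightarrow> 0"
    using tendsto_sum[of S ?e "\<lambda>_. 0" sequentially] expected_share_deviation by simp
  show "\<forall>\<^sub>F T in sequentially. 0 \<le> (\<Sum>t<T. prob {\<omega> \<in> space M. A (Suc t) \<omega> \<notin> S}) / real T"
    by (intro always_eventually allI divide_nonneg_nonneg sum_nonneg) auto
  show "\<forall>\<^sub>F T in sequentially. (\<Sum>t<T. prob {\<omega> \<in> space M. A (Suc t) \<omega> \<notin> S}) / real T \<le> (\<Sum>b\<in>S. ?e b T)"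
    using eventually_gt_at_top[of 0]
  proof eventually_elim
    case (elim T)
    have count: "(\<Sum>t<T. of_bool (A (Suc t) \<omega> \<notin> S)) = real T - (\<Sum>b\<in>S. real (cnt b T \<omega>))" for T \<omega>
    proof (induction T)
      case (Suc T)
      have "(\<Sum>b\<in>S. of_bool (A (Suc T) \<omega> = b)) = (of_bool (A (Suc T) \<omega> \<in> S) :: real)"
        by (cases "A (Suc T) \<omega> \<in> S") (auto simp: of_bool_def)
      then show ?case using Suc by (simp add: cnt_Suc sum.distrib del: sum_of_bool_eq)
    qed simp
    have "(\<Sum>t<T. prob {\<omega> \<in> space M. A (Suc t) \<omega> \<notin> S}) = expectation (\<lambda>\<omega>. \<Sum>t<T. of_bool (A (Suc t) \<omega> \<notin> S))"
      by (subst Bochner_Integration.integral_sum)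
         (simp_all only: prob_eq_expectation_of_bool[OF outside_pred] integrable_of_bool[OF outside_pred])
    also have "\<dots> = expectation (\<lambda>\<omega>. \<Sum>b\<in>S. - (real T * (real (cnt b T \<omega>) / real T - 1 / real (card S))))"
      unfolding count using elim card_S
      by (intro Bochner_Integration.integral_cong) (auto simp: sum_subtractf right_diff_distrib)
    also have "\<dots> \<le> expectation (\<lambda>\<omega>. \<Sum>b\<in>S. real T * \<bar>real (cnt b T \<omega>) / real T - 1 / real (card S)\<bar>)"
    proof (rule integral_mono)
      have "- (real T * y) \<le> real T * \<bar>y\<bar>" for y :: real
        using mult_left_mono[of "- y" "\<bar>y\<bar>" "real T"] by simp
      then show "(\<Sum>b\<in>S. - (real T * (real (cnt b T \<omega>) / real T - 1 / real (card S))))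
          \<le> (\<Sum>b\<in>S. real T * \<bar>real (cnt b T \<omega>) / real T - 1 / real (card S)\<bar>)" for \<omega>
        by (intro sum_mono)
    qed (intro Bochner_Integration.integrable_sum Bochner_Integration.integrable_minus integrable_mult_right
        integrable_abs integrable_share_deviation)+
    also have "\<dots> = real T * (\<Sum>b\<in>S. ?e b T)"
      unfolding sum_distrib_left
      by (subst Bochner_Integration.integral_sum) (use integrable_abs[OF integrable_share_deviation] in auto)
    finally show ?case using elim by (simp add: pos_divide_le_eq mult.commute)
  qed
qed

lemma unbalanced_average:
  assumes \<delta>: "\<delta> > 0"
  shows "(\<lambda>T. (\<Sum>t<T. prob {\<omega> \<in> space M. \<not> balanced \<delta> t \<omega>}) / real T) \<longlonglongrightarrow> 0"
proof -
  let ?m = "real (card S)"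
  \<comment> \<open>Balance at round \<open>t\<close> fails for three reasons: a pull outside
    \<open>S\<close>, a round too early for \<open>\<delta> * t / m \<ge> 1\<close>, or a share off
    by more than \<open>\<delta> / m\<close>. The last two, collected in \<open>g\<close>, vanish as
    \<open>t\<close> grows; the first is controlled only on average and is kept apart.\<close>
  define g where "g t = of_bool (\<not> 1 \<le> \<delta> * (real t / ?m))
    + (\<Sum>b\<in>S. prob {\<omega> \<in> space M. \<bar>real (cnt b t \<omega>) / real t - 1 / ?m\<bar> > \<delta> / ?m})" for t
  have m0: "?m > 0" using card_S by linarith
  have "(\<lambda>t. of_bool (\<not> 1 \<le> \<delta> * (real t / ?m)) :: real) \<longlonglongrightarrow> 0"
  proof (rule tendsto_eventually)
    have "filterlim (\<lambda>t. \<delta> / ?m * real t) at_top sequentially"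
      using \<delta> m0 by (intro filterlim_tendsto_pos_mult_at_top[OF tendsto_const _ filterlim_real_sequentially]) simp
    then have "eventually (\<lambda>t. 1 \<le> \<delta> / ?m * real t) sequentially" by (simp only: filterlim_at_top)
    then have "eventually (\<lambda>t. 1 \<le> \<delta> * (real t / ?m)) sequentially" by eventually_elim simp
    then show "eventually (\<lambda>t. of_bool (\<not> 1 \<le> \<delta> * (real t / ?m)) = (0::real)) sequentially"
      by eventually_elim simp
  qed
  moreover have "(\<lambda>t. \<Sum>b\<in>S. prob {\<omega> \<in> space M. \<bar>real (cnt b t \<omega>) / real t - 1 / ?m\<bar> > \<delta> / ?m}) \<longlonglongrightarrow> (\<Sum>b\<in>S. 0)"
    using \<delta> m0 by (intro tendsto_sum balance) auto
  ultimately have "g \<longlonglongrightarrow> 0" unfolding g_def[abs_def] using tendsto_add by fastforce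
  from tendsto_add[OF outside_average cesaro_null[OF this]]
  have lim: "(\<lambda>T. ((\<Sum>t<T. prob {\<omega> \<in> space M. A (Suc t) \<omega> \<notin> S}) + (\<Sum>t<T. g t)) / real T) \<longlonglongrightarrow> 0"
    by (simp add: add_divide_distrib)
  have le: "prob {\<omega> \<in> space M. \<not> balanced \<delta> t \<omega>} \<le> prob {\<omega> \<in> space M. A (Suc t) \<omega> \<notin> S} + g t" for t
  proof (cases "1 \<le> \<delta> * (real t / ?m)")
    case False
    have "0 \<le> (\<Sum>b\<in>S. prob {\<omega> \<in> space M. \<bar>real (cnt b t \<omega>) / real t - 1 / ?m\<bar> > \<delta> / ?m})"
      by (intro sum_nonneg) auto
    moreover have "prob {\<omega> \<in> space M. \<not> balanced \<delta> t \<omega>} \<le> 1" by simp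
    moreover have "of_bool (\<not> 1 \<le> \<delta> * (real t / ?m)) = (1::real)" using False by simp
    ultimately show ?thesis
      using measure_nonneg[of M "{\<omega> \<in> space M. A (Suc t) \<omega> \<notin> S}"] unfolding g_def by linarith
  next
    case True
    then have t0: "real t > 0" using m0 by (cases "t = 0") auto
    let ?U = "\<lambda>b. {\<omega> \<in> space M. \<bar>real (cnt b t \<omega>) / real t - 1 / ?m\<bar> > \<delta> / ?m}"
    have U: "?U b \<in> sets M" for b by (rule predE[OF share_deviation_pred])
    have out: "{\<omega> \<in> space M. A (Suc t) \<omega> \<notin> S} \<in> sets M" by (rule predE[OF outside_pred])
    have UU: "(\<Union>b\<in>S. ?U b) \<in> sets M" using U by (intro sets.finite_UN) auto
    have "{\<omega> \<in> space M. \<not> balanced \<delta> t \<omega>} \<subseteq> {\<omega> \<in> space M. A (Suc t) \<omega> \<notin> S} \<union> (\<Union>b\<in>S. ?U b)"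
    proof (rule subsetI, rule ccontr)
      fix \<omega> assume nb: "\<omega> \<in> {\<omega> \<in> space M. \<not> balanced \<delta> t \<omega>}"
        and n: "\<omega> \<notin> {\<omega> \<in> space M. A (Suc t) \<omega> \<notin> S} \<union> (\<Union>b\<in>S. ?U b)"
      have "\<bar>real (cnt b t \<omega>) - real t / ?m\<bar> \<le> \<delta> * (real t / ?m)" if "b \<in> S" for b
      proof -
        have "\<bar>real (cnt b t \<omega>) / real t - 1 / ?m\<bar> \<le> \<delta> / ?m" using n nb that by auto
        then have "real t * \<bar>real (cnt b t \<omega>) / real t - 1 / ?m\<bar> \<le> real t * (\<delta> / ?m)" using t0 by (intro mult_left_mono) auto
        also have "real t * \<bar>real (cnt b t \<omega>) / real t - 1 / ?m\<bar> = \<bar>real t * (real (cnt b t \<omega>) / real t - 1 / ?m)\<bar>"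
          using t0 by (simp add: abs_mult)
        also have "real t * (real (cnt b t \<omega>) / real t - 1 / ?m) = real (cnt b t \<omega>) - real t / ?m"
          using t0 by (simp add: right_diff_distrib)
        finally show ?thesis by (simp add: mult.commute)
      qed
      then show False using nb n True unfolding balanced_def by blast
    qed
    then have "prob {\<omega> \<in> space M. \<not> balanced \<delta> t \<omega>} \<le> prob ({\<omega> \<in> space M. A (Suc t) \<omega> \<notin> S} \<union> (\<Union>b\<in>S. ?U b))"
      by (intro finite_measure_mono sets.Un out UU)
    also have "\<dots> \<le> prob {\<omega> \<in> space M. A (Suc t) \<omega> \<notin> S} + prob (\<Union>b\<in>S. ?U b)"
      by (rule measure_Un_le[OF out UU])
    also have "prob (\<Union>b\<in>S. ?U b) \<le> (\<Sum>b\<in>S. prob (?U b))"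
      using U by (intro finite_measure_subadditive_finite) auto
    finally show ?thesis unfolding g_def using True by simp
  qed
  show ?thesis
  proof (rule tendsto_sandwich[OF _ _ tendsto_const lim])
    show "\<forall>\<^sub>F T in sequentially. 0 \<le> (\<Sum>t<T. prob {\<omega> \<in> space M. \<not> balanced \<delta> t \<omega>}) / real T"
      by (intro always_eventually allI divide_nonneg_nonneg sum_nonneg) auto
    show "\<forall>\<^sub>F T in sequentially. (\<Sum>t<T. prob {\<omega> \<in> space M. \<not> balanced \<delta> t \<omega>}) / real T
        \<le> ((\<Sum>t<T. prob {\<omega> \<in> space M. A (Suc t) \<omega> \<notin> S}) + (\<Sum>t<T. g t)) / real T"
      unfolding sum.distrib[symmetric]
      by (intro always_eventually allI divide_right_mono sum_mono le) auto
  qed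
qed

text \<open>The order of the choices matters: \<open>\<eta>\<close> fixes the race and
  \<open>c\<close>; then \<open>\<Lambda>\<close> is taken large in terms of
  \<open>c * \<tau>\<close>, then \<open>L\<close> in terms of \<open>\<Lambda>\<close>, and last
  \<open>\<delta>\<close> small in terms of \<open>L\<close>. Each costs one third of
  \<open>c * \<tau>\<close>, and only then does \<open>T\<close> grow.\<close>

lemma lead_average:
  assumes \<eta>: "\<eta> > 0"
  shows "(\<lambda>T. (\<Sum>t<T. prob {\<omega> \<in> space M. pn i t \<omega> - pn j t \<omega> \<ge> \<eta> * sqrt (real T)}) / real T) \<longlonglongrightarrow> 0"
proof (rule tendsto_zero_by_slack)
  fix \<tau> :: real assume \<tau>: "\<tau> > 0"
  obtain u x where ux: "u < x" "x < u + \<eta> / 2" "cdf D u < cdf D x" "cdf D x < cdf D (u + \<eta> / 2)"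
    using law.ex_split_points[of "\<eta> / 2"] \<eta> by auto
  define c where "c = \<eta> / 2 * race_prob u x (u + \<eta> / 2)"
  have c: "c > 0" unfolding c_def using race_prob_pos[OF ux] \<eta> by simp
  define m where "m = real (card S)"
  have m: "m \<ge> 1" unfolding m_def by (rule card_S)
  \<comment> \<open>The \<open>m\<close> terms \<open>1 / \<Lambda>\<close> come from
    \<open>noise_count_corr_le\<close>, and \<open>2 * m\<^sup>2 / \<Lambda>\<close> from truncating
    the crude bound.\<close>
  define Y where "Y = m + 2 * m\<^sup>2"
  have Y: "Y > 0" unfolding Y_def using m by (simp add: add_pos_nonneg)
  define \<Lambda> where "\<Lambda> = 3 * Y / (c * \<tau>)"
  have \<Lambda>: "\<Lambda> > 0" unfolding \<Lambda>_def using Y c \<tau> by simp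
  have \<Lambda>': "(m + 2 * m\<^sup>2) / \<Lambda> = c * \<tau> / 3" unfolding \<Lambda>_def Y_def[symmetric] using Y c \<tau> by simp
  define d where "d = 2 * \<Lambda> + \<eta> / 2"
  have d: "d > 0" using \<Lambda> \<eta> by (simp add: d_def)
  obtain L where L: "L > 0" "measure D {z. \<bar>z\<bar> > L} < c * \<tau> / 3 / (d * m)"
  proof -
    have "0 < c * \<tau> / 3 / (d * m)" using c \<tau> d m by simp
    from order_tendstoD(2)[OF law.two_sided_tail_null this]
    have "eventually (\<lambda>L. measure D {z. \<bar>z\<bar> > L} < c * \<tau> / 3 / (d * m) \<and> L > 0) at_top"
      using eventually_gt_at_top[of 0] by (rule eventually_conj)
    then show ?thesis using that by (auto simp: eventually_at_top_linorder)
  qed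
  define B where "B = 1 + L + \<bar>\<mu>s\<bar> / \<sigma> + m\<^sup>2"
  have B: "B > 0" using L sigma_pos by (simp add: B_def add_pos_nonneg)
  define \<delta> where "\<delta> = min (1 / 2) (c * \<tau> / 3 / (4 * B))"
  have \<delta>: "\<delta> > 0" "\<delta> \<le> 1 / 2" using c \<tau> B by (simp_all add: \<delta>_def)
  have \<delta>B: "4 * \<delta> * B \<le> c * \<tau> / 3"
  proof -
    have "\<delta> \<le> c * \<tau> / 3 / (4 * B)" by (simp add: \<delta>_def)
    then show ?thesis using B by (simp add: pos_le_divide_eq mult_ac)
  qed
  let ?e = "\<lambda>b T. expectation (\<lambda>\<omega>. \<bar>real (cnt b T \<omega>) / real T - 1 / m\<bar>)"
  let ?q = "\<lambda>T. (\<Sum>t<T. prob {\<omega> \<in> space M. \<not> balanced \<delta> t \<omega>}) / real T"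
  let ?f = "\<lambda>T. (\<Sum>t<T. prob {\<omega> \<in> space M. pn i t \<omega> - pn j t \<omega> \<ge> \<eta> * sqrt (real T)}) / real T"
  define h where "h T = ((\<Sum>b\<in>S. \<Lambda> * ?e b T) + d * ?q T) / c" for T
  have "(\<lambda>T. \<Sum>b\<in>S. \<Lambda> * ?e b T) \<longlonglongrightarrow> (\<Sum>b\<in>S. \<Lambda> * 0)"
    unfolding m_def by (intro tendsto_sum tendsto_mult tendsto_const expected_share_deviation)
  moreover have "(\<lambda>T. d * ?q T) \<longlonglongrightarrow> d * 0"
    by (intro tendsto_mult tendsto_const unbalanced_average \<delta>)
  ultimately have "h \<longlonglongrightarrow> ((\<Sum>b\<in>S. \<Lambda> * 0) + d * 0) / c"
    unfolding h_def[abs_def] using c by (intro tendsto_divide tendsto_add tendsto_const) auto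
  then have h: "h \<longlonglongrightarrow> 0" by simp
  have "eventually (\<lambda>T. ?f T \<le> \<tau> + h T) sequentially"
    using eventually_gt_at_top[of 0]
  proof eventually_elim
    case (elim T)
    have "c * ?f T \<le> (\<Sum>b\<in>S. \<Lambda> * ?e b T + 1 / \<Lambda>) + (4 * \<delta> * B + 2 * m\<^sup>2 / \<Lambda> + d * (?q T + m * measure D {z. \<bar>z\<bar> > L}))"
      using lead_race_average[OF \<delta> L(1) \<Lambda> elim, of "u + \<eta> / 2" u \<eta> x] \<eta>
      unfolding c_def d_def B_def m_def by simp
    also have "\<dots> = c * h T + (m + 2 * m\<^sup>2) / \<Lambda> + 4 * \<delta> * B + measure D {z. \<bar>z\<bar> > L} * (d * m)"
      using c by (simp add: h_def sum.distrib m_def[symmetric] add_divide_distrib algebra_simps)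
    also have "\<dots> \<le> c * h T + c * \<tau> / 3 + c * \<tau> / 3 + c * \<tau> / 3"
    proof -
      have "measure D {z. \<bar>z\<bar> > L} * (d * m) \<le> c * \<tau> / 3"
        using L(2) d m by (simp add: pos_less_divide_eq less_imp_le)
      then show ?thesis using \<Lambda>' \<delta>B by linarith
    qed
    also have "\<dots> = c * (\<tau> + h T)" by (simp add: algebra_simps)
    finally show ?case using c by (simp only: mult_le_cancel_left_pos)
  qed
  with h show "\<exists>h. h \<longlonglongrightarrow> 0 \<and> eventually (\<lambda>T. ?f T \<le> \<tau> + h T) sequentially" by blast
qed (intro divide_nonneg_nonneg sum_nonneg measure_nonneg, simp)

end

end

section \<open>Growth of the difference of two noise sums\<close>

lemma one_minus_cos_bounds: "0 \<le> 1 - cos (y::real)" "1 - cos y \<le> y\<^sup>2 / 2" "1 - cos y \<le> 2"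
proof -
  have "1 - cos y = 2 * (sin (y / 2))\<^sup>2" using cos_double_sin[of "y / 2"] by simp
  moreover have "(sin (y / 2))\<^sup>2 \<le> (y / 2)\<^sup>2"
    using abs_sin_x_le_abs_x[of "y / 2"] by (simp only: abs_le_square_iff)
  ultimately show "1 - cos y \<le> y\<^sup>2 / 2" by (simp add: power_divide)
  show "0 \<le> 1 - cos y" by simp
  show "1 - cos y \<le> 2" using cos_ge_minus_one[of y] by linarith
qed

text \<open>The quadratic bound provides an integrable majorant, the cubic one the pointwise
  limit.\<close>

lemma sin_minus_self_bounds: "\<bar>sin y - y\<bar> \<le> (y::real)\<^sup>2 / 2" "\<bar>sin y - y\<bar> \<le> \<bar>y\<bar> ^ 3 / 6"
  using Maclaurin_sin_bound[of y 2] Maclaurin_sin_bound[of y 3]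
  by (simp_all add: sin_coeff_def eval_nat_numeral)

lemma scaled_one_minus_cos_limit: "(\<lambda>T. real T * (1 - cos (x / sqrt (real T)))) \<longlonglongrightarrow> (x::real)\<^sup>2 / 2"
proof (cases "x = 0")
  case False
  then consider "x > 0" | "x < 0" by linarith
  then show ?thesis by cases (real_asymp simp: power2_eq_square)+
qed simp

text \<open>Dominated convergence with majorant \<open>\<xi>\<^sup>2 / 2\<close>. For the sine the
  linear term is subtracted first, which is possible because the mean is zero.\<close>

lemma (in prob_space) clt_scale_limits:
  fixes \<xi> :: "'a \<Rightarrow> real"
  assumes [measurable]: "\<xi> \<in> borel_measurable M" and sq: "integrable M (\<lambda>\<omega>. (\<xi> \<omega>)\<^sup>2)"
    and int: "integrable M \<xi>" and mean: "expectation \<xi> = 0"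
  shows "(\<lambda>T. real T * (1 - expectation (\<lambda>\<omega>. cos (\<xi> \<omega> / sqrt (real T))))) \<longlonglongrightarrow> expectation (\<lambda>\<omega>. (\<xi> \<omega>)\<^sup>2) / 2"
    and "(\<lambda>T. real T * \<bar>expectation (\<lambda>\<omega>. sin (\<xi> \<omega> / sqrt (real T)))\<bar>) \<longlonglongrightarrow> 0"
proof -
  have icos: "integrable M (\<lambda>\<omega>. cos (\<xi> \<omega> / y))" and isin: "integrable M (\<lambda>\<omega>. sin (\<xi> \<omega> / y))" for y
    by (rule integrable_const_bound[of _ 1]; simp)+
  have sq_scale: "real T * ((\<xi> \<omega> / sqrt (real T))\<^sup>2 / 2) \<le> (\<xi> \<omega>)\<^sup>2 / 2" for T \<omega>
    by (cases "T = 0") (simp_all add: power_divide)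
  have "(\<lambda>T. expectation (\<lambda>\<omega>. real T * (1 - cos (\<xi> \<omega> / sqrt (real T))))) \<longlonglongrightarrow> expectation (\<lambda>\<omega>. (\<xi> \<omega>)\<^sup>2 / 2)"
  proof (rule integral_dominated_convergence[where w = "\<lambda>\<omega>. (\<xi> \<omega>)\<^sup>2 / 2"])
    show "AE \<omega> in M. norm (real T * (1 - cos (\<xi> \<omega> / sqrt (real T)))) \<le> (\<xi> \<omega>)\<^sup>2 / 2" for T
    proof (rule AE_I2)
      fix \<omega>
      have "real T * (1 - cos (\<xi> \<omega> / sqrt (real T))) \<le> real T * ((\<xi> \<omega> / sqrt (real T))\<^sup>2 / 2)"
        by (intro mult_left_mono one_minus_cos_bounds) simp
      moreover have "0 \<le> real T * (1 - cos (\<xi> \<omega> / sqrt (real T)))"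
        by (intro mult_nonneg_nonneg one_minus_cos_bounds) simp
      ultimately show "norm (real T * (1 - cos (\<xi> \<omega> / sqrt (real T)))) \<le> (\<xi> \<omega>)\<^sup>2 / 2"
        using sq_scale[of T \<omega>] by simp
    qed
  qed (use sq scaled_one_minus_cos_limit in auto)
  moreover have "expectation (\<lambda>\<omega>. real T * (1 - cos (\<xi> \<omega> / sqrt (real T))))
      = real T * (1 - expectation (\<lambda>\<omega>. cos (\<xi> \<omega> / sqrt (real T))))" for T
    using icos[of "sqrt (real T)"] by (simp add: prob_space)
  ultimately show "(\<lambda>T. real T * (1 - expectation (\<lambda>\<omega>. cos (\<xi> \<omega> / sqrt (real T))))) \<longlonglongrightarrow> expectation (\<lambda>\<omega>. (\<xi> \<omega>)\<^sup>2) / 2"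
    by (simp only: integral_divide_zero)
  have "(\<lambda>T. expectation (\<lambda>\<omega>. real T * (sin (\<xi> \<omega> / sqrt (real T)) - \<xi> \<omega> / sqrt (real T)))) \<longlonglongrightarrow> expectation (\<lambda>\<omega>. 0)"
  proof (rule integral_dominated_convergence[where w = "\<lambda>\<omega>. (\<xi> \<omega>)\<^sup>2 / 2"])
    show "AE \<omega> in M. norm (real T * (sin (\<xi> \<omega> / sqrt (real T)) - \<xi> \<omega> / sqrt (real T))) \<le> (\<xi> \<omega>)\<^sup>2 / 2" for T
    proof (rule AE_I2)
      fix \<omega>
      have "real T * \<bar>sin (\<xi> \<omega> / sqrt (real T)) - \<xi> \<omega> / sqrt (real T)\<bar> \<le> real T * ((\<xi> \<omega> / sqrt (real T))\<^sup>2 / 2)"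
        by (intro mult_left_mono sin_minus_self_bounds) simp
      then show "norm (real T * (sin (\<xi> \<omega> / sqrt (real T)) - \<xi> \<omega> / sqrt (real T))) \<le> (\<xi> \<omega>)\<^sup>2 / 2"
        using sq_scale[of T \<omega>] by (simp add: abs_mult)
    qed
    show "AE \<omega> in M. (\<lambda>T. real T * (sin (\<xi> \<omega> / sqrt (real T)) - \<xi> \<omega> / sqrt (real T))) \<longlonglongrightarrow> 0"
    proof (rule AE_I2)
      fix \<omega>
      have "(\<lambda>T. \<bar>\<xi> \<omega>\<bar> ^ 3 / 6 / sqrt (real T)) \<longlonglongrightarrow> 0" by real_asymp
      then show "(\<lambda>T. real T * (sin (\<xi> \<omega> / sqrt (real T)) - \<xi> \<omega> / sqrt (real T))) \<longlonglongrightarrow> 0"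
      proof (rule Lim_null_comparison[rotated])
        show "\<forall>\<^sub>F T in sequentially. norm (real T * (sin (\<xi> \<omega> / sqrt (real T)) - \<xi> \<omega> / sqrt (real T))) \<le> \<bar>\<xi> \<omega>\<bar> ^ 3 / 6 / sqrt (real T)"
          using eventually_gt_at_top[of 0]
        proof eventually_elim
          case (elim T)
          have "real T * \<bar>sin (\<xi> \<omega> / sqrt (real T)) - \<xi> \<omega> / sqrt (real T)\<bar> \<le> real T * (\<bar>\<xi> \<omega> / sqrt (real T)\<bar> ^ 3 / 6)"
            by (intro mult_left_mono sin_minus_self_bounds) simp
          also have "\<dots> = \<bar>\<xi> \<omega>\<bar> ^ 3 / 6 / sqrt (real T)"
          proof -
            have "sqrt (real T) ^ 3 = real T * sqrt (real T)" by (simp add: power3_eq_cube)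
            then show ?thesis using elim by (simp add: power_divide)
          qed
          finally show ?case by (simp add: abs_mult)
        qed
      qed
    qed
  qed (use sq in auto)
  moreover have "expectation (\<lambda>\<omega>. real T * (sin (\<xi> \<omega> / sqrt (real T)) - \<xi> \<omega> / sqrt (real T)))
      = real T * expectation (\<lambda>\<omega>. sin (\<xi> \<omega> / sqrt (real T)))" for T
    using isin[of "sqrt (real T)"] int mean by simp
  ultimately have "(\<lambda>T. real T * expectation (\<lambda>\<omega>. sin (\<xi> \<omega> / sqrt (real T)))) \<longlonglongrightarrow> 0"
    by (simp only: Bochner_Integration.integral_zero)
  from tendsto_rabs_zero[OF this]
  show "(\<lambda>T. real T * \<bar>expectation (\<lambda>\<omega>. sin (\<xi> \<omega> / sqrt (real T)))\<bar>) \<longlonglongrightarrow> 0" by (simp add: abs_mult)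
qed

context adapted_thompson
begin

lemma noise_expectation_eq:
  assumes "t \<ge> 1" and g[measurable]: "g \<in> borel_measurable borel"
  shows "expectation (\<lambda>\<omega>. g (\<xi> t \<omega>) :: real) = expectation (\<lambda>\<omega>. g (\<xi> 1 \<omega>))"
proof -
  have "integral\<^sup>L (distr M borel (\<xi> t)) g = expectation (\<lambda>\<omega>. g (\<xi> t \<omega>))"
    by (rule integral_distr[OF noise_rv[OF assms(1)] g])
  moreover have "integral\<^sup>L (distr M borel (\<xi> 1)) g = expectation (\<lambda>\<omega>. g (\<xi> 1 \<omega>))"
    by (rule integral_distr[OF noise_rv g]) simp
  ultimately show ?thesis using noise_identical[OF assms(1)] by simp
qed

text \<open>
  Only second moments of the noise are available, so smallness in probability of \<open>pn i - pn j\<close> does not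
  control its variance; its cosine is used instead.
\<close>

lemma cos_lead_step:
  fixes \<theta> \<kappa> :: real
  assumes ij: "i \<noteq> j" and \<kappa>: "\<kappa> \<ge> 0"
  defines "\<phi> \<equiv> expectation (\<lambda>\<omega>. cos (\<theta> * \<xi> 1 \<omega>))" and "\<psi> \<equiv> expectation (\<lambda>\<omega>. sin (\<theta> * \<xi> 1 \<omega>))"
  shows "expectation (\<lambda>\<omega>. cos (\<theta> * (pn i (Suc t) \<omega> - pn j (Suc t) \<omega>)))
    \<le> expectation (\<lambda>\<omega>. cos (\<theta> * (pn i t \<omega> - pn j t \<omega>)))
      - (1 - \<phi>) * (prob {\<omega> \<in> space M. A (Suc t) \<omega> = i} + prob {\<omega> \<in> space M. A (Suc t) \<omega> = j}
          - \<kappa>\<^sup>2 / 2 - 2 * prob {\<omega> \<in> space M. \<bar>\<theta> * (pn i t \<omega> - pn j t \<omega>)\<bar> \<ge> \<kappa>}) + \<bar>\<psi>\<bar>"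
proof -
  define d where "d \<omega> = \<theta> * (pn i t \<omega> - pn j t \<omega>)" for \<omega>
  \<comment> \<open>A pull of \<open>i\<close> or \<open>j\<close> moves the difference by plus or
    minus the noise; \<open>p\<close> records that it moves and \<open>e\<close> the
    direction.\<close>
  define p where "p \<omega> = (of_bool (A (Suc t) \<omega> = i) + of_bool (A (Suc t) \<omega> = j) :: real)" for \<omega>
  define e where "e \<omega> = (of_bool (A (Suc t) \<omega> = i) - of_bool (A (Suc t) \<omega> = j) :: real)" for \<omega>
  have pe: "\<bar>p \<omega>\<bar> \<le> 1" "\<bar>e \<omega>\<bar> \<le> 1" "0 \<le> p \<omega>" for \<omega> using ij by (auto simp: p_def e_def)
  have dm: "d \<in> borel_measurable (gen (pre_index K t))"
    unfolding d_def[abs_def] by (intro borel_measurable_times borel_measurable_diff borel_measurable_const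
      pn_measurable[THEN hist_imp_pre])
  have em: "e \<in> borel_measurable (gen (pre_index K t))"
    unfolding e_def[abs_def] by (intro borel_measurable_diff pulled_measurable_pre)
  have pm: "p \<in> borel_measurable (gen (pre_index K t))"
    unfolding p_def[abs_def] by (intro borel_measurable_add pulled_measurable_pre)
  have um: "(\<lambda>\<omega>. p \<omega> * cos (d \<omega>)) \<in> borel_measurable (gen (pre_index K t))"
    and vm: "(\<lambda>\<omega>. e \<omega> * sin (d \<omega>)) \<in> borel_measurable (gen (pre_index K t))"
    using dm em pm by measurable
  note [measurable] = dm[THEN pre_imp_M] em[THEN pre_imp_M] pm[THEN pre_imp_M]
  have bnd: "\<bar>a * c\<bar> \<le> 1" if "\<bar>a\<bar> \<le> 1" "\<bar>c\<bar> \<le> 1" for a c :: real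
    using mult_mono[OF that(1,2)] by (simp add: abs_mult)
  have ui: "integrable M (\<lambda>\<omega>. p \<omega> * cos (d \<omega>))"
    by (rule integrable_const_bound[of _ 1]) (use bnd[OF pe(1) abs_cos_le_one] um[THEN pre_imp_M] in auto)
  have vi: "integrable M (\<lambda>\<omega>. e \<omega> * sin (d \<omega>))"
    by (rule integrable_const_bound[of _ 1]) (use bnd[OF pe(2) abs_sin_le_one] vm[THEN pre_imp_M] in auto)
  have ci: "integrable M (\<lambda>\<omega>. cos (d \<omega>))"
    by (rule integrable_const_bound[of _ 1]) auto
  have gm: "(\<lambda>x. 1 - cos (\<theta> * x)) \<in> borel_measurable borel" "(\<lambda>x. sin (\<theta> * x)) \<in> borel_measurable borel"
    by measurable
  have \<xi>m: "\<xi> (Suc t) \<in> borel_measurable M" by (rule noise_rv) simp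
  note [measurable] = \<xi>m noise_rv[OF order_refl]
  have gi: "integrable M (\<lambda>\<omega>. 1 - cos (\<theta> * \<xi> (Suc t) \<omega>))" "integrable M (\<lambda>\<omega>. sin (\<theta> * \<xi> (Suc t) \<omega>))"
    "integrable M (\<lambda>\<omega>. cos (\<theta> * \<xi> 1 \<omega>))"
    by (intro Bochner_Integration.integrable_diff integrable_const integrable_const_bound[of _ 1]; simp)+
  have E: "expectation (\<lambda>\<omega>. 1 - cos (\<theta> * \<xi> (Suc t) \<omega>)) = 1 - \<phi>" "expectation (\<lambda>\<omega>. sin (\<theta> * \<xi> (Suc t) \<omega>)) = \<psi>"
    using noise_expectation_eq[OF _ gm(1), of "Suc t"] noise_expectation_eq[OF _ gm(2), of "Suc t"] gi(3)
    by (simp_all add: \<phi>_def \<psi>_def prob_space)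
  have \<phi>: "1 - \<phi> \<ge> 0"
    unfolding E(1)[symmetric] by (rule Bochner_Integration.integral_nonneg) simp
  note X = noise_mult[OF um ui gm(1) gi(1)] noise_mult[OF vm vi gm(2) gi(2)]
  have "cos (\<theta> * (pn i (Suc t) \<omega> - pn j (Suc t) \<omega>)) =
      cos (d \<omega>) - p \<omega> * cos (d \<omega>) * (1 - cos (\<theta> * \<xi> (Suc t) \<omega>)) - e \<omega> * sin (d \<omega>) * sin (\<theta> * \<xi> (Suc t) \<omega>)" for \<omega>
  proof -
    consider "A (Suc t) \<omega> = i" | "A (Suc t) \<omega> = j" | "A (Suc t) \<omega> \<noteq> i" "A (Suc t) \<omega> \<noteq> j" by blast
    then show ?thesis
    proof cases
      case 1
      then have eq: "\<theta> * (pn i (Suc t) \<omega> - pn j (Suc t) \<omega>) = d \<omega> + \<theta> * \<xi> (Suc t) \<omega>"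
        using ij by (simp add: pn_Suc d_def algebra_simps)
      show ?thesis unfolding eq cos_add using 1 ij by (simp add: p_def e_def right_diff_distrib)
    next
      case 2
      then have eq: "\<theta> * (pn i (Suc t) \<omega> - pn j (Suc t) \<omega>) = d \<omega> - \<theta> * \<xi> (Suc t) \<omega>"
        using ij by (simp add: pn_Suc d_def algebra_simps)
      show ?thesis unfolding eq cos_diff using 2 ij by (simp add: p_def e_def right_diff_distrib)
    qed (simp add: p_def e_def d_def pn_Suc)
  qed
  then have "expectation (\<lambda>\<omega>. cos (\<theta> * (pn i (Suc t) \<omega> - pn j (Suc t) \<omega>)))
      = expectation (\<lambda>\<omega>. cos (d \<omega>)) - expectation (\<lambda>\<omega>. p \<omega> * cos (d \<omega>)) * (1 - \<phi>) - expectation (\<lambda>\<omega>. e \<omega> * sin (d \<omega>)) * \<psi>"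
    using ci X E by simp
  moreover have "- (expectation (\<lambda>\<omega>. e \<omega> * sin (d \<omega>)) * \<psi>) \<le> \<bar>\<psi>\<bar>"
  proof -
    have "\<bar>expectation (\<lambda>\<omega>. e \<omega> * sin (d \<omega>))\<bar> \<le> expectation (\<lambda>\<omega>. \<bar>e \<omega> * sin (d \<omega>)\<bar>)"
      by (rule integral_abs_bound)
    also have "\<dots> \<le> expectation (\<lambda>\<omega>. 1)"
      using bnd[OF pe(2) abs_sin_le_one] by (intro integral_mono integrable_abs vi) auto
    finally have "\<bar>expectation (\<lambda>\<omega>. e \<omega> * sin (d \<omega>))\<bar> \<le> 1" by (simp add: prob_space)
    then have "\<bar>expectation (\<lambda>\<omega>. e \<omega> * sin (d \<omega>)) * \<psi>\<bar> \<le> 1 * \<bar>\<psi>\<bar>" unfolding abs_mult by (rule mult_right_mono) simp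
    then show ?thesis by linarith
  qed
  moreover have "(1 - \<phi>) * (prob {\<omega> \<in> space M. A (Suc t) \<omega> = i} + prob {\<omega> \<in> space M. A (Suc t) \<omega> = j}
          - \<kappa>\<^sup>2 / 2 - 2 * prob {\<omega> \<in> space M. \<bar>d \<omega>\<bar> \<ge> \<kappa>}) \<le> expectation (\<lambda>\<omega>. p \<omega> * cos (d \<omega>)) * (1 - \<phi>)"
  proof -
    have ep: "Measurable.pred M (\<lambda>\<omega>. \<bar>d \<omega>\<bar> \<ge> \<kappa>)" by measurable
    \<comment> \<open>The cosine is replaced by 1 at cost \<open>\<kappa>\<^sup>2 / 2\<close>, or at
      the extra cost 2 when the difference is not small.\<close>
    have low: "p \<omega> - \<kappa>\<^sup>2 / 2 - 2 * of_bool (\<bar>d \<omega>\<bar> \<ge> \<kappa>) \<le> p \<omega> * cos (d \<omega>)" for \<omega>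
    proof -
      have "p \<omega> * (1 - cos (d \<omega>)) \<le> 1 * (1 - cos (d \<omega>))"
        using pe(1)[of \<omega>] by (intro mult_right_mono one_minus_cos_bounds) auto
      moreover have "1 - cos (d \<omega>) \<le> \<kappa>\<^sup>2 / 2 + 2 * of_bool (\<bar>d \<omega>\<bar> \<ge> \<kappa>)"
      proof (cases "\<bar>d \<omega>\<bar> \<ge> \<kappa>")
        case True
        then show ?thesis using one_minus_cos_bounds(3)[of "d \<omega>"] by (simp add: add_increasing)
      next
        case False
        then have "(d \<omega>)\<^sup>2 \<le> \<kappa>\<^sup>2" using \<kappa> by (simp add: abs_le_square_iff[symmetric])
        then show ?thesis using False one_minus_cos_bounds(2)[of "d \<omega>"] by simp
      qed
      ultimately show ?thesis by (simp add: right_diff_distrib)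
    qed
    note ints = integrable_of_bool[OF pull_eq_pred[of t i]] integrable_of_bool[OF pull_eq_pred[of t j]] integrable_of_bool[OF ep]
    have pint: "integrable M p" unfolding p_def[abs_def] by (intro Bochner_Integration.integrable_add ints)
    have "prob {\<omega> \<in> space M. A (Suc t) \<omega> = i} + prob {\<omega> \<in> space M. A (Suc t) \<omega> = j} = expectation p"
      unfolding prob_eq_expectation_of_bool[OF pull_eq_pred] p_def[abs_def]
      by (rule Bochner_Integration.integral_add[symmetric]) (rule ints)+
    then have "prob {\<omega> \<in> space M. A (Suc t) \<omega> = i} + prob {\<omega> \<in> space M. A (Suc t) \<omega> = j}
          - \<kappa>\<^sup>2 / 2 - 2 * prob {\<omega> \<in> space M. \<bar>d \<omega>\<bar> \<ge> \<kappa>}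
        = expectation (\<lambda>\<omega>. p \<omega> - \<kappa>\<^sup>2 / 2 - 2 * of_bool (\<bar>d \<omega>\<bar> \<ge> \<kappa>))"
      unfolding prob_eq_expectation_of_bool[OF ep] using pint ints(3) by (simp add: prob_space)
    also have "\<dots> \<le> expectation (\<lambda>\<omega>. p \<omega> * cos (d \<omega>))"
      by (rule integral_mono[OF _ ui low]) (use pint ints(3) in simp)
    finally show ?thesis using \<phi> by (subst mult.commute) (rule mult_right_mono)
  qed
  ultimately show ?thesis unfolding d_def by linarith
qed

lemma expectation_cnt_eq_sum: "expectation (\<lambda>\<omega>. real (cnt b n \<omega>)) = (\<Sum>t<n. prob {\<omega> \<in> space M. A (Suc t) \<omega> = b})"
proof (induction n)
  case (Suc n)
  have "expectation (\<lambda>\<omega>. real (cnt b (Suc n) \<omega>)) = expectation (\<lambda>\<omega>. real (cnt b n \<omega>) + of_bool (A (Suc n) \<omega> = b))"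
    by (simp add: cnt_Suc)
  also have "\<dots> = expectation (\<lambda>\<omega>. real (cnt b n \<omega>)) + prob {\<omega> \<in> space M. A (Suc n) \<omega> = b}"
    unfolding prob_eq_expectation_of_bool[OF pull_eq_pred]
    by (rule Bochner_Integration.integral_add[OF integrable_cnt integrable_of_bool[OF pull_eq_pred]])
  finally show ?case using Suc by simp
qed simp

text \<open>Summing the steps from the value 1 at time 0 bounds the mean cosine at time
  \<open>n\<close> from above, while a small difference at \<open>n\<close> keeps it near 1. The
  drift in between, driven by the pulls of \<open>i\<close> and \<open>j\<close>, must therefore be
  small.\<close>

lemma cos_lead_bound:
  fixes \<theta> \<kappa> :: real
  assumes ij: "i \<noteq> j" and \<kappa>: "\<kappa> \<ge> 0" and nT: "n \<le> T"
  defines "\<phi> \<equiv> expectation (\<lambda>\<omega>. cos (\<theta> * \<xi> 1 \<omega>))" and "\<psi> \<equiv> expectation (\<lambda>\<omega>. sin (\<theta> * \<xi> 1 \<omega>))"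
    and "P \<equiv> \<lambda>t. prob {\<omega> \<in> space M. \<bar>\<theta> * (pn i t \<omega> - pn j t \<omega>)\<bar> \<ge> \<kappa>}"
  shows "(1 - \<phi>) * (expectation (\<lambda>\<omega>. real (cnt i n \<omega>)) + expectation (\<lambda>\<omega>. real (cnt j n \<omega>))
      - real n * \<kappa>\<^sup>2 / 2 - 2 * (\<Sum>t<T. P t)) \<le> \<kappa>\<^sup>2 / 2 + 2 * P n + real T * \<bar>\<psi>\<bar>"
proof -
  let ?C = "\<lambda>t. expectation (\<lambda>\<omega>. cos (\<theta> * (pn i t \<omega> - pn j t \<omega>)))"
  have \<phi>: "1 - \<phi> \<ge> 0"
  proof -
    have m: "(\<lambda>\<omega>. cos (\<theta> * \<xi> 1 \<omega>)) \<in> borel_measurable M"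
      using noise_rv[OF order_refl] by measurable
    have "integrable M (\<lambda>\<omega>. cos (\<theta> * \<xi> 1 \<omega>))" by (rule integrable_const_bound[OF _ m, of 1]) simp
    then have "\<phi> \<le> expectation (\<lambda>\<omega>. 1)" unfolding \<phi>_def by (intro integral_mono) auto
    then show ?thesis by (simp add: prob_space)
  qed
  have "?C n \<le> 1 - (1 - \<phi>) * ((\<Sum>t<n. prob {\<omega> \<in> space M. A (Suc t) \<omega> = i}) + (\<Sum>t<n. prob {\<omega> \<in> space M. A (Suc t) \<omega> = j})
      - real n * \<kappa>\<^sup>2 / 2 - 2 * (\<Sum>t<n. P t)) + real n * \<bar>\<psi>\<bar>"
  proof (induction n)
    case (Suc n)
    have lin: "c' \<le> 1 - f * (s + s' - (k + k') - 2 * (q + q')) + (w + w')"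
      if "c' \<le> c - f * (x - k' - 2 * q') + w'" "c \<le> 1 - f * (y - k - 2 * q) + w" "s + s' = x + y"
      for c c' f s s' k k' q q' w w' x y :: real
    proof -
      have "f * (s + s' - (k + k') - 2 * (q + q')) = f * (x - k' - 2 * q') + f * (y - k - 2 * q)"
        unfolding that(3) by (simp add: algebra_simps)
      then show ?thesis using that by linarith
    qed
    have e: "real (Suc n) * \<kappa>\<^sup>2 / 2 = real n * \<kappa>\<^sup>2 / 2 + \<kappa>\<^sup>2 / 2" "real (Suc n) * \<bar>\<psi>\<bar> = real n * \<bar>\<psi>\<bar> + \<bar>\<psi>\<bar>"
      by (simp_all add: algebra_simps)
    have Pn: "prob {\<omega> \<in> space M. \<bar>\<theta> * (pn i n \<omega> - pn j n \<omega>)\<bar> \<ge> \<kappa>} = P n" by (simp add: P_def)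
    show ?case
      unfolding sum.lessThan_Suc e
      by (rule lin[OF cos_lead_step[OF ij \<kappa>, of \<theta> n, folded \<phi>_def \<psi>_def, unfolded Pn] Suc]) simp
  qed (simp add: prob_space)
  moreover have "(1 - \<phi>) * (\<Sum>t<n. P t) \<le> (1 - \<phi>) * (\<Sum>t<T. P t)"
    using nT by (intro mult_left_mono \<phi> sum_mono2) (auto simp: P_def)
  moreover have "real n * \<bar>\<psi>\<bar> \<le> real T * \<bar>\<psi>\<bar>" using nT by (intro mult_right_mono) auto
  moreover have "1 - \<kappa>\<^sup>2 / 2 - 2 * P n \<le> ?C n"
  proof -
    have dm: "(\<lambda>\<omega>. \<theta> * (pn i n \<omega> - pn j n \<omega>)) \<in> borel_measurable M"
      by (intro borel_measurable_times borel_measurable_diff borel_measurable_const pn_measurable_M)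
    note [measurable] = dm
    have ep: "Measurable.pred M (\<lambda>\<omega>. \<bar>\<theta> * (pn i n \<omega> - pn j n \<omega>)\<bar> \<ge> \<kappa>)" by measurable
    note ints = integrable_of_bool[OF ep]
    have "1 - \<kappa>\<^sup>2 / 2 - 2 * P n = expectation (\<lambda>\<omega>. 1 - \<kappa>\<^sup>2 / 2 - 2 * of_bool (\<bar>\<theta> * (pn i n \<omega> - pn j n \<omega>)\<bar> \<ge> \<kappa>))"
      unfolding P_def prob_eq_expectation_of_bool[OF ep] using ints by (simp add: prob_space)
    also have "\<dots> \<le> ?C n"
    proof (rule integral_mono)
      show "integrable M (\<lambda>\<omega>. cos (\<theta> * (pn i n \<omega> - pn j n \<omega>)))"
        by (rule integrable_const_bound[of _ 1]) auto
      fix \<omega>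
      let ?d = "\<theta> * (pn i n \<omega> - pn j n \<omega>)"
      show "1 - \<kappa>\<^sup>2 / 2 - 2 * of_bool (\<bar>?d\<bar> \<ge> \<kappa>) \<le> cos ?d"
      proof (cases "\<bar>?d\<bar> \<ge> \<kappa>")
        case True
        have "0 \<le> \<kappa>\<^sup>2 / 2" "of_bool (\<bar>?d\<bar> \<ge> \<kappa>) = (1::real)" using True by simp_all
        then show ?thesis using one_minus_cos_bounds(3)[of ?d] by linarith
      next
        case False
        then have "?d\<^sup>2 \<le> \<kappa>\<^sup>2" using \<kappa> by (simp only: abs_le_square_iff[symmetric] abs_of_nonneg not_le less_imp_le)
        then show ?thesis using False one_minus_cos_bounds(2)[of ?d] unfolding of_bool_def by simp
      qed
    qed (use ints in simp)
    finally show ?thesis .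
  qed
  ultimately show ?thesis unfolding expectation_cnt_eq_sum right_diff_distrib by linarith
qed

end

text \<open>The second half of the range has at least \<open>T / 2\<close> indices and at most the
  whole sum. A late \<open>n\<close> is wanted so that the pulls up to \<open>n\<close> are of order
  \<open>T\<close>.\<close>

lemma ex_le_twice_average:
  fixes p :: "nat \<Rightarrow> real"
  assumes "T > 0" "\<And>t. p t \<ge> 0"
  shows "\<exists>n<T. T div 2 \<le> n \<and> p n \<le> 2 * ((\<Sum>t<T. p t) / real T)"
proof (rule ccontr)
  define G where "G = (\<Sum>t<T. p t) / real T"
  assume "\<not> ?thesis"
  then have big: "2 * G < p n" if "n \<in> {T div 2..<T}" for n using that by (auto simp: G_def not_le)
  have "G \<ge> 0" unfolding G_def using assms by (intro divide_nonneg_nonneg sum_nonneg) auto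
  have "real T * G \<le> real (T - T div 2) * (2 * G)"
  proof -
    have "real T \<le> real (T - T div 2) * 2" by linarith
    from mult_right_mono[OF this \<open>G \<ge> 0\<close>] show ?thesis by (simp only: mult.assoc)
  qed
  also have "\<dots> = (\<Sum>n\<in>{T div 2..<T}. 2 * G)" by simp
  also have "\<dots> < (\<Sum>n\<in>{T div 2..<T}. p n)"
    using assms(1) by (intro sum_strict_mono big) auto
  also have "\<dots> \<le> (\<Sum>t<T. p t)" using assms(2) by (intro sum_mono2) auto
  also have "\<dots> = real T * G" using assms(1) by (simp add: G_def)
  finally show False by simp
qed

section \<open>Contradiction between small differences and growing variance\<close>

context tied_arms
begin

text \<open>By \<open>lead_average\<close> in both directions the difference is small in most
  rounds, yet balanced pulls keep adding variance. In the limit \<open>cos_lead_bound\<close> would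
  read \<open>1 / (8 * m) \<le> \<kappa>\<^sup>2 / 2\<close>, and \<open>\<kappa>\<close> is chosen
  to make the right side \<open>1 / (16 * m)\<close>.\<close>

lemma not_balanced_limit:
  assumes balance: "\<And>b e. b \<in> S \<Longrightarrow> e > 0 \<Longrightarrow>
    (\<lambda>T. prob {\<omega> \<in> space M. \<bar>real (cnt b T \<omega>) / real T - 1 / real (card S)\<bar> > e}) \<longlonglongrightarrow> 0"
  shows False
proof -
  \<comment> \<open>Exchanging \<open>i\<close> and \<open>j\<close> gives the estimate for the
    opposite sign of the difference.\<close>
  interpret swap: tied_arms M K \<mu> \<sigma> D \<xi> Z A S \<mu>s j i
    by unfold_locales (use S \<mu>s i j ij in auto)
  define m where "m = real (card S)"
  have m: "m \<ge> 1" unfolding m_def by (rule card_S)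
  define \<kappa> where "\<kappa> = sqrt (1 / (8 * m))"
  have \<kappa>: "\<kappa> > 0" "\<kappa>\<^sup>2 = 1 / (8 * m)" using m by (simp_all add: \<kappa>_def)
  define P where "P T t = prob {\<omega> \<in> space M. \<bar>1 / sqrt (real T) * (pn i t \<omega> - pn j t \<omega>)\<bar> \<ge> \<kappa>}" for T t
  define G where "G T = (\<Sum>t<T. P T t) / real T" for T
  have G: "G \<longlonglongrightarrow> 0"
  proof (rule tendsto_sandwich[OF _ _ tendsto_const])
    let ?f = "\<lambda>i j T. (\<Sum>t<T. prob {\<omega> \<in> space M. pn i t \<omega> - pn j t \<omega> \<ge> \<kappa> * sqrt (real T)}) / real T"
    show "(\<lambda>T. ?f i j T + ?f j i T) \<longlonglongrightarrow> 0"
      using tendsto_add[OF lead_average[OF balance \<kappa>(1)] swap.lead_average[OF balance \<kappa>(1)]] by simp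
    show "\<forall>\<^sub>F T in sequentially. 0 \<le> G T"
      unfolding G_def P_def by (intro always_eventually allI divide_nonneg_nonneg sum_nonneg) auto
    show "\<forall>\<^sub>F T in sequentially. G T \<le> ?f i j T + ?f j i T"
      using eventually_gt_at_top[of 0]
    proof eventually_elim
      case (elim T)
      have r: "sqrt (real T) > 0" using elim by simp
      have le: "P T t \<le> prob {\<omega> \<in> space M. pn i t \<omega> - pn j t \<omega> \<ge> \<kappa> * sqrt (real T)}
          + prob {\<omega> \<in> space M. pn j t \<omega> - pn i t \<omega> \<ge> \<kappa> * sqrt (real T)}" for t
      proof -
        let ?a = "{\<omega> \<in> space M. pn i t \<omega> - pn j t \<omega> \<ge> \<kappa> * sqrt (real T)}"
        let ?b = "{\<omega> \<in> space M. pn j t \<omega> - pn i t \<omega> \<ge> \<kappa> * sqrt (real T)}"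
        have ms: "?a \<in> sets M" "?b \<in> sets M"
          by (rule sets_gen_algebra_imp[OF indep' index_subset(1) lead_hist]
              sets_gen_algebra_imp[OF indep' index_subset(1) swap.lead_hist])+
        have "{\<omega> \<in> space M. \<bar>1 / sqrt (real T) * (pn i t \<omega> - pn j t \<omega>)\<bar> \<ge> \<kappa>} \<subseteq> ?a \<union> ?b"
        proof safe
          fix \<omega> assume d: "\<kappa> \<le> \<bar>1 / sqrt (real T) * (pn i t \<omega> - pn j t \<omega>)\<bar>" "\<not> \<kappa> * sqrt (real T) \<le> pn j t \<omega> - pn i t \<omega>"
          have "\<kappa> \<le> \<bar>pn i t \<omega> - pn j t \<omega>\<bar> / sqrt (real T)" using d(1) r by (simp add: abs_mult)
          then have "\<kappa> * sqrt (real T) \<le> \<bar>pn i t \<omega> - pn j t \<omega>\<bar>" using r by (simp only: pos_le_divide_eq)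
          then show "\<kappa> * sqrt (real T) \<le> pn i t \<omega> - pn j t \<omega>" using d(2) by linarith
        qed
        then have "P T t \<le> prob (?a \<union> ?b)" unfolding P_def by (intro finite_measure_mono sets.Un ms)
        also have "\<dots> \<le> prob ?a + prob ?b" by (rule measure_Un_le[OF ms])
        finally show ?thesis .
      qed
      then show ?case unfolding G_def add_divide_distrib[symmetric] sum.distrib[symmetric]
        by (intro divide_right_mono sum_mono) auto
    qed
  qed
  have share: "eventually (\<lambda>n. expectation (\<lambda>\<omega>. real (cnt b n \<omega>)) \<ge> 3 / (4 * m) * real n) sequentially" if b: "b \<in> S" for b
  proof -
    have "eventually (\<lambda>n. expectation (\<lambda>\<omega>. \<bar>real (cnt b n \<omega>) / real n - 1 / m\<bar>) < 1 / (4 * m)) sequentially"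
      using m unfolding m_def by (intro order_tendstoD(2)[OF expected_share_deviation[OF balance b]]) auto
    then show ?thesis
      using eventually_gt_at_top[of 0]
    proof eventually_elim
      case (elim n)
      have int: "integrable M (\<lambda>\<omega>. real (cnt b n \<omega>) / real n - 1 / m)"
        using integrable_share_deviation[OF balance] by (simp add: m_def)
      have "- expectation (\<lambda>\<omega>. real (cnt b n \<omega>) / real n - 1 / m) \<le> expectation (\<lambda>\<omega>. \<bar>real (cnt b n \<omega>) / real n - 1 / m\<bar>)"
        using integral_abs_bound[of M "\<lambda>\<omega>. real (cnt b n \<omega>) / real n - 1 / m"] by linarith
      moreover have "expectation (\<lambda>\<omega>. real (cnt b n \<omega>) / real n - 1 / m) = expectation (\<lambda>\<omega>. real (cnt b n \<omega>)) / real n - 1 / m"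
        using integrable_cnt[of b n] by (simp add: prob_space)
      moreover have "1 / (4 * m) = 1 / m / 4" "3 / (4 * m) = 1 / m - 1 / m / 4" by simp_all
      ultimately have "3 / (4 * m) \<le> expectation (\<lambda>\<omega>. real (cnt b n \<omega>)) / real n" using elim(1) by linarith
      then show ?case using elim(2) by (simp only: pos_le_divide_eq of_nat_0_less_iff)
    qed
  qed
  obtain n0 where n0: "\<And>n b. n \<ge> n0 \<Longrightarrow> b \<in> {i, j} \<Longrightarrow> expectation (\<lambda>\<omega>. real (cnt b n \<omega>)) \<ge> 3 / (4 * m) * real n"
    using eventually_conj[OF share[OF i] share[OF j]] unfolding eventually_sequentially by blast
  define \<phi> where "\<phi> T = expectation (\<lambda>\<omega>. cos (1 / sqrt (real T) * \<xi> 1 \<omega>))" for T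
  define \<psi> where "\<psi> T = expectation (\<lambda>\<omega>. sin (1 / sqrt (real T) * \<xi> 1 \<omega>))" for T
  note clt = clt_scale_limits[OF noise_rv[OF order_refl] noise_sq_integrable[OF order_refl]
      noise_integrable[OF order_refl] noise_mean[OF order_refl]]
  have \<phi>: "(\<lambda>T. real T * (1 - \<phi> T)) \<longlonglongrightarrow> 1 / 2" and \<psi>: "(\<lambda>T. real T * \<bar>\<psi> T\<bar>) \<longlonglongrightarrow> 0"
    using clt expectation_noise_sq[OF order_refl] by (simp_all add: \<phi>_def \<psi>_def)
  have "eventually (\<lambda>T. real T * (1 - \<phi> T) > 0) sequentially"
    by (rule order_tendstoD(1)[OF \<phi>]) simp
  then have "eventually (\<lambda>T. real T * (1 - \<phi> T) * (1 / (4 * m) - 2 * G T) \<le> \<kappa>\<^sup>2 / 2 + 4 * G T + real T * \<bar>\<psi> T\<bar>) sequentially"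
    \<comment> \<open>Ensures \<open>T div 2 \<ge> n0\<close> and \<open>T div 2 \<ge> 1\<close>;
      the latter gives \<open>T \<le> 4 * n\<close>.\<close>
    using eventually_ge_at_top[of "2 * n0 + 2"]
  proof eventually_elim
    case (elim T)
    have T0: "T > 0" using elim by simp
    have \<phi>0: "1 - \<phi> T \<ge> 0" using elim(1) T0 by (simp add: zero_less_mult_iff)
    obtain n where n: "n < T" "T div 2 \<le> n" "P T n \<le> 2 * G T"
      using ex_le_twice_average[OF T0, of "P T"] unfolding G_def by (auto simp: P_def)
    have nn: "n \<ge> n0" using n elim by linarith
    have nT: "real T / 4 \<le> real n"
    proof -
      have "real T \<le> 4 * real n" using n elim by linarith
      then show ?thesis by simp
    qed
    have "real T * (1 / (4 * m) - 2 * G T) = 1 / m * (real T / 4) - 2 * (\<Sum>t<T. P T t)"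
      using T0 by (simp add: G_def right_diff_distrib)
    also have "\<dots> \<le> 1 / m * real n - 2 * (\<Sum>t<T. P T t)"
      using m nT by (intro diff_right_mono mult_left_mono) auto
    \<comment> \<open>Two shares of \<open>3 / (4 * m)\<close> exceed \<open>1 / m\<close> by enough
      to pay for \<open>\<kappa>\<^sup>2 / 2\<close>.\<close>
    also have "\<dots> \<le> 3 / (4 * m) * real n + 3 / (4 * m) * real n - real n * \<kappa>\<^sup>2 / 2 - 2 * (\<Sum>t<T. P T t)"
    proof -
      have "3 / (4 * m) * real n = 3 / 4 * (real n / m)" "real n * \<kappa>\<^sup>2 / 2 = 1 / 16 * (real n / m)" "1 / m * real n = real n / m"
        unfolding \<kappa>(2) by simp_all
      moreover have "real n / m \<ge> 0" using m by simp
      ultimately show ?thesis by linarith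
    qed
    also have "\<dots> \<le> expectation (\<lambda>\<omega>. real (cnt i n \<omega>)) + expectation (\<lambda>\<omega>. real (cnt j n \<omega>)) - real n * \<kappa>\<^sup>2 / 2 - 2 * (\<Sum>t<T. P T t)"
      using n0[OF nn, of i] n0[OF nn, of j] by simp
    finally have "(1 - \<phi> T) * (real T * (1 / (4 * m) - 2 * G T)) \<le> (1 - \<phi> T) *
        (expectation (\<lambda>\<omega>. real (cnt i n \<omega>)) + expectation (\<lambda>\<omega>. real (cnt j n \<omega>)) - real n * \<kappa>\<^sup>2 / 2 - 2 * (\<Sum>t<T. P T t))"
      by (rule mult_left_mono[OF _ \<phi>0])
    also have "\<dots> \<le> \<kappa>\<^sup>2 / 2 + 2 * P T n + real T * \<bar>\<psi> T\<bar>"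
      unfolding \<phi>_def \<psi>_def P_def by (rule cos_lead_bound[OF ij]) (use \<kappa> n in auto)
    also have "\<dots> \<le> \<kappa>\<^sup>2 / 2 + 4 * G T + real T * \<bar>\<psi> T\<bar>" using n(3) by linarith
    finally show ?case by (simp only: mult_ac)
  qed
  moreover have "(\<lambda>T. real T * (1 - \<phi> T) * (1 / (4 * m) - 2 * G T)) \<longlonglongrightarrow> 1 / 2 * (1 / (4 * m) - 2 * 0)"
    by (intro tendsto_mult tendsto_diff tendsto_const \<phi> G)
  moreover have "(\<lambda>T. \<kappa>\<^sup>2 / 2 + 4 * G T + real T * \<bar>\<psi> T\<bar>) \<longlonglongrightarrow> \<kappa>\<^sup>2 / 2 + 4 * 0 + 0"
    by (intro tendsto_add tendsto_mult tendsto_const \<psi> G)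
  ultimately have "1 / 2 * (1 / (4 * m) - 2 * 0) \<le> \<kappa>\<^sup>2 / 2 + 4 * 0 + 0"
    by (intro LIMSEQ_le) (auto simp: eventually_sequentially)
  then show False using m unfolding \<kappa>(2) by (simp add: field_simps)
qed

end

section \<open>From stability to balanced counts, and the equivalence\<close>

context adapted_thompson
begin

lemma cnt_ratio_sets: "{\<omega> \<in> space M. \<bar>real (cnt b T \<omega>) / y - 1\<bar> > e} \<in> sets M"
proof -
  note [measurable] = cnt_real_measurable_M[of b T]
  have "Measurable.pred M (\<lambda>\<omega>. \<bar>real (cnt b T \<omega>) / y - 1\<bar> > e)" by measurable
  then show ?thesis by (rule predE)
qed

lemma sum_cnt:
  assumes "\<omega> \<in> space M"
  shows "(\<Sum>b\<in>{1..K}. real (cnt b T \<omega>)) = real T"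
proof -
  have "(\<Sum>b\<in>{1..K}. cnt b T \<omega>) = T"
    unfolding cnt_def
  proof (rule sum_pull_count)
    fix s :: nat assume "1 \<le> s"
    then show "A s \<omega> \<in> {1..K}" using pull_in_arms[OF assms, of "s - 1"] by simp
  qed simp
  then show ?thesis by (simp only: of_nat_sum[symmetric])
qed

text \<open>Each count in \<open>S\<close> is close to \<open>N\<close>, so their sum is close to
  \<open>m * N\<close>; it is also close to \<open>T\<close>, because the rest is negligible.
  Eliminating \<open>N\<close> between the two enlarges the relative error to
  \<open>4 * \<epsilon>\<close>.\<close>

lemma share_near_uniform:
  fixes c :: "nat \<Rightarrow> real" and R :: "nat set"
  assumes "S \<subseteq> R" "finite R" "S \<noteq> {}" and total: "(\<Sum>b\<in>R. c b) = T" and nonneg: "\<And>b. c b \<ge> 0"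
    and \<epsilon>: "0 < \<epsilon>" "\<epsilon> \<le> 1 / 2" and near: "\<And>b. b \<in> S \<Longrightarrow> \<bar>c b / N - 1\<bar> \<le> \<epsilon>"
    and rest: "(\<Sum>b\<in>R - S. c b) \<le> \<epsilon> * T" and b: "b \<in> S"
  shows "\<bar>real (card S) * c b - T\<bar> \<le> 4 * \<epsilon> * T"
proof -
  have finS: "finite S" using assms(1,2) finite_subset by blast
  define m where "m = real (card S)"
  have m: "m \<ge> 1" using finS assms(3) by (simp add: m_def Suc_le_eq card_gt_0_iff)
  \<comment> \<open>\<open>N\<close> is an arbitrary real; a quotient near 1 with nonnegative
    numerator excludes \<open>N \<le> 0\<close>, division by 0 included.\<close>
  have N: "N > 0"
  proof (rule ccontr)
    assume "\<not> N > 0"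
    then have "c b / N \<le> 0" using nonneg[of b] by (simp add: divide_nonneg_nonpos)
    then show False using near[OF b] \<epsilon> by (auto simp: abs_le_iff)
  qed
  have lo: "(1 - \<epsilon>) * N \<le> c b" and hi: "c b \<le> (1 + \<epsilon>) * N" if "b \<in> S" for b
  proof -
    have "1 - \<epsilon> \<le> c b / N" "c b / N \<le> 1 + \<epsilon>" using near[OF that] by (auto simp: abs_le_iff)
    then show "(1 - \<epsilon>) * N \<le> c b" "c b \<le> (1 + \<epsilon>) * N" using N by (simp_all add: pos_le_divide_eq pos_divide_le_eq)
  qed
  have T0: "T \<ge> 0" unfolding total[symmetric] by (intro sum_nonneg nonneg)
  have split: "T = (\<Sum>b\<in>S. c b) + (\<Sum>b\<in>R - S. c b)"
    unfolding total[symmetric] using assms(1,2) by (subst sum.subset_diff[of S R]) auto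
  have rest0: "(\<Sum>b\<in>R - S. c b) \<ge> 0" by (intro sum_nonneg nonneg)
  have "m * ((1 - \<epsilon>) * N) \<le> (\<Sum>b\<in>S. c b)" unfolding m_def using sum_mono[of S "\<lambda>_. (1 - \<epsilon>) * N" c] lo by simp
  then have 1: "(1 - \<epsilon>) * (m * N) \<le> T" using split rest0 by (simp add: mult_ac)
  have "(\<Sum>b\<in>S. c b) \<le> m * ((1 + \<epsilon>) * N)" unfolding m_def using sum_mono[of S c "\<lambda>_. (1 + \<epsilon>) * N"] hi by simp
  then have 2: "(1 - \<epsilon>) * T \<le> (1 + \<epsilon>) * (m * N)" using split rest by (simp add: algebra_simps)
  have mN: "m * N > 0" using m N by simp
  have cm: "(1 - \<epsilon>) * (m * N) \<le> m * c b" "m * c b \<le> (1 + \<epsilon>) * (m * N)"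
    using mult_left_mono[OF lo[OF b], of m] mult_left_mono[OF hi[OF b], of m] m by (simp_all add: mult_ac)
  have "m * c b \<le> (1 + 4 * \<epsilon>) * T"
  proof -
    have "1 + \<epsilon> \<le> (1 + 4 * \<epsilon>) * (1 - \<epsilon>)"
      using mult_left_mono[OF \<epsilon>(2), of "\<epsilon>"] \<epsilon> by (simp add: algebra_simps)
    then have "(1 + \<epsilon>) * (m * N) \<le> (1 + 4 * \<epsilon>) * (1 - \<epsilon>) * (m * N)" using mN by (intro mult_right_mono) auto
    also have "\<dots> \<le> (1 + 4 * \<epsilon>) * T" unfolding mult.assoc using 1 \<epsilon> by (intro mult_left_mono) auto
    finally show ?thesis using cm by linarith
  qed
  moreover have "(1 - 4 * \<epsilon>) * T \<le> m * c b"
  proof -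
    have "(1 + \<epsilon>) * (1 - 4 * \<epsilon>) \<le> (1 - \<epsilon>) * (1 - \<epsilon>)" using \<epsilon> by (simp add: algebra_simps add_nonneg_nonneg)
    then have "(1 + \<epsilon>) * (1 - 4 * \<epsilon>) * T \<le> (1 - \<epsilon>) * (1 - \<epsilon>) * T" using T0 by (rule mult_right_mono)
    also have "\<dots> \<le> (1 - \<epsilon>) * ((1 + \<epsilon>) * (m * N))" unfolding mult.assoc using 2 \<epsilon> by (intro mult_left_mono) auto
    also have "\<dots> = (1 + \<epsilon>) * ((1 - \<epsilon>) * (m * N))" by (simp only: mult_ac)
    also have "\<dots> \<le> (1 + \<epsilon>) * (m * c b)" using cm(1) \<epsilon> by (intro mult_left_mono) auto
    finally have "(1 + \<epsilon>) * ((1 - 4 * \<epsilon>) * T) \<le> (1 + \<epsilon>) * (m * c b)" by (simp only: mult.assoc)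
    then show ?thesis using \<epsilon> by (subst (asm) mult_le_cancel_left_pos) auto
  qed
  ultimately show ?thesis unfolding m_def[symmetric] abs_le_iff by (simp add: algebra_simps)
qed

text \<open>Equal laws let one normaliser serve all arms of \<open>S\<close>. As all counts add up
  to \<open>T\<close> and the remaining arms take a negligible share, that normaliser must be close
  to \<open>T / m\<close>.\<close>

lemma stable_imp_balance:
  assumes S: "S \<subseteq> {1..K}" and a: "a \<in> S" and \<mu>s: "\<And>b. b \<in> S \<Longrightarrow> \<mu> b = \<mu>s"
    and sub: "\<And>b. b \<in> {1..K} - S \<Longrightarrow> \<mu> b < \<mu>s"
    and stable: "tendsto_in_prob M (\<lambda>T \<omega>. real (cnt a T \<omega>) / N T) 1"
    and b: "b \<in> S" and e: "e > 0"
  shows "(\<lambda>T. prob {\<omega> \<in> space M. \<bar>real (cnt b T \<omega>) / real T - 1 / real (card S)\<bar> > e}) \<longlonglongrightarrow> 0"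
proof -
  define \<epsilon> where "\<epsilon> = min (1 / 2) (e / 4)"
  have \<epsilon>: "0 < \<epsilon>" "\<epsilon> \<le> 1 / 2" "4 * \<epsilon> \<le> e" using e by (auto simp: \<epsilon>_def)
  have finS: "finite S" using S finite_subset by auto
  have m: "real (card S) \<ge> 1" using finS a by (auto simp: Suc_le_eq card_gt_0_iff)
  have K0: "real K > 0" using K_ge_1 by simp
  let ?U = "\<lambda>c T. {\<omega> \<in> space M. \<bar>real (cnt c T \<omega>) / N T - 1\<bar> > \<epsilon>}"
  let ?V = "\<lambda>c T. {\<omega> \<in> space M. real (cnt c T \<omega>) > \<epsilon> / real K * real T}"
  have U: "(\<lambda>T. prob (?U c T)) \<longlonglongrightarrow> 0" if c: "c \<in> S" for c
  proof -
    have "prob (?U c T) = prob (?U a T)" for T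
    proof (rule pull_count_law_symmetric[where P = "\<lambda>n. \<bar>real n / N T - 1\<bar> > \<epsilon>"])
      show "c \<in> {1..K}" "a \<in> {1..K}" using S a c by blast+
      show "\<mu> c = \<mu> a" using \<mu>s[OF a] \<mu>s[OF c] by simp
    qed (rule law.sampling_law_axioms)
    then show ?thesis using stable \<epsilon>(1) unfolding tendsto_in_prob_def by simp
  qed
  have V: "(\<lambda>T. prob (?V c T)) \<longlonglongrightarrow> 0" if c: "c \<in> {1..K} - S" for c
  proof (rule suboptimal_count_sublinear[of a c])
    show "\<mu> d \<le> \<mu> a" if "d \<in> {1..K}" for d
      using sub[of d] \<mu>s[of d] \<mu>s[OF a] that by (cases "d \<in> S") auto
    show "\<mu> c < \<mu> a" using sub[OF c] \<mu>s[OF a] by simp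
  qed (use S a c \<epsilon> K0 in auto)
  have lim: "(\<lambda>T. (\<Sum>c\<in>S. prob (?U c T)) + (\<Sum>c\<in>{1..K} - S. prob (?V c T))) \<longlonglongrightarrow> (\<Sum>c\<in>S. 0) + (\<Sum>c\<in>{1..K} - S. 0)"
    by (intro tendsto_add tendsto_sum U V)
  have "eventually (\<lambda>T. prob {\<omega> \<in> space M. \<bar>real (cnt b T \<omega>) / real T - 1 / real (card S)\<bar> > e}
      \<le> (\<Sum>c\<in>S. prob (?U c T)) + (\<Sum>c\<in>{1..K} - S. prob (?V c T))) sequentially"
    using eventually_gt_at_top[of 0]
  proof eventually_elim
    case (elim T)
    have ms: "(\<Union>c\<in>S. ?U c T) \<in> sets M" "(\<Union>c\<in>{1..K} - S. ?V c T) \<in> sets M"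
      using finS by (intro sets.finite_UN cnt_ratio_sets cnt_gt_sets; simp)+
    have "{\<omega> \<in> space M. \<bar>real (cnt b T \<omega>) / real T - 1 / real (card S)\<bar> > e} \<subseteq> (\<Union>c\<in>S. ?U c T) \<union> (\<Union>c\<in>{1..K} - S. ?V c T)"
    proof (rule subsetI, rule ccontr)
      fix \<omega> assume dev: "\<omega> \<in> {\<omega> \<in> space M. \<bar>real (cnt b T \<omega>) / real T - 1 / real (card S)\<bar> > e}"
        and n: "\<omega> \<notin> (\<Union>c\<in>S. ?U c T) \<union> (\<Union>c\<in>{1..K} - S. ?V c T)"
      have \<omega>: "\<omega> \<in> space M" using dev by simp
      have Vn: "real (cnt c T \<omega>) \<le> \<epsilon> / real K * real T" if "c \<in> {1..K} - S" for c
      proof -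
        have "\<omega> \<notin> ?V c T" using n that by blast
        then show ?thesis using \<omega> by (simp add: not_less)
      qed
      have "\<bar>real (card S) * real (cnt b T \<omega>) - real T\<bar> \<le> 4 * \<epsilon> * real T"
      proof (rule share_near_uniform[OF S _ _ sum_cnt[OF \<omega>] _ \<epsilon>(1,2), where N = "N T"])
        show "\<bar>real (cnt c T \<omega>) / N T - 1\<bar> \<le> \<epsilon>" if "c \<in> S" for c
        proof -
          have "\<omega> \<notin> ?U c T" using n that by blast
          then show ?thesis using \<omega> by (simp add: not_less)
        qed
        have "(\<Sum>c\<in>{1..K} - S. real (cnt c T \<omega>)) \<le> real (card ({1..K} - S)) * (\<epsilon> / real K * real T)"
          using sum_mono[of "{1..K} - S" "\<lambda>c. real (cnt c T \<omega>)" "\<lambda>_. \<epsilon> / real K * real T"] Vn by simp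
        also have "\<dots> \<le> real K * (\<epsilon> / real K * real T)"
        proof (rule mult_right_mono)
          have "card ({1..K} - S) \<le> card {1..K}" by (rule card_mono) auto
          then show "real (card ({1..K} - S)) \<le> real K" by simp
        qed (use \<epsilon> K0 in simp)
        also have "\<dots> = \<epsilon> * real T" using K0 by simp
        finally show "(\<Sum>c\<in>{1..K} - S. real (cnt c T \<omega>)) \<le> \<epsilon> * real T" .
      qed (use a b in auto)
      moreover have "real (card S) * real (cnt b T \<omega>) - real T
          = real (card S) * real T * (real (cnt b T \<omega>) / real T - 1 / real (card S))"
        using elim m by (simp add: right_diff_distrib)
      ultimately have "real (card S) * real T * \<bar>real (cnt b T \<omega>) / real T - 1 / real (card S)\<bar> \<le> 4 * \<epsilon> * real T"
        by (simp add: abs_mult)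
      moreover have "real T * e < real (card S) * real T * \<bar>real (cnt b T \<omega>) / real T - 1 / real (card S)\<bar>"
      proof -
        have "real T * e < real T * \<bar>real (cnt b T \<omega>) / real T - 1 / real (card S)\<bar>"
          using dev elim by simp
        also have "\<dots> \<le> real (card S) * (real T * \<bar>real (cnt b T \<omega>) / real T - 1 / real (card S)\<bar>)"
          using mult_right_mono[OF m, of "real T * \<bar>real (cnt b T \<omega>) / real T - 1 / real (card S)\<bar>"] by simp
        finally show ?thesis by (simp only: mult.assoc)
      qed
      moreover have "4 * \<epsilon> * real T \<le> real T * e" using \<epsilon>(3) mult_right_mono[OF \<epsilon>(3), of "real T"] by (simp add: mult.commute)
      ultimately show False by linarith
    qed
    then have "prob {\<omega> \<in> space M. \<bar>real (cnt b T \<omega>) / real T - 1 / real (card S)\<bar> > e}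
        \<le> prob ((\<Union>c\<in>S. ?U c T) \<union> (\<Union>c\<in>{1..K} - S. ?V c T))"
      by (intro finite_measure_mono sets.Un ms)
    also have "\<dots> \<le> prob (\<Union>c\<in>S. ?U c T) + prob (\<Union>c\<in>{1..K} - S. ?V c T)" by (rule measure_Un_le[OF ms])
    also have "\<dots> \<le> (\<Sum>c\<in>S. prob (?U c T)) + (\<Sum>c\<in>{1..K} - S. prob (?V c T))"
      using finS cnt_ratio_sets cnt_gt_sets by (intro add_mono finite_measure_subadditive_finite) auto
    finally show ?case .
  qed
  from tendsto_sandwich[OF always_eventually this tendsto_const lim[unfolded sum.neutral_const add_0]]
  show ?thesis by (simp only: measure_nonneg simp_thms)
qed

text \<open>All other arms together take a negligible share of the \<open>T\<close> pulls, so
  \<open>T\<close> itself is a normaliser.\<close>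

lemma unique_optimal_ratio:
  assumes a: "a \<in> {1..K}" and sub: "\<And>b. b \<in> {1..K} - {a} \<Longrightarrow> \<mu> b < \<mu> a"
  shows "tendsto_in_prob M (\<lambda>T \<omega>. real (cnt a T \<omega>) / real T) 1"
  unfolding tendsto_in_prob_def
proof (intro allI impI)
  fix \<epsilon> :: real assume \<epsilon>: "\<epsilon> > 0"
  have K0: "real K > 0" using K_ge_1 by simp
  let ?V = "\<lambda>c T. {\<omega> \<in> space M. real (cnt c T \<omega>) > \<epsilon> / real K * real T}"
  have V: "(\<lambda>T. prob (?V c T)) \<longlonglongrightarrow> 0" if c: "c \<in> {1..K} - {a}" for c
  proof (rule suboptimal_count_sublinear[of a c])
    show "\<mu> d \<le> \<mu> a" if "d \<in> {1..K}" for d using sub[of d] that by (cases "d = a") auto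
    show "\<mu> c < \<mu> a" by (rule sub[OF c])
  qed (use a c \<epsilon> K0 in auto)
  have lim: "(\<lambda>T. \<Sum>c\<in>{1..K} - {a}. prob (?V c T)) \<longlonglongrightarrow> (\<Sum>c\<in>{1..K} - {a}. 0)"
    by (intro tendsto_sum V)
  have "eventually (\<lambda>T. prob {\<omega> \<in> space M. \<epsilon> < \<bar>real (cnt a T \<omega>) / real T - 1\<bar>} \<le> (\<Sum>c\<in>{1..K} - {a}. prob (?V c T))) sequentially"
    using eventually_gt_at_top[of 0]
  proof eventually_elim
    case (elim T)
    have ms: "(\<Union>c\<in>{1..K} - {a}. ?V c T) \<in> sets M"
      by (intro sets.finite_UN cnt_gt_sets) simp
    have "{\<omega> \<in> space M. \<epsilon> < \<bar>real (cnt a T \<omega>) / real T - 1\<bar>} \<subseteq> (\<Union>c\<in>{1..K} - {a}. ?V c T)"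
    proof (rule subsetI, rule ccontr)
      fix \<omega> assume dev: "\<omega> \<in> {\<omega> \<in> space M. \<epsilon> < \<bar>real (cnt a T \<omega>) / real T - 1\<bar>}" and n: "\<omega> \<notin> (\<Union>c\<in>{1..K} - {a}. ?V c T)"
      have \<omega>: "\<omega> \<in> space M" using dev by simp
      have Vn: "real (cnt c T \<omega>) \<le> \<epsilon> / real K * real T" if "c \<in> {1..K} - {a}" for c
      proof -
        have "\<omega> \<notin> ?V c T" using n that by blast
        then show ?thesis using \<omega> by (simp add: not_less)
      qed
      have "(\<Sum>c\<in>{1..K} - {a}. real (cnt c T \<omega>)) \<le> real (card ({1..K} - {a})) * (\<epsilon> / real K * real T)"
        using sum_mono[of "{1..K} - {a}" "\<lambda>c. real (cnt c T \<omega>)" "\<lambda>_. \<epsilon> / real K * real T"] Vn by simp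
      also have "\<dots> \<le> real K * (\<epsilon> / real K * real T)"
      proof (rule mult_right_mono)
        have "card ({1..K} - {a}) \<le> card {1..K}" by (rule card_mono) auto
        then show "real (card ({1..K} - {a})) \<le> real K" by simp
      qed (use \<epsilon> K0 in simp)
      also have "\<dots> = \<epsilon> * real T" using K0 by simp
      finally have "real T - real (cnt a T \<omega>) \<le> \<epsilon> * real T"
        using sum_cnt[OF \<omega>, of T] sum.remove[OF _ a, of "\<lambda>c. real (cnt c T \<omega>)"] by simp
      moreover have "real (cnt a T \<omega>) \<le> real T" using cnt_le[of a T \<omega>] by simp
      ultimately have "\<bar>real (cnt a T \<omega>) - real T\<bar> \<le> \<epsilon> * real T" by simp
      moreover have "real (cnt a T \<omega>) - real T = real T * (real (cnt a T \<omega>) / real T - 1)"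
        using elim by (simp add: right_diff_distrib)
      ultimately have "real T * \<bar>real (cnt a T \<omega>) / real T - 1\<bar> \<le> real T * \<epsilon>" by (simp add: abs_mult mult.commute)
      then have "\<bar>real (cnt a T \<omega>) / real T - 1\<bar> \<le> \<epsilon>" using elim by (subst (asm) mult_le_cancel_left_pos) auto
      then show False using dev by simp
    qed
    then have "prob {\<omega> \<in> space M. \<epsilon> < \<bar>real (cnt a T \<omega>) / real T - 1\<bar>} \<le> prob (\<Union>c\<in>{1..K} - {a}. ?V c T)"
      by (rule finite_measure_mono[OF _ ms])
    also have "\<dots> \<le> (\<Sum>c\<in>{1..K} - {a}. prob (?V c T))"
      using cnt_gt_sets by (intro finite_measure_subadditive_finite) auto
    finally show ?case .
  qed
  from tendsto_sandwich[OF always_eventually this tendsto_const lim[unfolded sum.neutral_const]]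
  show "(\<lambda>T. prob {\<omega> \<in> space M. \<epsilon> < \<bar>real (cnt a T \<omega>) / real T - 1\<bar>}) \<longlonglongrightarrow> 0"
    by (simp only: measure_nonneg simp_thms)
qed

theorem stable_arm_iff:
  assumes a: "a \<in> {1..K}"
  shows "stable_arm M A a \<longleftrightarrow> a \<in> suboptimal_arms K \<mu> \<or> optimal_arms K \<mu> = {a}"
proof -
  have best: "\<mu> b \<le> best_mean K \<mu>" if "b \<in> {1..K}" for b
    unfolding best_mean_def using that by (intro Max_ge) auto
  have "best_mean K \<mu> \<in> \<mu> ` {1..K}" unfolding best_mean_def using a by (intro Max_in) auto
  then obtain i where i: "i \<in> {1..K}" "\<mu> i = best_mean K \<mu>" by auto
  have stable_cnt: "stable_arm M A a \<longleftrightarrow> (\<exists>N. tendsto_in_prob M (\<lambda>T \<omega>. real (cnt a T \<omega>) / N T) 1)"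
    unfolding stable_arm_def cnt_def ..
  show ?thesis
  proof
    assume "a \<in> suboptimal_arms K \<mu> \<or> optimal_arms K \<mu> = {a}"
    then show "stable_arm M A a"
    proof
      assume "a \<in> suboptimal_arms K \<mu>"
      then have gp: "\<mu> a < \<mu> i" using i by (simp add: suboptimal_arms_def gap_def)
      have le: "\<mu> b \<le> \<mu> i" if "b \<in> {1..K}" for b using best[OF that] i(2) by simp
      have "tendsto_in_prob M (\<lambda>T \<omega>. real (cnt a T \<omega>) / nstar (\<mu> i - \<mu> a) T) 1"
        by (rule suboptimal_count_ratio[OF i(1) a _ gp]) (erule le)
      then show ?thesis unfolding stable_cnt by (rule exI[of _ "nstar (\<mu> i - \<mu> a)"])
    next
      assume opt: "optimal_arms K \<mu> = {a}"
      then have "a \<in> optimal_arms K \<mu>" by simp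
      then have \<mu>a: "\<mu> a = best_mean K \<mu>" by (simp add: optimal_arms_def gap_def)
      have lt: "\<mu> b < \<mu> a" if b: "b \<in> {1..K} - {a}" for b
      proof -
        have "b \<notin> optimal_arms K \<mu>" unfolding opt using b by blast
        then have "best_mean K \<mu> - \<mu> b \<noteq> 0" using b by (simp add: optimal_arms_def gap_def)
        then show ?thesis using best[of b] b \<mu>a by force
      qed
      have "tendsto_in_prob M (\<lambda>T \<omega>. real (cnt a T \<omega>) / real T) 1"
        by (rule unique_optimal_ratio[OF a]) (erule lt)
      then show ?thesis unfolding stable_cnt by (rule exI[of _ real])
    qed
  next
    assume st: "stable_arm M A a"
    show "a \<in> suboptimal_arms K \<mu> \<or> optimal_arms K \<mu> = {a}"
    proof (rule ccontr)
      assume neg: "\<not> ?thesis"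
      define S where "S = optimal_arms K \<mu>"
      have opt: "S \<subseteq> {1..K}" "\<And>b. b \<in> S \<Longrightarrow> \<mu> b = best_mean K \<mu>" by (auto simp: S_def optimal_arms_def gap_def)
      have aS: "a \<in> S" using neg a best[OF a] by (auto simp: S_def optimal_arms_def suboptimal_arms_def gap_def)
      then obtain j where j: "j \<in> S" "j \<noteq> a" using neg by (auto simp: S_def)
      have sub: "\<mu> b < best_mean K \<mu>" if "b \<in> {1..K} - S" for b
      proof -
        have "best_mean K \<mu> - \<mu> b \<noteq> 0" using that by (simp add: S_def optimal_arms_def gap_def)
        then show ?thesis using that best[of b] by force
      qed
      interpret tied_arms M K \<mu> \<sigma> D \<xi> Z A S "best_mean K \<mu>" a j
        by unfold_locales (use opt aS j in auto)
      obtain N where N: "tendsto_in_prob M (\<lambda>T \<omega>. real (cnt a T \<omega>) / N T) 1" using st unfolding stable_cnt by blast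
      show False
        by (rule not_balanced_limit, rule stable_imp_balance[OF opt(1) aS _ _ N]; (assumption | erule opt(2) | erule sub))
    qed
  qed
qed

end

lemma (in thompson_sampling) sampling_law_samples:
  assumes "1 \<le> K" "condition_B1 D" "condition_B2 D"
  shows "sampling_law D"
proof -
  have eq: "distr M borel (Z 1 1) = D" by (rule sample_law) (use assms in auto)
  have "real_distribution (distr M borel (Z 1 1))"
    by (rule real_distribution_distr, rule sample_rv) (use assms in auto)
  then have "real_distribution D" unfolding eq .
  then show ?thesis using assms by (simp add: sampling_law_def sampling_law_axioms_def)
qed

theorem corollary2p9:
  fixes M :: "'w measure"
    and K :: nat
    and \<mu> :: "nat \<Rightarrow> real"
    and \<sigma> :: real
    and D :: "real measure"
    and \<xi> :: "nat \<Rightarrow> 'w \<Rightarrow> real"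
    and Z :: "nat \<Rightarrow> nat \<Rightarrow> 'w \<Rightarrow> real"
    and A :: "nat \<Rightarrow> 'w \<Rightarrow> nat"
    and a :: nat
  assumes "thompson_sampling M K \<mu> \<sigma> D \<xi> Z A"
    and "condition_B1 D"
    and "condition_B2 D"
    and "a \<in> {1..K}"
  shows "stable_arm M A a \<longleftrightarrow> a \<in> suboptimal_arms K \<mu> \<or> optimal_arms K \<mu> = {a}"
proof -
  interpret thompson_sampling M K \<mu> \<sigma> D \<xi> Z A by (rule assms(1))
  have K: "1 \<le> K" using assms(4) by simp
  have law: "sampling_law D" by (rule sampling_law_samples[OF K assms(2,3)])
  interpret C: adapted_thompson M K \<mu> \<sigma> D \<xi> Z canonical_arm
    by (rule adapted_thompson_canonical[OF K law])
  \<comment> \<open>Stability speaks only of the laws of the individual counts, so it passes from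
    the given run to the adapted one.\<close>
  have "stable_arm M A a \<longleftrightarrow> stable_arm M canonical_arm a"
    unfolding stable_arm_def tendsto_in_prob_def
    using pull_count_law[OF C.thompson_sampling_axioms K law, where b = a
        and P = "\<lambda>n. \<bar>real n / N - 1\<bar> > \<epsilon>" for N \<epsilon>] by simp
  then show ?thesis using C.stable_arm_iff[OF assms(4)] by simp
qed

end
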